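(* Let $\gamma\in\partial\mathbb{D}$. There is a unique $*$-isomorphism $\Gamma: C([0,1])\to C^*(\mathbb{P}_\gamma)/\mathcal{K}$ such that $\Gamma(t^a)=[C_{\rho_a}]$ for all complex $a$ with $\mathrm{Re}\,a>0$.
   Context: $\mathbb{D}$ is the open unit disk and $H^2$ is the Hardy space of $\mathbb{D}$. For an analytic self-map $\psi$ of $\mathbb{D}$, $C_\psi f=f\circ\psi$ is the (bounded) composition operator on $H^2$. $\mathcal{K}$ is the ideal of compact operators on $H^2$, and $[T]$ is the coset of $T$ modulo $\mathcal{K}$. For $\gamma\in\partial\mathbb{D}$ and $a\in\mathbb{C}$ with $\mathrm{Re}\,a\ge 0$, $\rho_a=\rho_{\gamma,a}$ is the linear-fractional self-map of $\mathbb{D}$ fixing $\gamma$ which is conjugate, via the map $z\mapsto(\gamma+z)/(\gamma-z)$ of $\mathbb{D}$ onto the right half-plane, to the translation $w\mapsto w+a$; $a$ is its translation number. For $\mathrm{Re}\,a>0$ these are exactly the parabolic non-automorphisms of $\mathbb{D}$ fixing $\gamma$. $\mathbb{P}_\gamma=\{C_{\rho_{\gamma,a}}:\mathrm{Re}\,a>0\}$ and $C^*(\mathbb{P}_\gamma)$ is the unital $C^*$-algebra generated by $\mathbb{P}_\gamma$; it contains $\mathcal{K}$. $C([0,1])$ is the $C^*$-algebra of continuous complex functions on $[0,1]$, and $t^a$ denotes the function $t\mapsto t^a=e^{a\log t}$ for $t\in(0,1]$, with value $0$ at $t=0$. *)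

theory Defs
  imports
    "HOL-Complex_Analysis.Complex_Analysis"
    "HOL-Algebra.Module"
    "HOL-Algebra.QuotRing"
begin

section \<open>The Hardy space of the unit disk\<close>

definition taylor_coeff :: "(complex \<Rightarrow> complex) \<Rightarrow> nat \<Rightarrow> complex"
  where "taylor_coeff f n = (deriv ^^ n) f 0 / fact n"

text \<open>Elements of the Hardy space are analytic functions on the open disk with square-summable
  Taylor coefficients.  Since HOL functions are total, the values off the disk are set to 0,
  so that equality of elements is equality of functions on the disk.\<close>

definition hardy_functions :: "(complex \<Rightarrow> complex) set"
  where "hardy_functions = {f. f holomorphic_on ball 0 1 \<and> (\<forall>z. z \<notin> ball 0 1 \<longrightarrow> f z = 0) \<and>
           summable (\<lambda>n. (cmod (taylor_coeff f n))\<^sup>2)}"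

lemma taylor_coeff_zero: "taylor_coeff (\<lambda>z. 0) n = 0"
  unfolding taylor_coeff_def by simp

lemma taylor_coeff_add:
  assumes "f holomorphic_on ball 0 1" "g holomorphic_on ball 0 1"
  shows "taylor_coeff (\<lambda>z. f z + g z) n = taylor_coeff f n + taylor_coeff g n"
  unfolding taylor_coeff_def using higher_deriv_add[OF assms, of 0 n]
  by (simp add: add_divide_distrib)

lemma taylor_coeff_cmult:
  assumes "f holomorphic_on ball 0 1"
  shows "taylor_coeff (\<lambda>z. c * f z) n = c * taylor_coeff f n"
  unfolding taylor_coeff_def using higher_deriv_cmult[OF assms, of 0 n c] by simp

lemma summable_norm_square_add:
  fixes a b :: "nat \<Rightarrow> complex"
  assumes "summable (\<lambda>n. (cmod (a n))\<^sup>2)" "summable (\<lambda>n. (cmod (b n))\<^sup>2)"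
  shows "summable (\<lambda>n. (cmod (a n + b n))\<^sup>2)"
proof (rule summable_comparison_test')
  show "summable (\<lambda>n. 2 * (cmod (a n))\<^sup>2 + 2 * (cmod (b n))\<^sup>2)"
    using assms by (intro summable_add summable_mult)
  fix n :: nat
  have "(cmod (a n + b n))\<^sup>2 \<le> (cmod (a n) + cmod (b n))\<^sup>2"
    by (intro power_mono norm_triangle_ineq) simp
  also have "\<dots> \<le> 2 * (cmod (a n))\<^sup>2 + 2 * (cmod (b n))\<^sup>2"
    using sum_squares_bound[of "cmod (a n)" "cmod (b n)"] by (simp add: power2_sum)
  finally show "norm ((cmod (a n + b n))\<^sup>2) \<le> 2 * (cmod (a n))\<^sup>2 + 2 * (cmod (b n))\<^sup>2"
    by simp
qed

lemma hardy_functions_zero: "(\<lambda>z. 0) \<in> hardy_functions"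
  by (simp add: hardy_functions_def taylor_coeff_zero)

lemma hardy_functions_add:
  assumes "f \<in> hardy_functions" "g \<in> hardy_functions"
  shows "(\<lambda>z. f z + g z) \<in> hardy_functions"
  using assms
  by (auto simp: hardy_functions_def taylor_coeff_add
      intro!: holomorphic_intros summable_norm_square_add)

lemma hardy_functions_cmult:
  assumes "f \<in> hardy_functions"
  shows "(\<lambda>z. c * f z) \<in> hardy_functions"
  using assms
  by (auto simp: hardy_functions_def taylor_coeff_cmult norm_mult power_mult_distrib
      intro!: holomorphic_intros summable_mult)

typedef h2 = hardy_functions
  by (rule exI, rule hardy_functions_zero)

setup_lifting type_definition_h2

lemma holomorphic_Rep_h2: "Rep_h2 f holomorphic_on ball 0 1"
  using Rep_h2[of f] by (simp add: hardy_functions_def)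

lift_definition scaleC_h2 :: "complex \<Rightarrow> h2 \<Rightarrow> h2" is "\<lambda>c f z. c * f z"
  by (rule hardy_functions_cmult)

abbreviation h2_coeff :: "h2 \<Rightarrow> nat \<Rightarrow> complex"
  where "h2_coeff f \<equiv> taylor_coeff (Rep_h2 f)"

lemma summable_h2_coeff: "summable (\<lambda>n. (cmod (h2_coeff f n))\<^sup>2)"
  using Rep_h2[of f] by (simp add: hardy_functions_def)

definition cinner_h2 :: "h2 \<Rightarrow> h2 \<Rightarrow> complex"
  where "cinner_h2 f g = (\<Sum>n. h2_coeff f n * cnj (h2_coeff g n))"

lemma summable_cinner_h2: "summable (\<lambda>n. h2_coeff f n * cnj (h2_coeff g n))"
proof (rule summable_comparison_test')
  show "summable (\<lambda>n. (cmod (h2_coeff f n))\<^sup>2 + (cmod (h2_coeff g n))\<^sup>2)"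
    by (intro summable_add summable_h2_coeff)
  fix n :: nat
  have "0 \<le> cmod (h2_coeff f n) * cmod (h2_coeff g n)" by simp
  then show "cmod (h2_coeff f n * cnj (h2_coeff g n))
      \<le> (cmod (h2_coeff f n))\<^sup>2 + (cmod (h2_coeff g n))\<^sup>2"
    using sum_squares_bound[of "cmod (h2_coeff f n)" "cmod (h2_coeff g n)"]
    unfolding norm_mult complex_mod_cnj by linarith
qed

instantiation h2 :: real_vector
begin

lift_definition zero_h2 :: h2 is "\<lambda>z. 0"
  by (rule hardy_functions_zero)

lift_definition plus_h2 :: "h2 \<Rightarrow> h2 \<Rightarrow> h2" is "\<lambda>f g z. f z + g z"
  by (rule hardy_functions_add)

definition "- f = scaleC_h2 (- 1) f" for f :: h2

definition "f - g = f + (- g)" for f g :: h2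

definition "r *\<^sub>R f = scaleC_h2 (of_real r) f" for f :: h2

instance
  by standard
    (simp_all add: uminus_h2_def minus_h2_def scaleR_h2_def, (transfer, simp add: algebra_simps)+)

end

lemma Rep_h2_plus: "Rep_h2 (f + g) = (\<lambda>z. Rep_h2 f z + Rep_h2 g z)"
  by transfer simp

lemma h2_coeff_zero [simp]: "h2_coeff 0 n = 0"
  by (simp add: zero_h2.rep_eq taylor_coeff_zero)

lemma h2_coeff_add: "h2_coeff (f + g) n = h2_coeff f n + h2_coeff g n"
  by (simp add: Rep_h2_plus taylor_coeff_add holomorphic_Rep_h2)

lemma h2_coeff_scaleC: "h2_coeff (scaleC_h2 c f) n = c * h2_coeff f n"
  by (simp add: scaleC_h2.rep_eq taylor_coeff_cmult holomorphic_Rep_h2)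

lemma h2_eq_0I:
  assumes "\<And>n. h2_coeff f n = 0"
  shows "f = 0"
proof -
  have "Rep_h2 f z = 0" for z
  proof (cases "z \<in> ball 0 1")
    case True
    then show ?thesis
      using assms
      by (intro holomorphic_fun_eq_0_on_ball[OF holomorphic_Rep_h2])
         (auto simp: taylor_coeff_def)
  next
    case False
    then show ?thesis using Rep_h2[of f] by (simp add: hardy_functions_def)
  qed
  then show ?thesis by (simp add: Rep_h2_inject[symmetric] zero_h2.rep_eq fun_eq_iff)
qed

lemma cinner_h2_add_left: "cinner_h2 (f + g) h = cinner_h2 f h + cinner_h2 g h"
  unfolding cinner_h2_def h2_coeff_add distrib_right
  by (intro suminf_add[symmetric] summable_cinner_h2)

lemma cinner_h2_scaleC_left: "cinner_h2 (scaleC_h2 c f) h = c * cinner_h2 f h"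
  unfolding cinner_h2_def h2_coeff_scaleC mult.assoc
  by (intro suminf_mult summable_cinner_h2)

lemma cinner_h2_commute: "cinner_h2 f g = cnj (cinner_h2 g f)"
proof -
  have "(\<lambda>n. cnj (h2_coeff g n * cnj (h2_coeff f n))) sums cnj (cinner_h2 g f)"
    unfolding sums_cnj cinner_h2_def by (intro summable_sums summable_cinner_h2)
  then show ?thesis
    unfolding cinner_h2_def[of f g] by (simp add: sums_iff mult.commute)
qed

lemma cinner_h2_self: "cinner_h2 f f = of_real (\<Sum>n. (cmod (h2_coeff f n))\<^sup>2)"
  unfolding cinner_h2_def complex_norm_square[symmetric]
  by (rule suminf_of_real[OF summable_h2_coeff, symmetric])

text \<open>The real inner product below is the real part of the complex one; it induces the Hardy
  space norm and makes the bounded real-linear operators available as \<^typ>\<open>h2 \<Rightarrow>\<^sub>L h2\<close>.\<close>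

instantiation h2 :: real_inner
begin

definition "inner f g = Re (cinner_h2 f g)" for f g :: h2
definition "norm f = sqrt (inner f f)" for f :: h2
definition "sgn f = f /\<^sub>R norm f" for f :: h2
definition "dist f g = norm (f - g)" for f g :: h2
definition "uniformity = (INF e\<in>{0<..}. principal {(f :: h2, g). dist f g < e})"
definition "open U = (\<forall>f\<in>U. eventually (\<lambda>(f', g). f' = f \<longrightarrow> g \<in> U) uniformity)" for U :: "h2 set"

instance
proof
  fix f g h :: h2 and r :: real
  show "inner f g = inner g f"
    by (metis inner_h2_def cinner_h2_commute complex_cnj cnj.simps(1))
  show "inner (f + g) h = inner f h + inner g h"
    by (simp add: inner_h2_def cinner_h2_add_left)
  show "inner (r *\<^sub>R f) g = r * inner f g"
    by (simp add: inner_h2_def cinner_h2_scaleC_left scaleR_h2_def)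
  show nonneg: "0 \<le> inner f f"
    by (simp add: inner_h2_def cinner_h2_self suminf_nonneg summable_h2_coeff)
  show "inner f f = 0 \<longleftrightarrow> f = 0"
  proof
    assume "inner f f = 0"
    then have "(\<Sum>n. (cmod (h2_coeff f n))\<^sup>2) = 0"
      by (simp add: inner_h2_def cinner_h2_self)
    then have "(cmod (h2_coeff f n))\<^sup>2 = 0" for n
      using suminf_eq_zero_iff[OF summable_h2_coeff, of f] by auto
    then show "f = 0" by (intro h2_eq_0I) simp
  next
    assume "f = 0"
    then show "inner f f = 0" by (simp add: inner_h2_def cinner_h2_self)
  qed
qed (rule norm_h2_def sgn_h2_def dist_h2_def uniformity_h2_def open_h2_def)+

end

lemma norm_scaleC_h2: "norm (scaleC_h2 c f) = cmod c * norm f"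
proof -
  have "cinner_h2 (scaleC_h2 c f) (scaleC_h2 c f) = of_real ((cmod c)\<^sup>2) * cinner_h2 f f"
    unfolding cinner_h2_scaleC_left
    by (subst cinner_h2_commute)
       (simp add: cinner_h2_scaleC_left cinner_h2_self complex_norm_square del: of_real_power)
  then show ?thesis
    by (simp add: norm_h2_def inner_h2_def real_sqrt_mult)
qed

lemma bounded_linear_scaleC_h2: "bounded_linear (scaleC_h2 c)"
proof (rule bounded_linear_intro[where K = "cmod c"])
  show "scaleC_h2 c (f + g) = scaleC_h2 c f + scaleC_h2 c g" for f g
    by transfer (simp add: algebra_simps)
  show "scaleC_h2 c (r *\<^sub>R f) = r *\<^sub>R scaleC_h2 c f" for r f
    unfolding scaleR_h2_def by transfer (simp add: algebra_simps)
  show "norm (scaleC_h2 c f) \<le> norm f * cmod c" for f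
    by (simp add: norm_scaleC_h2)
qed


section \<open>Operators on the Hardy space\<close>

text \<open>\<^typ>\<open>h2 \<Rightarrow>\<^sub>L h2\<close> only enforces boundedness and real linearity, so complex linearity
  is imposed separately.\<close>

definition bounded_operators :: "(h2 \<Rightarrow>\<^sub>L h2) set"
  where "bounded_operators =
    {T. \<forall>c f. blinfun_apply T (scaleC_h2 c f) = scaleC_h2 c (blinfun_apply T f)}"

definition compact_operators :: "(h2 \<Rightarrow>\<^sub>L h2) set"
  where "compact_operators =
    {T \<in> bounded_operators. compact (closure (blinfun_apply T ` cball 0 1))}"

definition op_scaleC :: "complex \<Rightarrow> (h2 \<Rightarrow>\<^sub>L h2) \<Rightarrow> (h2 \<Rightarrow>\<^sub>L h2)"
  where "op_scaleC c T = Blinfun (scaleC_h2 c) o\<^sub>L T"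

lemma op_scaleC_apply: "blinfun_apply (op_scaleC c T) f = scaleC_h2 c (blinfun_apply T f)"
  by (simp add: op_scaleC_def bounded_linear_Blinfun_apply bounded_linear_scaleC_h2)

definition op_adjoint :: "(h2 \<Rightarrow>\<^sub>L h2) \<Rightarrow> (h2 \<Rightarrow>\<^sub>L h2)"
  where "op_adjoint T =
    (THE S. \<forall>f g. cinner_h2 (blinfun_apply T f) g = cinner_h2 f (blinfun_apply S g))"

text \<open>For an analytic self-map \<open>\<psi>\<close> of the disk the operator below exists by Littlewood's
  subordination theorem.\<close>

definition composition_operator :: "(complex \<Rightarrow> complex) \<Rightarrow> (h2 \<Rightarrow>\<^sub>L h2)"
  where "composition_operator \<psi> =
    (THE T. \<forall>f. \<forall>z\<in>ball 0 1. Rep_h2 (blinfun_apply T f) z = Rep_h2 f (\<psi> z))"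


section \<open>Parabolic maps\<close>

definition cayley :: "complex \<Rightarrow> complex \<Rightarrow> complex"
  where "cayley \<gamma> z = (\<gamma> + z) / (\<gamma> - z)"

definition cayley_inv :: "complex \<Rightarrow> complex \<Rightarrow> complex"
  where "cayley_inv \<gamma> w = \<gamma> * (w - 1) / (w + 1)"

lemma Re_cayley_pos:
  assumes "cmod \<gamma> = 1" "z \<in> ball 0 1"
  shows "Re (cayley \<gamma> z) > 0"
proof -
  have ne: "\<gamma> - z \<noteq> 0" using assms by auto
  have "Re ((\<gamma> + z) * cnj (\<gamma> - z)) = (cmod \<gamma>)\<^sup>2 - (cmod z)\<^sup>2"
    unfolding cmod_power2 by (simp add: algebra_simps power2_eq_square)
  moreover have "(cmod z)\<^sup>2 < 1"
    using assms by (simp add: abs_square_less_1)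
  ultimately have "Re ((\<gamma> + z) * cnj (\<gamma> - z)) > 0" using assms by simp
  moreover have "(\<gamma> + z) / (\<gamma> - z) = (\<gamma> + z) * cnj (\<gamma> - z) / of_real ((cmod (\<gamma> - z))\<^sup>2)"
    by (rule complex_div_cnj)
  ultimately show ?thesis
    using ne unfolding cayley_def by (simp add: Re_divide_of_real del: Re_divide of_real_power)
qed

lemma cayley_cayley_inv:
  assumes "cmod \<gamma> = 1" "Re w > 0"
  shows "cayley \<gamma> (cayley_inv \<gamma> w) = w" "cayley_inv \<gamma> w \<in> ball 0 1"
proof -
  have g: "\<gamma> \<noteq> 0" using assms by auto
  have w: "w + 1 \<noteq> 0"
  proof
    assume "w + 1 = 0"
    then have "Re (w + 1) = 0" by simp
    with assms(2) show False by simp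
  qed
  have 1: "\<gamma> + cayley_inv \<gamma> w = 2 * \<gamma> * w / (w + 1)" "\<gamma> - cayley_inv \<gamma> w = 2 * \<gamma> / (w + 1)"
    using w unfolding cayley_inv_def by (simp_all add: field_simps)
  show "cayley \<gamma> (cayley_inv \<gamma> w) = w"
    unfolding cayley_def 1 using g w by simp
  have "(cmod (w - 1))\<^sup>2 < (cmod (w + 1))\<^sup>2"
    using assms(2) unfolding cmod_power2 by (simp add: power2_eq_square algebra_simps)
  then have "cmod (w - 1) < cmod (w + 1)"
    by (rule power_less_imp_less_base) simp
  then show "cayley_inv \<gamma> w \<in> ball 0 1"
    using assms(1) w by (simp add: cayley_inv_def norm_mult norm_divide divide_less_eq_1)
qed

text \<open>Only the values on the open disk matter; at the boundary fixed point \<open>\<gamma>\<close> the formula divides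
  by zero.\<close>

definition parabolic_map :: "complex \<Rightarrow> complex \<Rightarrow> complex \<Rightarrow> complex"
  where "parabolic_map \<gamma> a z = cayley_inv \<gamma> (cayley \<gamma> z + a)"

lemma parabolic_map_conjugate:
  assumes "cmod \<gamma> = 1" "0 \<le> Re a" "z \<in> ball 0 1"
  shows "parabolic_map \<gamma> a z \<in> ball 0 1"
    and "cayley \<gamma> (parabolic_map \<gamma> a z) = cayley \<gamma> z + a"
  using cayley_cayley_inv[of \<gamma> "cayley \<gamma> z + a"] Re_cayley_pos[of \<gamma> z] assms
  by (simp_all add: parabolic_map_def)


section \<open>Star algebras\<close>

record 'a star_algebra = "(complex, 'a) module" +
  star :: "'a \<Rightarrow> 'a"

definition quotient_star_algebra ::
    "('a, 'm) star_algebra_scheme \<Rightarrow> 'a set \<Rightarrow> 'a set star_algebra"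
  where "quotient_star_algebra A I =
    \<lparr>carrier = carrier (A Quot I),
     mult = mult (A Quot I),
     one = one (A Quot I),
     zero = zero (A Quot I),
     add = add (A Quot I),
     smult = (\<lambda>c X. \<Union>x\<in>X. I +>\<^bsub>A\<^esub> (c \<odot>\<^bsub>A\<^esub> x)),
     star = (\<lambda>X. \<Union>x\<in>X. I +>\<^bsub>A\<^esub> star A x)\<rparr>"

definition star_iso ::
    "('a, 'm) star_algebra_scheme \<Rightarrow> ('b, 'n) star_algebra_scheme \<Rightarrow> ('a \<Rightarrow> 'b) set"
  where "star_iso A B =
    {h \<in> ring_iso A B.
       (\<forall>c. \<forall>x\<in>carrier A. h (c \<odot>\<^bsub>A\<^esub> x) = c \<odot>\<^bsub>B\<^esub> h x) \<and>
       (\<forall>x\<in>carrier A. h (star A x) = star B (h x))}"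

definition C01 :: "(real \<Rightarrow> complex) star_algebra"
  where "C01 =
    \<lparr>carrier = {f \<in> extensional {0..1}. continuous_on {0..1} f},
     mult = (\<lambda>f g. \<lambda>t\<in>{0..1}. f t * g t),
     one = (\<lambda>t\<in>{0..1}. 1),
     zero = (\<lambda>t\<in>{0..1}. 0),
     add = (\<lambda>f g. \<lambda>t\<in>{0..1}. f t + g t),
     smult = (\<lambda>c f. \<lambda>t\<in>{0..1}. c * f t),
     star = (\<lambda>f. \<lambda>t\<in>{0..1}. cnj (f t))\<rparr>"

text \<open>The library's complex power satisfies \<open>0 powr a = 0\<close>, and \<open>t powr a = exp (a * ln t)\<close>
  for \<open>t > 0\<close>.\<close>

definition power_function :: "complex \<Rightarrow> real \<Rightarrow> complex"
  where "power_function a = (\<lambda>t\<in>{0..1}. complex_of_real t powr a)"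

text \<open>Closedness refers to the operator norm topology of \<^typ>\<open>h2 \<Rightarrow>\<^sub>L h2\<close>.\<close>

definition unital_cstar_subalgebra :: "(h2 \<Rightarrow>\<^sub>L h2) set \<Rightarrow> bool"
  where "unital_cstar_subalgebra A \<longleftrightarrow>
    A \<subseteq> bounded_operators \<and> closed A \<and> id_blinfun \<in> A \<and>
    (\<forall>S\<in>A. \<forall>T\<in>A. S + T \<in> A \<and> S o\<^sub>L T \<in> A) \<and>
    (\<forall>c. \<forall>T\<in>A. op_scaleC c T \<in> A) \<and>
    (\<forall>T\<in>A. op_adjoint T \<in> A)"

definition cstar_generated :: "(h2 \<Rightarrow>\<^sub>L h2) set \<Rightarrow> (h2 \<Rightarrow>\<^sub>L h2) set"
  where "cstar_generated P = \<Inter>{A. unital_cstar_subalgebra A \<and> P \<subseteq> A}"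

definition operator_algebra :: "(h2 \<Rightarrow>\<^sub>L h2) set \<Rightarrow> (h2 \<Rightarrow>\<^sub>L h2) star_algebra"
  where "operator_algebra A =
    \<lparr>carrier = A,
     mult = (o\<^sub>L),
     one = id_blinfun,
     zero = 0,
     add = (+),
     smult = op_scaleC,
     star = op_adjoint\<rparr>"

definition parabolic_operators :: "complex \<Rightarrow> (h2 \<Rightarrow>\<^sub>L h2) set"
  where "parabolic_operators \<gamma> =
    {composition_operator (parabolic_map \<gamma> a) | a. Re a > 0}"

definition parabolic_cstar_algebra :: "complex \<Rightarrow> (h2 \<Rightarrow>\<^sub>L h2) star_algebra"
  where "parabolic_cstar_algebra \<gamma> = operator_algebra (cstar_generated (parabolic_operators \<gamma>))"

end

theory Submission
  imports Defs
begin

text \<open>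
  Why the theorem holds.  Write \<open>w = cayley \<gamma> z\<close> for the coordinate of the right half-plane.  By the
  Paley--Wiener theorem the functions \<open>(w + 1) F(w)\<close> of the Hardy space correspond to square
  integrable functions on \<open>x > 0\<close>, with \<open>F\<close> the Laplace transform, and after \<open>t = exp (- x)\<close> and a
  weight to square integrable functions on the unit interval.  In this picture the translation
  \<open>F(w) \<mapsto> F(w + a)\<close> is multiplication by \<open>t\<^sup>a\<close>.  Composition with the parabolic map is this translation
  followed by multiplication by \<open>1 + a / (w + 1)\<close>, and the extra term is a Hilbert--Schmidt operator
  (\<open>parabolic_op_mod_compact\<close>).  So modulo compact operators the composition operator is
  multiplication by \<open>t\<^sup>a\<close>, and the isomorphism sends \<open>f\<close> to the coset of multiplication by \<open>f\<close>.

  The Paley--Wiener theorem is replaced by a computation with Gram matrices.  The functions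
  \<open>(w + 1) / (w + \<nu> + 1/2)\<close> are multiples of Szego kernels and have, up to a constant, the same inner
  products as the powers \<open>t\<^sup>\<nu>\<close> on the unit interval (\<open>cinner_power_vec\<close>).  This yields an isometry
  \<open>fun_vec\<close> of the continuous functions onto a dense subspace, and multiplication by a continuous
  function extends from there to a bounded operator \<open>mult_op f\<close>.

  Injectivity, and closedness of the set of operators \<open>mult_op f + K\<close> with \<open>K\<close> compact, rest on the
  lower bound for the essential norm of \<open>mult_op f\<close> by the supremum of \<open>f\<close>
  (\<open>essential_norm_lower_bound\<close>): bumps with disjoint supports that shrink to a point form an
  orthonormal sequence of approximate eigenvectors.  Consequently the algebra generated by the
  composition operators lies in that set, which gives surjectivity.

  The map takes values in the quotient of the generated algebra only if each continuous \<open>f\<close> is the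
  symbol of an element of that algebra (\<open>lift_exists\<close>).  Polynomials in \<open>t\<close> settle this for a dense
  set of \<open>f\<close>, and lifts with controlled norm are needed to pass to the limit.  The algebra contains a positive contraction with symbol
  \<open>t\<^sup>2 / N\<close>, and Bernstein polynomials of a positive contraction are bounded in operator norm by the
  supremum of the approximated function.  Summing a geometric series of such lifts gives the exact one.

  For uniqueness, two isomorphisms differ by an endomorphism of the algebra of continuous functions
  that preserves conjugation and fixes \<open>t\<close>.  Such an endomorphism is contractive, hence the identity,
  because polynomials are dense (\<open>character_eq_evaluation\<close>).
\<close>

section \<open>The Hardy space as a complex Hilbert space\<close>

notation scaleC_h2 (infixr "*\<^sub>C" 75)

interpretation complex_h2: vector_space scaleC_h2
  by standard (transfer, simp add: algebra_simps)+

lemma scaleR_eq_scaleC: "r *\<^sub>R f = complex_of_real r *\<^sub>C f"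
  by (rule scaleR_h2_def)

lemma cinner_h2_scaleC_right: "cinner_h2 f (c *\<^sub>C g) = cnj c * cinner_h2 f g"
  by (metis cinner_h2_commute cinner_h2_scaleC_left complex_cnj_mult)

lemma cinner_h2_add_right: "cinner_h2 f (g + h) = cinner_h2 f g + cinner_h2 f h"
  by (metis cinner_h2_commute cinner_h2_add_left complex_cnj_add)

lemma cinner_h2_self_norm: "cinner_h2 f f = of_real ((norm f)\<^sup>2)"
proof -
  have "cinner_h2 f f = of_real (inner f f)"
    by (simp add: inner_h2_def cinner_h2_self)
  then show ?thesis by (simp add: power2_norm_eq_inner)
qed

lemma norm_h2_eq_1:
  assumes "cinner_h2 f f = 1"
  shows "norm f = 1"
proof -
  have "complex_of_real ((norm f)\<^sup>2) = of_real 1" using assms by (simp only: cinner_h2_self_norm) simp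
  then have "(norm f)\<^sup>2 = 1" by (simp only: of_real_eq_iff)
  then show ?thesis using norm_ge_zero[of f] unfolding power2_eq_1_iff by linarith
qed

lemma norm_h2_square: "(norm f)\<^sup>2 = (\<Sum>n. (cmod (h2_coeff f n))\<^sup>2)"
  using cinner_h2_self[of f] cinner_h2_self_norm[of f] by (metis of_real_eq_iff)

lemma cnj_sgn_mult_self: "cnj (sgn z) * z = of_real (cmod z)"
proof (cases "z = 0")
  case False
  have "cnj (sgn z) * z = (z * cnj z) / of_real (cmod z)"
    by (simp add: sgn_eq)
  also have "z * cnj z = of_real (cmod z) * of_real (cmod z)"
    using complex_norm_square[of z] by (simp add: power2_eq_square)
  finally show ?thesis using False by simp
qed simp

text \<open>The real inner product is the real part of the complex one, so its Cauchy--Schwarz inequality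
  gives the complex one after a rotation that makes \<open>cinner_h2 f g\<close> nonnegative.\<close>

lemma cinner_h2_Cauchy_Schwarz: "cmod (cinner_h2 f g) \<le> norm f * norm g"
proof (cases "cinner_h2 f g = 0")
  case False
  define c where "c = cnj (sgn (cinner_h2 f g))"
  have c: "cmod c = 1" using False by (simp add: c_def norm_sgn)
  have "cinner_h2 (c *\<^sub>C f) g = of_real (cmod (cinner_h2 f g))"
    by (simp add: c_def cinner_h2_scaleC_left cnj_sgn_mult_self)
  then have "cmod (cinner_h2 f g) = inner (c *\<^sub>C f) g"
    by (simp add: inner_h2_def)
  also have "\<dots> \<le> norm (c *\<^sub>C f) * norm g" by (rule norm_cauchy_schwarz)
  finally show ?thesis by (simp add: norm_scaleC_h2 c)
qed simp

interpretation cinner_h2: bounded_bilinear cinner_h2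
proof
  show "\<exists>K. \<forall>f g. cmod (cinner_h2 f g) \<le> norm f * norm g * K"
    using cinner_h2_Cauchy_Schwarz by (intro exI[of _ 1]) simp
qed (simp_all add: cinner_h2_add_left cinner_h2_add_right scaleR_eq_scaleC cinner_h2_scaleC_left
    cinner_h2_scaleC_right scaleR_conv_of_real)

lemmas cinner_h2_simps = cinner_h2.add_left cinner_h2.add_right cinner_h2.diff_left
  cinner_h2.diff_right cinner_h2_scaleC_left cinner_h2_scaleC_right

lemma h2_coeff_diff: "h2_coeff (f - g) n = h2_coeff f n - h2_coeff g n"
proof -
  have "f - g = f + (- 1) *\<^sub>C g" by (simp only: minus_h2_def uminus_h2_def)
  then show ?thesis by (simp only: h2_coeff_add h2_coeff_scaleC) simp
qed

lemma h2_eqI_coeff: "(\<And>n. h2_coeff f n = h2_coeff g n) \<Longrightarrow> f = g"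
  using h2_eq_0I[of "f - g"] by (simp add: h2_coeff_diff)

lemma Rep_h2_outside: "z \<notin> ball 0 1 \<Longrightarrow> Rep_h2 f z = 0"
  using Rep_h2[of f] by (simp add: hardy_functions_def)

lemma h2_eqI: 
  assumes "\<And>z. z \<in> ball 0 1 \<Longrightarrow> Rep_h2 f z = Rep_h2 g z"
  shows "f = g"
proof -
  have "Rep_h2 f z = Rep_h2 g z" for z
    using assms[of z] Rep_h2_outside[of z] by (cases "z \<in> ball 0 1") simp_all
  then show ?thesis by (simp add: Rep_h2_inject[symmetric] fun_eq_iff)
qed

lemma h2_power_series:
  assumes "z \<in> ball 0 1"
  shows "(\<lambda>n. h2_coeff f n * z ^ n) sums Rep_h2 f z"
  using holomorphic_power_series[OF holomorphic_Rep_h2, of z f] assms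
  by (simp add: taylor_coeff_def)

lemma taylor_coeff_power_series:
  assumes "\<And>z. z \<in> ball 0 1 \<Longrightarrow> (\<lambda>n. a n * z ^ n) sums f z"
  shows "taylor_coeff f n = a n"
proof -
  have "f has_fps_expansion Abs_fps a"
    unfolding has_fps_expansion_def
  proof
    have "summable (\<lambda>n. fps_nth (Abs_fps a) n * (1/2) ^ n)"
      using assms[of "1/2"] by (auto simp: sums_iff)
    then have "conv_radius (fps_nth (Abs_fps a)) \<ge> norm (1/2 :: complex)"
      by (rule conv_radius_geI)
    moreover have "ereal (norm (1/2 :: complex)) > 0"
      by simp
    ultimately show "fps_conv_radius (Abs_fps a) > 0"
      unfolding fps_conv_radius_def by (rule less_le_trans[rotated])
    have "eventually (\<lambda>z. z \<in> ball 0 1) (nhds (0::complex))"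
      by (rule eventually_nhds_in_open) auto
    then show "eventually (\<lambda>z. eval_fps (Abs_fps a) z = f z) (nhds 0)"
      by eventually_elim (use assms in \<open>auto simp: eval_fps_def sums_iff\<close>)
  qed
  from fps_nth_fps_expansion[OF this, of n] show ?thesis
    by (simp add: taylor_coeff_def)
qed

lemma summable_power_series_l2:
  fixes a :: "nat \<Rightarrow> complex"
  assumes "summable (\<lambda>n. (cmod (a n))\<^sup>2)" "cmod z < 1"
  shows "summable (\<lambda>n. a n * z ^ n)"
proof (rule summable_comparison_test')
  have "summable (\<lambda>n. (cmod z)\<^sup>2 ^ n)"
    using assms(2) by (intro summable_geometric) (simp add: abs_square_less_1)
  then show "summable (\<lambda>n. (cmod (a n))\<^sup>2 + (cmod z)\<^sup>2 ^ n)"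
    using assms(1) by (intro summable_add)
  fix n :: nat
  have "2 * cmod (a n) * cmod z ^ n \<le> (cmod (a n))\<^sup>2 + (cmod z ^ n)\<^sup>2"
    by (rule sum_squares_bound)
  moreover have "0 \<le> cmod (a n) * cmod z ^ n" by simp
  ultimately have "cmod (a n) * cmod z ^ n \<le> (cmod (a n))\<^sup>2 + (cmod z ^ n)\<^sup>2"
    by linarith
  then show "norm (a n * z ^ n) \<le> (cmod (a n))\<^sup>2 + (cmod z)\<^sup>2 ^ n"
    by (simp add: norm_mult norm_power power_mult[symmetric] mult.commute)
qed

text \<open>The function with Taylor coefficients \<open>a\<close>; for \<open>a\<close> that is not square summable the value of
  \<^const>\<open>Abs_h2\<close> is arbitrary.\<close>

definition h2_of :: "(nat \<Rightarrow> complex) \<Rightarrow> h2"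
  where "h2_of a = Abs_h2 (\<lambda>z. if z \<in> ball 0 1 then \<Sum>n. a n * z ^ n else 0)"

lemma h2_coeff_h2_of:
  assumes "summable (\<lambda>n. (cmod (a n))\<^sup>2)"
  shows "h2_coeff (h2_of a) n = a n"
proof -
  define f where "f z = (if z \<in> ball 0 1 then \<Sum>n. a n * z ^ n else 0)" for z
  have sums: "(\<lambda>n. a n * z ^ n) sums f z" if "z \<in> ball 0 1" for z
    using summable_power_series_l2[OF assms, of z] that by (simp add: f_def summable_sums)
  have hol: "f holomorphic_on ball 0 1"
    by (rule power_series_holomorphic) (use sums in simp)
  have coeff: "taylor_coeff f n = a n" for n
    by (rule taylor_coeff_power_series) (rule sums)
  have "f \<in> hardy_functions"
    using hol assms by (auto simp: hardy_functions_def coeff f_def)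
  then show ?thesis
    using coeff unfolding h2_of_def f_def[symmetric] by (simp add: Abs_h2_inverse)
qed

lemma cmod_h2_coeff_le: "cmod (h2_coeff f n) \<le> norm f"
proof (rule power2_le_imp_le)
  show "(cmod (h2_coeff f n))\<^sup>2 \<le> (norm f)\<^sup>2"
    unfolding norm_h2_square
    using sum_le_suminf[OF summable_h2_coeff[of f], of "{n}"] by simp
qed simp

lemma norm_h2_leI:
  assumes "\<And>N. (\<Sum>n<N. (cmod (h2_coeff f n))\<^sup>2) \<le> B\<^sup>2" "0 \<le> B"
  shows "norm f \<le> B"
proof (rule power2_le_imp_le)
  show "(norm f)\<^sup>2 \<le> B\<^sup>2"
    unfolding norm_h2_square by (intro suminf_le_const summable_h2_coeff assms)
qed fact

text \<open>Completeness is inherited from the sequence space of the Taylor coefficients: a Cauchy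
  sequence converges coefficientwise, and the Cauchy bounds pass to the partial sums of the
  squares of the limit coefficients.\<close>

instance h2 :: banach
proof
  fix X :: "nat \<Rightarrow> h2"
  assume X: "Cauchy X"
  have "Cauchy (\<lambda>m. h2_coeff (X m) n)" for n
  proof (rule metric_CauchyI)
    fix e :: real assume "e > 0"
    then obtain M where M: "\<And>m m'. m \<ge> M \<Longrightarrow> m' \<ge> M \<Longrightarrow> norm (X m - X m') < e"
      using CauchyD[OF X \<open>e > 0\<close>] by blast
    show "\<exists>M. \<forall>m\<ge>M. \<forall>n'\<ge>M. dist (h2_coeff (X m) n) (h2_coeff (X n') n) < e"
      unfolding dist_norm h2_coeff_diff[symmetric]
      using M le_less_trans[OF cmod_h2_coeff_le] by blast
  qed
  then have "\<forall>n. \<exists>l. (\<lambda>m. h2_coeff (X m) n) \<longlonglongrightarrow> l"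
    unfolding Cauchy_convergent_iff convergent_def by blast
  then obtain c where c: "\<And>n. (\<lambda>m. h2_coeff (X m) n) \<longlonglongrightarrow> c n"
    by metis
  have bound: "\<exists>M. \<forall>m\<ge>M. \<forall>N. (\<Sum>n<N. (cmod (c n - h2_coeff (X m) n))\<^sup>2) \<le> e\<^sup>2" if "e > 0" for e
  proof -
    obtain M where M: "\<And>m m'. m \<ge> M \<Longrightarrow> m' \<ge> M \<Longrightarrow> norm (X m - X m') < e"
      using CauchyD[OF X \<open>e > 0\<close>] by blast
    have "(\<Sum>n<N. (cmod (c n - h2_coeff (X m) n))\<^sup>2) \<le> e\<^sup>2" if "m \<ge> M" for m N
    proof (rule tendsto_upperbound)
      show "(\<lambda>m'. \<Sum>n<N. (cmod (h2_coeff (X m') n - h2_coeff (X m) n))\<^sup>2)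
          \<longlonglongrightarrow> (\<Sum>n<N. (cmod (c n - h2_coeff (X m) n))\<^sup>2)"
        by (intro tendsto_intros c)
      have "(\<Sum>n<N. (cmod (h2_coeff (X m') n - h2_coeff (X m) n))\<^sup>2) \<le> e\<^sup>2" if "m' \<ge> M" for m'
      proof -
        have "(\<Sum>n<N. (cmod (h2_coeff (X m') n - h2_coeff (X m) n))\<^sup>2) \<le> (norm (X m' - X m))\<^sup>2"
          unfolding norm_h2_square h2_coeff_diff[symmetric]
          by (intro sum_le_suminf summable_h2_coeff) auto
        also have "\<dots> \<le> e\<^sup>2"
          using M[OF \<open>m' \<ge> M\<close> \<open>m \<ge> M\<close>] by (intro power_mono) auto
        finally show ?thesis .
      qed
      then show "\<forall>\<^sub>F m' in sequentially. (\<Sum>n<N. (cmod (h2_coeff (X m') n - h2_coeff (X m) n))\<^sup>2) \<le> e\<^sup>2"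
        unfolding eventually_sequentially by blast
    qed simp
    then show ?thesis by blast
  qed
  have "summable (\<lambda>n. (cmod (c n))\<^sup>2)"
  proof -
    obtain M where M: "\<And>N. (\<Sum>n<N. (cmod (c n - h2_coeff (X M) n))\<^sup>2) \<le> 1\<^sup>2"
      using bound[of 1] by auto
    have "summable (\<lambda>n. (cmod (c n - h2_coeff (X M) n))\<^sup>2)"
      by (rule summableI_nonneg_bounded) (use M in auto)
    from summable_norm_square_add[OF this summable_h2_coeff[of "X M"]] show ?thesis by simp
  qed
  then have coeff: "h2_coeff (h2_of c) n = c n" for n
    by (rule h2_coeff_h2_of)
  have "X \<longlonglongrightarrow> h2_of c"
  proof (rule LIMSEQ_I)
    fix e :: real assume "e > 0"
    then obtain M where M: "\<And>m N. m \<ge> M \<Longrightarrow> (\<Sum>n<N. (cmod (c n - h2_coeff (X m) n))\<^sup>2) \<le> (e/2)\<^sup>2"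
      using bound[of "e/2"] by auto
    have "norm (h2_of c - X m) \<le> e/2" if "m \<ge> M" for m
      by (rule norm_h2_leI) (use M[OF that] \<open>e > 0\<close> in \<open>simp_all add: h2_coeff_diff coeff\<close>)
    then show "\<exists>M. \<forall>m\<ge>M. norm (X m - h2_of c) < e"
      using \<open>e > 0\<close> by (intro exI[of _ M]) (force simp: norm_minus_commute)
  qed
  then show "convergent X" by (auto simp: convergent_def)
qed

subsection \<open>Geometric series, monomials and point evaluations\<close>

definition geometric_h2 :: "complex \<Rightarrow> h2"
  where "geometric_h2 w = h2_of (\<lambda>n. w ^ n)"

definition monomial_h2 :: "nat \<Rightarrow> h2"
  where "monomial_h2 k = h2_of (\<lambda>n. if n = k then 1 else 0)"

lemma h2_coeff_geometric:
  assumes "cmod w < 1"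
  shows "h2_coeff (geometric_h2 w) n = w ^ n"
proof -
  have "summable (\<lambda>n. (cmod w)\<^sup>2 ^ n)"
    using assms by (intro summable_geometric) (simp add: abs_square_less_1)
  then show ?thesis
    unfolding geometric_h2_def
    by (intro h2_coeff_h2_of) (simp add: norm_power power_mult[symmetric] mult.commute)
qed

lemma Rep_h2_geometric:
  assumes "cmod w < 1" "z \<in> ball 0 1"
  shows "Rep_h2 (geometric_h2 w) z = 1 / (1 - w * z)"
proof -
  have "cmod (w * z) < 1"
    using mult_strict_mono'[of "cmod w" 1 "cmod z" 1] assms by (simp add: norm_mult)
  then have "(\<lambda>n. (w * z) ^ n) sums (1 / (1 - w * z))"
    by (rule geometric_sums)
  then show ?thesis
    using h2_power_series[OF assms(2), of "geometric_h2 w"] assms(1)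
    by (simp add: h2_coeff_geometric power_mult_distrib sums_unique2)
qed

text \<open>The geometric series are the Szego kernels: they represent the point evaluations.\<close>

lemma cinner_geometric:
  assumes "cmod w < 1"
  shows "cinner_h2 f (geometric_h2 w) = Rep_h2 f (cnj w)"
  using h2_power_series[of "cnj w" f] assms
  by (simp add: cinner_h2_def h2_coeff_geometric sums_iff)

lemma bounded_linear_Rep_h2:
  assumes "z \<in> ball 0 1"
  shows "bounded_linear (\<lambda>f. Rep_h2 f z)"
  using cinner_geometric[of "cnj z"] assms
    cinner_h2.bounded_linear_left[of "geometric_h2 (cnj z)"] by simp

lemma h2_coeff_monomial: "h2_coeff (monomial_h2 k) n = (if n = k then 1 else 0)"
proof -
  have "summable (\<lambda>n. (cmod (if n = k then 1 else 0))\<^sup>2)"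
    by (rule summable_finite[of "{k}"]) auto
  then show ?thesis unfolding monomial_h2_def by (rule h2_coeff_h2_of)
qed

lemma cinner_monomial: "cinner_h2 f (monomial_h2 k) = h2_coeff f k"
proof -
  have "cinner_h2 f (monomial_h2 k) = (\<Sum>n\<in>{k}. h2_coeff f n * cnj (h2_coeff (monomial_h2 k) n))"
    unfolding cinner_h2_def by (rule suminf_finite) (auto simp: h2_coeff_monomial)
  then show ?thesis by (simp add: h2_coeff_monomial)
qed

lemma norm_monomial_h2 [simp]: "norm (monomial_h2 k) = 1"
  by (rule norm_h2_eq_1) (simp add: cinner_monomial h2_coeff_monomial)

lemma Rep_h2_monomial:
  assumes "z \<in> ball 0 1"
  shows "Rep_h2 (monomial_h2 k) z = z ^ k"
proof -
  have "(\<lambda>n. h2_coeff (monomial_h2 k) n * z ^ n) sums (\<Sum>n\<in>{k}. h2_coeff (monomial_h2 k) n * z ^ n)"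
    by (rule sums_finite) (auto simp: h2_coeff_monomial)
  with h2_power_series[OF assms, of "monomial_h2 k"] show ?thesis
    by (simp add: h2_coeff_monomial sums_unique2)
qed

definition h2_truncate :: "nat \<Rightarrow> h2 \<Rightarrow> h2"
  where "h2_truncate N f = (\<Sum>k<N. h2_coeff f k *\<^sub>C monomial_h2 k)"

lemma h2_coeff_sum: "h2_coeff (sum F A) n = (\<Sum>k\<in>A. h2_coeff (F k) n)"
  by (induction A rule: infinite_finite_induct) (simp_all add: h2_coeff_add)

lemma h2_coeff_truncate: "h2_coeff (h2_truncate N f) n = (if n < N then h2_coeff f n else 0)"
proof -
  have "h2_coeff (h2_truncate N f) n = (\<Sum>k<N. if k = n then h2_coeff f n else 0)"
    unfolding h2_truncate_def h2_coeff_sum h2_coeff_scaleC h2_coeff_monomial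
    by (intro sum.cong) auto
  then show ?thesis by simp
qed

lemma h2_truncate_tendsto: "(\<lambda>N. h2_truncate N f) \<longlonglongrightarrow> f"
proof -
  have sq: "(norm (f - h2_truncate N f))\<^sup>2 = (norm f)\<^sup>2 - (\<Sum>n<N. (cmod (h2_coeff f n))\<^sup>2)" for N
  proof -
    have "(norm (f - h2_truncate N f))\<^sup>2
        = (\<Sum>n. (cmod (h2_coeff f n))\<^sup>2 - (if n \<in> {..<N} then (cmod (h2_coeff f n))\<^sup>2 else 0))"
      unfolding norm_h2_square h2_coeff_diff h2_coeff_truncate
      by (intro arg_cong[where f = suminf] ext) auto
    also have "\<dots> = (\<Sum>n. (cmod (h2_coeff f n))\<^sup>2) - (\<Sum>n. if n \<in> {..<N} then (cmod (h2_coeff f n))\<^sup>2 else 0)"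
      by (intro suminf_diff[symmetric] summable_h2_coeff) (rule summable_If_finite_set, simp)
    finally show ?thesis
      unfolding norm_h2_square using suminf_finite[of "{..<N}" "\<lambda>n. if n \<in> {..<N} then (cmod (h2_coeff f n))\<^sup>2 else 0"]
      by simp
  qed
  have "(\<lambda>N. (norm f)\<^sup>2 - (\<Sum>n<N. (cmod (h2_coeff f n))\<^sup>2)) \<longlonglongrightarrow> (norm f)\<^sup>2 - (norm f)\<^sup>2"
    unfolding norm_h2_square by (intro tendsto_intros summable_LIMSEQ summable_h2_coeff)
  then have "(\<lambda>N. (norm (f - h2_truncate N f))\<^sup>2) \<longlonglongrightarrow> 0"
    by (simp add: sq)
  from tendsto_real_sqrt[OF this] have "(\<lambda>N. norm (h2_truncate N f - f)) \<longlonglongrightarrow> 0"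
    by (simp add: norm_minus_commute)
  then show ?thesis
    by (rule LIM_zero_cancel[OF tendsto_norm_zero_cancel])
qed

section \<open>Bounded operators and their adjoints\<close>

interpretation complex_op: vector_space op_scaleC
  by standard
    (rule blinfun_eqI, simp add: op_scaleC_apply plus_blinfun.rep_eq complex_h2.scale_right_distrib
      complex_h2.scale_left_distrib)+

lemma compose_id_left [simp]: "id_blinfun o\<^sub>L T = T"
  by (rule blinfun_eqI) simp

lemma compose_id_right [simp]: "T o\<^sub>L id_blinfun = T"
  by (rule blinfun_eqI) simp

lemma op_scaleC_compose_left: "op_scaleC c S o\<^sub>L T = op_scaleC c (S o\<^sub>L T)"
  by (rule blinfun_eqI) (simp add: op_scaleC_apply)

lemma bounded_operatorsD: "T \<in> bounded_operators \<Longrightarrow> T (c *\<^sub>C f) = c *\<^sub>C T f"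
  by (simp add: bounded_operators_def)

lemma op_scaleC_compose_right:
  "S \<in> bounded_operators \<Longrightarrow> S o\<^sub>L op_scaleC c T = op_scaleC c (S o\<^sub>L T)"
  by (rule blinfun_eqI) (simp add: op_scaleC_apply bounded_operatorsD)

lemma bounded_operators_0: "0 \<in> bounded_operators"
  and bounded_operators_id: "id_blinfun \<in> bounded_operators"
  and bounded_operators_add:
    "S \<in> bounded_operators \<Longrightarrow> T \<in> bounded_operators \<Longrightarrow> S + T \<in> bounded_operators"
  and bounded_operators_compose:
    "S \<in> bounded_operators \<Longrightarrow> T \<in> bounded_operators \<Longrightarrow> S o\<^sub>L T \<in> bounded_operators"
  and bounded_operators_scaleC: "T \<in> bounded_operators \<Longrightarrow> op_scaleC c T \<in> bounded_operators"
  by (simp_all add: bounded_operators_def plus_blinfun.rep_eq op_scaleC_apply mult.commute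
      complex_h2.scale_right_distrib)

lemma bounded_operators_diff:
  assumes "S \<in> bounded_operators" "T \<in> bounded_operators"
  shows "S - T \<in> bounded_operators"
proof -
  have "S - T = S + op_scaleC (- 1) T" by simp
  with assms show ?thesis
    by (simp only: bounded_operators_add bounded_operators_scaleC)
qed

lemma bounded_operators_sum:
  "(\<And>i. i \<in> A \<Longrightarrow> F i \<in> bounded_operators) \<Longrightarrow> sum F A \<in> bounded_operators"
  by (induction A rule: infinite_finite_induct) (auto intro: bounded_operators_0 bounded_operators_add)

lemmas bounded_operators_intros = bounded_operators_0 bounded_operators_id bounded_operators_add
  bounded_operators_diff bounded_operators_compose bounded_operators_scaleC bounded_operators_sum

lemma tendsto_blinfun_apply: "(F \<longlongrightarrow> T) net \<Longrightarrow> ((\<lambda>n. blinfun_apply (F n) f) \<longlongrightarrow> T f) net"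
  by (intro tendsto_intros)

lemma tendsto_scaleC_h2: "(F \<longlongrightarrow> f) net \<Longrightarrow> ((\<lambda>n. c *\<^sub>C F n) \<longlongrightarrow> c *\<^sub>C f) net"
  by (rule bounded_linear.tendsto[OF bounded_linear_scaleC_h2])

lemma closed_bounded_operators: "closed bounded_operators"
  unfolding closed_sequential_limits
proof (intro allI impI, elim conjE)
  fix F T assume F: "\<forall>n. F n \<in> bounded_operators" and lim: "F \<longlonglongrightarrow> T"
  have "T (c *\<^sub>C f) = c *\<^sub>C T f" for c f
  proof (rule LIMSEQ_unique)
    show "(\<lambda>n. F n (c *\<^sub>C f)) \<longlonglongrightarrow> T (c *\<^sub>C f)"
      by (intro tendsto_blinfun_apply lim)
    show "(\<lambda>n. F n (c *\<^sub>C f)) \<longlonglongrightarrow> c *\<^sub>C T f"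
      using F by (simp add: bounded_operatorsD tendsto_scaleC_h2 tendsto_blinfun_apply lim)
  qed
  then show "T \<in> bounded_operators" by (simp add: bounded_operators_def)
qed

text \<open>Testing a functional on the truncated candidate for its representing vector bounds the
  coefficients of that vector in square mean.\<close>

lemma Riesz_representation_h2:
  assumes lin: "bounded_linear \<phi>" and hom: "\<And>c f. \<phi> (c *\<^sub>C f) = c * \<phi> f"
  shows "\<exists>h. \<forall>f. \<phi> f = cinner_h2 f h"
proof -
  interpret bounded_linear \<phi> by fact
  obtain K where K: "\<And>f. cmod (\<phi> f) \<le> norm f * K" and "K \<ge> 0"
    using nonneg_bounded by blast
  define c where "c n = cnj (\<phi> (monomial_h2 n))" for n
  have "(\<Sum>n<N. (cmod (c n))\<^sup>2) \<le> K\<^sup>2" for N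
  proof -
    define s where "s = (\<Sum>n<N. (cmod (c n))\<^sup>2)"
    define x where "x = (\<Sum>n<N. c n *\<^sub>C monomial_h2 n)"
    have "s \<ge> 0" by (simp add: s_def sum_nonneg)
    have "\<phi> x = (\<Sum>n<N. c n * cnj (c n))"
      by (simp add: x_def sum hom c_def)
    then have px: "\<phi> x = of_real s"
      by (simp add: s_def complex_norm_square del: of_real_power)
    have "h2_coeff x n = (if n < N then c n else 0)" for n
    proof -
      have "h2_coeff x n = (\<Sum>k<N. if k = n then c n else 0)"
        unfolding x_def h2_coeff_sum h2_coeff_scaleC h2_coeff_monomial by (intro sum.cong) auto
      then show ?thesis by simp
    qed
    then have "(norm x)\<^sup>2 = (\<Sum>n. if n \<in> {..<N} then (cmod (c n))\<^sup>2 else 0)"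
      unfolding norm_h2_square by (intro arg_cong[where f = suminf] ext) auto
    also have "\<dots> = s"
      unfolding s_def by (subst suminf_finite[of "{..<N}"]) auto
    finally have nx: "(norm x)\<^sup>2 = s" .
    have "s \<le> norm x * K" using K[of x] \<open>s \<ge> 0\<close> by (simp add: px)
    then have "(norm x * norm x) \<le> norm x * K" using nx by (simp add: power2_eq_square)
    then have "norm x \<le> K" using \<open>K \<ge> 0\<close> by (cases "norm x = 0") auto
    then show ?thesis unfolding s_def[symmetric] nx[symmetric] by (intro power_mono) auto
  qed
  then have summable: "summable (\<lambda>n. (cmod (c n))\<^sup>2)"
    by (intro summableI_nonneg_bounded[where x = "K\<^sup>2"]) auto
  have "\<phi> f = cinner_h2 f (h2_of c)" for f
  proof (rule LIMSEQ_unique)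
    show "(\<lambda>N. \<phi> (h2_truncate N f)) \<longlonglongrightarrow> \<phi> f"
      by (intro tendsto h2_truncate_tendsto)
    have "\<phi> (h2_truncate N f) = (\<Sum>n<N. h2_coeff f n * cnj (h2_coeff (h2_of c) n))" for N
      by (simp add: h2_truncate_def sum hom h2_coeff_h2_of[OF summable] c_def)
    then show "(\<lambda>N. \<phi> (h2_truncate N f)) \<longlonglongrightarrow> cinner_h2 f (h2_of c)"
      unfolding cinner_h2_def using summable_LIMSEQ[OF summable_cinner_h2] by presburger
  qed
  then show ?thesis by blast
qed

lemma cinner_h2_eqI: "(\<And>f. cinner_h2 f g = cinner_h2 f h) \<Longrightarrow> g = h"
  by (metis cinner_monomial cinner_h2_commute h2_eqI_coeff)

text \<open>The definite description in \<^const>\<open>op_adjoint\<close> denotes something only because of the next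
  lemma.  The bound for the adjoint comes from testing \<open>norm (S g)\<close> against \<open>S g\<close> itself.\<close>

lemma op_adjoint_exists:
  assumes T: "T \<in> bounded_operators"
  shows "\<exists>S :: h2 \<Rightarrow>\<^sub>L h2. \<forall>f g. cinner_h2 (T f) g = cinner_h2 f (S g)"
proof -
  have "\<exists>h. \<forall>f. cinner_h2 (T f) g = cinner_h2 f h" for g
    by (rule Riesz_representation_h2)
      (use T in \<open>simp_all add: bounded_operatorsD cinner_h2_scaleC_left
        bounded_linear_compose[OF cinner_h2.bounded_linear_left blinfun.bounded_linear_right]\<close>)
  then obtain S where S: "\<And>f g. cinner_h2 (T f) g = cinner_h2 f (S g)"
    by metis
  have "bounded_linear S"
  proof (rule bounded_linear_intro[where K = "norm T"])
    show "S (g + h) = S g + S h" for g h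
      by (rule cinner_h2_eqI) (simp add: S[symmetric] cinner_h2_simps)
    show "S (r *\<^sub>R g) = r *\<^sub>R S g" for r g
      by (rule cinner_h2_eqI) (simp add: S[symmetric] scaleR_eq_scaleC cinner_h2_simps)
    show "norm (S g) \<le> norm g * norm T" for g
    proof -
      have "(norm (S g))\<^sup>2 = cmod (cinner_h2 (T (S g)) g)"
        by (simp add: S cinner_h2_self_norm norm_power)
      also have "\<dots> \<le> norm (T (S g)) * norm g" by (rule cinner_h2_Cauchy_Schwarz)
      also have "\<dots> \<le> (norm T * norm (S g)) * norm g"
        by (intro mult_right_mono norm_blinfun) simp
      finally have "norm (S g) * norm (S g) \<le> norm (S g) * (norm g * norm T)"
        by (simp add: power2_eq_square mult_ac)
      then show ?thesis by (cases "norm (S g) = 0") auto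
    qed
  qed
  then show ?thesis using S by (intro exI[of _ "Blinfun S"]) (simp add: bounded_linear_Blinfun_apply)
qed

lemma op_adjoint_eqI:
  fixes S T :: "h2 \<Rightarrow>\<^sub>L h2"
  assumes "\<And>f g. cinner_h2 (T f) g = cinner_h2 f (S g)"
  shows "op_adjoint T = S"
  unfolding op_adjoint_def
proof (rule the_equality)
  fix S' :: "h2 \<Rightarrow>\<^sub>L h2" assume S': "\<forall>f g. cinner_h2 (T f) g = cinner_h2 f (S' g)"
  show "S' = S"
    by (intro blinfun_eqI cinner_h2_eqI) (use assms S' in simp)
qed (use assms in blast)

lemma cinner_op_adjoint:
  assumes "T \<in> bounded_operators"
  shows "cinner_h2 (T f) g = cinner_h2 f (op_adjoint T g)"
  using op_adjoint_exists[OF assms] op_adjoint_eqI[of T] by metis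

lemma cinner_op_adjoint_left:
  assumes "T \<in> bounded_operators"
  shows "cinner_h2 (op_adjoint T f) g = cinner_h2 f (T g)"
  by (metis assms cinner_h2_commute cinner_op_adjoint)

lemma bounded_operators_adjoint:
  assumes "T \<in> bounded_operators"
  shows "op_adjoint T \<in> bounded_operators"
proof -
  have "op_adjoint T (c *\<^sub>C g) = c *\<^sub>C op_adjoint T g" for c g
    by (rule cinner_h2_eqI)
      (simp add: cinner_op_adjoint[OF assms, symmetric] cinner_h2_scaleC_right)
  then show ?thesis by (simp add: bounded_operators_def)
qed

lemma op_adjoint_diff:
  "S \<in> bounded_operators \<Longrightarrow> T \<in> bounded_operators \<Longrightarrow> op_adjoint (S - T) = op_adjoint S - op_adjoint T"
  by (intro op_adjoint_eqI) (simp add: minus_blinfun.rep_eq cinner_h2_simps cinner_op_adjoint)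

section \<open>Compact operators\<close>

text \<open>A sequence in the closure of \<open>S\<close> may be replaced by one in \<open>S\<close> at distances tending to \<open>0\<close>,
  so relative compactness can be tested on sequences in \<open>S\<close> alone.\<close>

lemma compact_closure_iff_subsequence:
  fixes S :: "'a::metric_space set"
  shows "compact (closure S) \<longleftrightarrow>
    (\<forall>x. (\<forall>n::nat. x n \<in> S) \<longrightarrow> (\<exists>r. strict_mono r \<and> convergent (\<lambda>n. x (r n))))"
proof (intro iffI allI impI)
  fix x :: "nat \<Rightarrow> 'a" assume "compact (closure S)" "\<forall>n. x n \<in> S"
  then obtain l r where "strict_mono r" "(x \<circ> r) \<longlonglongrightarrow> l"
    unfolding compact_def using closure_subset by blast
  then show "\<exists>r. strict_mono r \<and> convergent (\<lambda>n. x (r n))"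
    unfolding convergent_def comp_def by blast
next
  assume sub: "\<forall>x. (\<forall>n::nat. x n \<in> S) \<longrightarrow> (\<exists>r. strict_mono r \<and> convergent (\<lambda>n. x (r n)))"
  show "compact (closure S)"
    unfolding compact_def
  proof (intro allI impI)
    fix y :: "nat \<Rightarrow> 'a" assume y: "\<forall>n. y n \<in> closure S"
    have "\<exists>x\<in>S. dist x (y n) < inverse (real (Suc n))" for n
      using y closure_approachable[of "y n" S] by auto
    then obtain x where x: "\<And>n. x n \<in> S" "\<And>n. dist (x n) (y n) < inverse (real (Suc n))"
      by metis
    then obtain r l where r: "strict_mono r" and l: "(\<lambda>n. x (r n)) \<longlonglongrightarrow> l"
      using sub unfolding convergent_def by metis
    have "(\<lambda>n. inverse (real (Suc (r n)))) \<longlonglongrightarrow> 0"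
      using LIMSEQ_subseq_LIMSEQ[OF LIMSEQ_inverse_real_of_nat r] by (simp add: comp_def)
    then have "(\<lambda>n. dist (x (r n)) (y (r n))) \<longlonglongrightarrow> 0"
      by (rule Lim_null_comparison[rotated]) (use x(2) in \<open>auto intro!: always_eventually less_imp_le\<close>)
    then have "(\<lambda>n. dist (x (r n)) (y (r n)) + dist (x (r n)) l) \<longlonglongrightarrow> 0 + 0"
      by (rule tendsto_add) (use l in \<open>simp add: tendsto_dist_iff[symmetric]\<close>)
    then have "(\<lambda>n. dist (x (r n)) (y (r n)) + dist (x (r n)) l) \<longlonglongrightarrow> 0" by simp
    then have "(\<lambda>n. dist (y (r n)) l) \<longlonglongrightarrow> 0"
      by (rule Lim_null_comparison[rotated]) (simp add: dist_triangle3)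
    then have "(y \<circ> r) \<longlonglongrightarrow> l"
      by (simp add: tendsto_dist_iff[symmetric] comp_def)
    moreover have "l \<in> closure S"
      unfolding closure_sequential using l x(1) by (intro exI[of _ "\<lambda>n. x (r n)"]) auto
    ultimately show "\<exists>l\<in>closure S. \<exists>r. strict_mono r \<and> (y \<circ> r) \<longlonglongrightarrow> l"
      using r by blast
  qed
qed

lemma compact_operators_iff:
  "T \<in> compact_operators \<longleftrightarrow> T \<in> bounded_operators \<and>
    (\<forall>x. (\<forall>n::nat. norm (x n) \<le> 1) \<longrightarrow> (\<exists>r. strict_mono r \<and> convergent (\<lambda>n. T (x (r n)))))"
  (is "_ \<longleftrightarrow> _ \<and> ?sub")
proof -
  have "(\<forall>y. (\<forall>n::nat. y n \<in> blinfun_apply T ` cball 0 1) \<longrightarrow>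
      (\<exists>r. strict_mono r \<and> convergent (\<lambda>n. y (r n)))) \<longleftrightarrow> ?sub"
  proof (intro iffI allI impI)
    fix x :: "nat \<Rightarrow> h2"
    assume a: "\<forall>y. (\<forall>n::nat. y n \<in> blinfun_apply T ` cball 0 1) \<longrightarrow>
      (\<exists>r. strict_mono r \<and> convergent (\<lambda>n. y (r n)))" and "\<forall>n. norm (x n) \<le> 1"
    then show "\<exists>r. strict_mono r \<and> convergent (\<lambda>n. T (x (r n)))"
      using a[rule_format, of "\<lambda>n. T (x n)"] by simp
  next
    fix y :: "nat \<Rightarrow> h2"
    assume sub: ?sub and y: "\<forall>n. y n \<in> blinfun_apply T ` cball 0 1"
    have "\<exists>x. norm x \<le> 1 \<and> y n = T x" for n
      using y[rule_format, of n] by auto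
    then obtain x where "\<And>n. norm (x n) \<le> 1" "\<And>n. y n = T (x n)"
      by metis
    then show "\<exists>r. strict_mono r \<and> convergent (\<lambda>n. y (r n))"
      using sub by simp
  qed
  then show ?thesis
    unfolding compact_operators_def compact_closure_iff_subsequence by simp
qed

lemma compact_operators_bounded: "T \<in> compact_operators \<Longrightarrow> T \<in> bounded_operators"
  by (simp add: compact_operators_def)

lemma compact_operators_subsequence:
  assumes "T \<in> compact_operators" "\<And>n::nat. norm (x n) \<le> 1"
  obtains r where "strict_mono r" "convergent (\<lambda>n. T (x (r n)))"
  using assms unfolding compact_operators_iff by blast

lemma compact_operators_0: "0 \<in> compact_operators"
  by (auto simp: compact_operators_iff bounded_operators_0 intro!: exI[of _ id] convergent_const strict_mono_id)

lemma compact_operators_add: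
  assumes S: "S \<in> compact_operators" and T: "T \<in> compact_operators"
  shows "S + T \<in> compact_operators"
  unfolding compact_operators_iff
proof (intro conjI allI impI)
  show "S + T \<in> bounded_operators"
    using S T by (simp add: bounded_operators_intros compact_operators_bounded)
  fix x :: "nat \<Rightarrow> h2" assume x: "\<forall>n. norm (x n) \<le> 1"
  obtain r where r: "strict_mono r" "convergent (\<lambda>n. S (x (r n)))"
    using compact_operators_subsequence[OF S] x by blast
  obtain r' where r': "strict_mono r'" "convergent (\<lambda>n. T (x (r (r' n))))"
    using compact_operators_subsequence[OF T, of "\<lambda>n. x (r n)"] x by blast
  have "convergent (\<lambda>n. S (x (r (r' n))))"
    using convergent_subseq_convergent[OF r(2) r'(1)] by (simp add: comp_def)
  then have "convergent (\<lambda>n. (S + T) (x ((r \<circ> r') n)))"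
    using convergent_add[OF _ r'(2)] by (simp add: plus_blinfun.rep_eq comp_def)
  then show "\<exists>r. strict_mono r \<and> convergent (\<lambda>n. (S + T) (x (r n)))"
    using strict_mono_o[OF r(1) r'(1)] by blast
qed

lemma compact_operators_compose_left:
  assumes S: "S \<in> bounded_operators" and T: "T \<in> compact_operators"
  shows "S o\<^sub>L T \<in> compact_operators"
  unfolding compact_operators_iff
proof (intro conjI allI impI)
  show "S o\<^sub>L T \<in> bounded_operators"
    using S T by (simp add: bounded_operators_intros compact_operators_bounded)
  fix x :: "nat \<Rightarrow> h2" assume x: "\<forall>n. norm (x n) \<le> 1"
  obtain r where r: "strict_mono r" "convergent (\<lambda>n. T (x (r n)))"
    using compact_operators_subsequence[OF T] x by blast
  then have "convergent (\<lambda>n. S (T (x (r n))))"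
    unfolding convergent_def using blinfun.tendsto[OF tendsto_const] by blast
  then show "\<exists>r. strict_mono r \<and> convergent (\<lambda>n. (S o\<^sub>L T) (x (r n)))"
    using r(1) by auto
qed

lemma compact_operators_compose_right:
  assumes T: "T \<in> compact_operators" and S: "S \<in> bounded_operators"
  shows "T o\<^sub>L S \<in> compact_operators"
  unfolding compact_operators_iff
proof (intro conjI allI impI)
  show "T o\<^sub>L S \<in> bounded_operators"
    using S T by (simp add: bounded_operators_intros compact_operators_bounded)
  fix x :: "nat \<Rightarrow> h2" assume x: "\<forall>n. norm (x n) \<le> 1"
  define M where "M = norm S + 1"
  have M: "M > 0" by (simp add: M_def add_nonneg_pos)
  have "norm (S (x n) /\<^sub>R M) \<le> 1" for n
  proof -
    have "norm (S (x n)) \<le> norm S * norm (x n)" by (rule norm_blinfun)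
    also have "\<dots> \<le> norm S * 1" using x by (intro mult_left_mono) auto
    finally show ?thesis using M by (simp add: M_def field_simps)
  qed
  then obtain r where r: "strict_mono r" "convergent (\<lambda>n. T (S (x (r n)) /\<^sub>R M))"
    using compact_operators_subsequence[OF T, of "\<lambda>n. S (x n) /\<^sub>R M"] by blast
  then have "convergent (\<lambda>n. M *\<^sub>R T (S (x (r n)) /\<^sub>R M))"
    unfolding convergent_def using tendsto_scaleR[OF tendsto_const] by blast
  then have "convergent (\<lambda>n. T (S (x (r n))))"
    using M by (simp add: blinfun.scaleR_right)
  then show "\<exists>r. strict_mono r \<and> convergent (\<lambda>n. (T o\<^sub>L S) (x (r n)))"
    using r(1) by auto
qed

lemma compact_operators_scaleC: "T \<in> compact_operators \<Longrightarrow> op_scaleC c T \<in> compact_operators"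
  using compact_operators_compose_left[OF bounded_operators_scaleC[OF bounded_operators_id], of T c]
  by (simp add: op_scaleC_compose_left compose_id_left)

lemma compact_operators_diff:
  assumes "S \<in> compact_operators" "T \<in> compact_operators"
  shows "S - T \<in> compact_operators"
proof -
  have "S - T = S + op_scaleC (- 1) T" by simp
  with assms show ?thesis by (simp only: compact_operators_add compact_operators_scaleC)
qed

lemma compact_operators_sum:
  "(\<And>i. i \<in> A \<Longrightarrow> F i \<in> compact_operators) \<Longrightarrow> sum F A \<in> compact_operators"
  by (induction A rule: infinite_finite_induct) (auto intro: compact_operators_0 compact_operators_add)

text \<open>On the unit ball the identity \<open>(norm (T\<^sup>* f))\<^sup>2 = cinner (T T\<^sup>* f) f\<close> makes \<open>T\<^sup>*\<close> convergent
  along every sequence along which the compact operator \<open>T T\<^sup>*\<close> is.\<close>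

lemma compact_operators_adjoint:
  assumes T: "T \<in> compact_operators"
  shows "op_adjoint T \<in> compact_operators"
proof -
  have bT: "T \<in> bounded_operators" by (rule compact_operators_bounded[OF T])
  have bA: "op_adjoint T \<in> bounded_operators" by (rule bounded_operators_adjoint[OF bT])
  have K: "T o\<^sub>L op_adjoint T \<in> compact_operators"
    by (rule compact_operators_compose_right[OF T bA])
  have "\<exists>r. strict_mono r \<and> convergent (\<lambda>n. op_adjoint T (x (r n)))"
    if x: "\<forall>n. norm (x n) \<le> 1" for x :: "nat \<Rightarrow> h2"
  proof -
    obtain r where r: "strict_mono r" "convergent (\<lambda>n. (T o\<^sub>L op_adjoint T) (x (r n)))"
      using compact_operators_subsequence[OF K] x by blast
    define y where "y n = x (r n)" for n
    have y: "norm (y n) \<le> 1" for n using x by (simp add: y_def)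
    have cau: "Cauchy (\<lambda>n. T (op_adjoint T (y n)))"
      using convergent_Cauchy[OF r(2)] by (simp add: y_def)
    have "Cauchy (\<lambda>n. op_adjoint T (y n))"
    proof (rule CauchyI)
      fix e :: real assume "e > 0"
      then obtain M where M: "\<And>m n. m \<ge> M \<Longrightarrow> n \<ge> M \<Longrightarrow>
          norm (T (op_adjoint T (y m)) - T (op_adjoint T (y n))) < e\<^sup>2 / 2"
        using CauchyD[OF cau, of "e\<^sup>2 / 2"] by auto
      have "norm (op_adjoint T (y m) - op_adjoint T (y n)) < e" if "m \<ge> M" "n \<ge> M" for m n
      proof (rule power2_less_imp_less)
        define d where "d = y m - y n"
        have d: "norm d \<le> 2" using norm_triangle_ineq4[of "y m" "y n"] y[of m] y[of n]
          by (simp add: d_def)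
        have "(norm (op_adjoint T d))\<^sup>2 = cmod (cinner_h2 (T (op_adjoint T d)) d)"
          by (simp add: cinner_op_adjoint[OF bT] cinner_h2_self_norm norm_power)
        also have "\<dots> \<le> norm (T (op_adjoint T d)) * norm d"
          by (rule cinner_h2_Cauchy_Schwarz)
        also have "\<dots> \<le> norm (T (op_adjoint T d)) * 2"
          using d by (intro mult_left_mono) auto
        also have "\<dots> < e\<^sup>2"
          using M[OF that] by (simp add: d_def blinfun.diff_right)
        finally show "(norm (op_adjoint T (y m) - op_adjoint T (y n)))\<^sup>2 < e\<^sup>2"
          by (simp add: d_def blinfun.diff_right)
      qed (use \<open>e > 0\<close> in simp)
      then show "\<exists>M. \<forall>m\<ge>M. \<forall>n\<ge>M. norm (op_adjoint T (y m) - op_adjoint T (y n)) < e"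
        by blast
    qed
    then show ?thesis using r(1) by (auto simp: Cauchy_convergent_iff y_def)
  qed
  then show ?thesis using bA by (simp add: compact_operators_iff)
qed

text \<open>Total boundedness is stable under operators that are close in norm, which makes the compact
  operators norm closed without a diagonal argument.\<close>

lemma compact_operator_iff_totally_bounded:
  "T \<in> compact_operators \<longleftrightarrow> T \<in> bounded_operators \<and>
    (\<forall>e>0. \<exists>k. finite k \<and> blinfun_apply T ` cball 0 1 \<subseteq> (\<Union>x\<in>k. ball x e))" (is "_ \<longleftrightarrow> _ \<and> ?tb")
proof -
  let ?S = "blinfun_apply T ` cball 0 1"
  have "compact (closure ?S) \<longleftrightarrow> (\<forall>e>0. \<exists>k. finite k \<and> closure ?S \<subseteq> (\<Union>x\<in>k. ball x e))"
    using compact_eq_totally_bounded[of "closure ?S"] complete_eq_closed[of "closure ?S"] by auto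
  also have "\<dots> \<longleftrightarrow> ?tb"
  proof (intro iffI allI impI)
    fix e :: real assume "\<forall>e>0. \<exists>k. finite k \<and> closure ?S \<subseteq> (\<Union>x\<in>k. ball x e)" "e > 0"
    then show "\<exists>k. finite k \<and> ?S \<subseteq> (\<Union>x\<in>k. ball x e)"
      using closure_subset[of ?S] by (meson order_trans)
  next
    fix e :: real assume ?tb "e > 0"
    then obtain k where k: "finite k" "?S \<subseteq> (\<Union>x\<in>k. ball x (e/2))"
      by (metis half_gt_zero)
    have "closure ?S \<subseteq> (\<Union>x\<in>k. cball x (e/2))"
    proof (rule closure_minimal)
      show "?S \<subseteq> (\<Union>x\<in>k. cball x (e/2))" using k(2) by force
    qed (use k(1) in auto)
    also have "\<dots> \<subseteq> (\<Union>x\<in>k. ball x e)" using \<open>e > 0\<close> by (intro UN_mono) auto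
    finally show "\<exists>k. finite k \<and> closure ?S \<subseteq> (\<Union>x\<in>k. ball x e)" using k(1) by blast
  qed
  finally show ?thesis by (simp add: compact_operators_def)
qed

lemma closed_compact_operators: "closed compact_operators"
  unfolding closed_sequential_limits
proof (intro allI impI, elim conjE)
  fix F T assume F: "\<forall>n. F n \<in> compact_operators" and lim: "F \<longlonglongrightarrow> T"
  have "T \<in> bounded_operators"
    using F lim closed_bounded_operators compact_operators_bounded
    unfolding closed_sequential_limits by blast
  moreover have "\<exists>k. finite k \<and> blinfun_apply T ` cball 0 1 \<subseteq> (\<Union>x\<in>k. ball x e)" if "e > 0" for e
  proof -
    obtain n where n: "norm (F n - T) < e/2"
      using LIMSEQ_D[OF lim, of "e/2"] \<open>e > 0\<close> by auto
    obtain k where k: "finite k" "blinfun_apply (F n) ` cball 0 1 \<subseteq> (\<Union>x\<in>k. ball x (e/2))"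
      using F \<open>e > 0\<close> unfolding compact_operator_iff_totally_bounded by (metis half_gt_zero)
    have "T f \<in> (\<Union>x\<in>k. ball x e)" if f: "f \<in> cball 0 1" for f
    proof -
      have "F n f \<in> (\<Union>x\<in>k. ball x (e/2))" using k(2) f by blast
      then obtain x where x: "x \<in> k" "dist x (F n f) < e/2" by auto
      have "norm (F n f - T f) \<le> norm (F n - T) * norm f"
        using norm_blinfun[of "F n - T" f] by (simp add: minus_blinfun.rep_eq)
      also have "\<dots> \<le> norm (F n - T) * 1" using f by (intro mult_left_mono) auto
      finally have "dist (F n f) (T f) < e/2" using n by (simp add: dist_norm)
      then have "dist x (T f) < e" using x(2) dist_triangle[of x "T f" "F n f"] by simp
      then show ?thesis using x(1) by auto
    qed
    then show ?thesis using k(1) by blast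
  qed
  ultimately show "T \<in> compact_operators"
    unfolding compact_operator_iff_totally_bounded by blast
qed

definition rank_one :: "h2 \<Rightarrow> h2 \<Rightarrow> (h2 \<Rightarrow>\<^sub>L h2)"
  where "rank_one u v = Blinfun (\<lambda>f. cinner_h2 f u *\<^sub>C v)"

lemma bounded_linear_scaleC_left: "bounded_linear (\<lambda>c. c *\<^sub>C v)"
  by (rule bounded_linear_intro[where K = "norm v"])
    (simp_all add: complex_h2.scale_left_distrib scaleR_eq_scaleC scaleR_conv_of_real norm_scaleC_h2)

lemma rank_one_apply: "rank_one u v f = cinner_h2 f u *\<^sub>C v"
  unfolding rank_one_def
  by (rule bounded_linear_Blinfun_apply[THEN fun_cong])
    (rule bounded_linear_compose[OF bounded_linear_scaleC_left cinner_h2.bounded_linear_left])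

lemma compact_rank_one: "rank_one u v \<in> compact_operators"
  unfolding compact_operators_iff
proof (intro conjI allI impI)
  show "rank_one u v \<in> bounded_operators"
    by (simp add: bounded_operators_def rank_one_apply cinner_h2_scaleC_left)
  fix x :: "nat \<Rightarrow> h2" assume x: "\<forall>n. norm (x n) \<le> 1"
  have "cmod (cinner_h2 (x n) u) \<le> norm u" for n
  proof -
    have "cmod (cinner_h2 (x n) u) \<le> norm (x n) * norm u" by (rule cinner_h2_Cauchy_Schwarz)
    also have "\<dots> \<le> 1 * norm u" using x by (intro mult_right_mono) auto
    finally show ?thesis by simp
  qed
  then have "\<forall>n. cinner_h2 (x n) u \<in> cball 0 (norm u)" by simp
  then obtain l r where r: "strict_mono r" "((\<lambda>n. cinner_h2 (x n) u) \<circ> r) \<longlonglongrightarrow> l"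
    using compact_cball[of "0::complex" "norm u", unfolded compact_def, rule_format,
        of "\<lambda>n. cinner_h2 (x n) u"] by blast
  then have "(\<lambda>n. rank_one u v (x (r n))) \<longlonglongrightarrow> l *\<^sub>C v"
    unfolding rank_one_apply
    using bounded_linear.tendsto[OF bounded_linear_scaleC_left, of _ l sequentially v] by (simp add: comp_def)
  then show "\<exists>r. strict_mono r \<and> convergent (\<lambda>n. rank_one u v (x (r n)))"
    using r(1) by (auto simp: convergent_def)
qed

text \<open>Replacing all but finitely many images of the monomials by zero gives a finite rank operator,
  and by the Cauchy--Schwarz inequality the error in norm is at most the root of the tail of the
  series of their squared norms.\<close>

lemma Hilbert_Schmidt_compact:
  assumes T: "T \<in> bounded_operators"
    and HS: "summable (\<lambda>n. (norm (T (monomial_h2 n)))\<^sup>2)"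
  shows "T \<in> compact_operators"
proof -
  define t where "t n = (norm (T (monomial_h2 n)))\<^sup>2" for n
  define F where "F N = (\<Sum>k<N. rank_one (monomial_h2 k) (T (monomial_h2 k)))" for N
  have F_apply: "F N f = T (h2_truncate N f)" for N f
    by (simp add: F_def blinfun.sum_left h2_truncate_def blinfun.sum_right bounded_operatorsD[OF T]
        rank_one_apply cinner_monomial)
  have tail: "norm (T - F N) \<le> sqrt (\<Sum>n. t (n + N))" for N
  proof (rule norm_blinfun_bound)
    have summ: "summable (\<lambda>n. t (n + N))"
      using HS unfolding t_def by (rule summable_ignore_initial_segment)
    show "0 \<le> sqrt (\<Sum>n. t (n + N))"
      by (intro real_sqrt_ge_zero suminf_nonneg summ) (simp add: t_def)
    fix f
    show "norm ((T - F N) f) \<le> sqrt (\<Sum>n. t (n + N)) * norm f"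
    proof (rule tendsto_upperbound)
      show "(\<lambda>M. norm (T (h2_truncate M f) - F N f)) \<longlonglongrightarrow> norm ((T - F N) f)"
        unfolding minus_blinfun.rep_eq
        by (intro tendsto_intros h2_truncate_tendsto)
      have "norm (T (h2_truncate M f) - F N f) \<le> sqrt (\<Sum>n. t (n + N)) * norm f" if "M \<ge> N" for M
      proof -
        have "h2_truncate M f - h2_truncate N f = (\<Sum>k\<in>{N..<M}. h2_coeff f k *\<^sub>C monomial_h2 k)"
          unfolding h2_truncate_def using \<open>M \<ge> N\<close>
          by (metis atLeast0LessThan sum_diff_nat_ivl zero_le)
        then have "T (h2_truncate M f) - F N f = (\<Sum>k\<in>{N..<M}. h2_coeff f k *\<^sub>C T (monomial_h2 k))"
          by (simp add: F_apply blinfun.diff_right[symmetric] blinfun.sum_right bounded_operatorsD[OF T])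
        then have "norm (T (h2_truncate M f) - F N f)
            \<le> (\<Sum>k\<in>{N..<M}. norm (h2_coeff f k *\<^sub>C T (monomial_h2 k)))"
          by (metis norm_sum)
        also have "\<dots> = (\<Sum>k\<in>{N..<M}. \<bar>cmod (h2_coeff f k)\<bar> * \<bar>norm (T (monomial_h2 k))\<bar>)"
          by (simp add: norm_scaleC_h2)
        also have "\<dots> \<le> L2_set (\<lambda>k. cmod (h2_coeff f k)) {N..<M} * L2_set (\<lambda>k. norm (T (monomial_h2 k))) {N..<M}"
          by (rule L2_set_mult_ineq)
        also have "\<dots> \<le> norm f * sqrt (\<Sum>n. t (n + N))"
        proof (rule mult_mono)
          show "L2_set (\<lambda>k. cmod (h2_coeff f k)) {N..<M} \<le> norm f"
            unfolding L2_set_def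
          proof (rule real_le_lsqrt)
            show "(\<Sum>k\<in>{N..<M}. (cmod (h2_coeff f k))\<^sup>2) \<le> (norm f)\<^sup>2"
              unfolding norm_h2_square by (intro sum_le_suminf summable_h2_coeff) auto
          qed (simp_all add: sum_nonneg)
          have "(\<Sum>k\<in>{N..<M}. t k) = (\<Sum>k<M - N. t (k + N))"
            using sum.shift_bounds_nat_ivl[of t 0 N "M - N"] \<open>M \<ge> N\<close> by (simp add: atLeast0LessThan)
          also have "\<dots> \<le> (\<Sum>n. t (n + N))"
            by (intro sum_le_suminf summ) (auto simp: t_def)
          finally show "L2_set (\<lambda>k. norm (T (monomial_h2 k))) {N..<M} \<le> sqrt (\<Sum>n. t (n + N))"
            unfolding L2_set_def t_def by simp
        qed (auto simp: L2_set_nonneg)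
        finally show ?thesis by (simp add: mult.commute)
      qed
      then show "\<forall>\<^sub>F M in sequentially. norm (T (h2_truncate M f) - F N f) \<le> sqrt (\<Sum>n. t (n + N)) * norm f"
        unfolding eventually_sequentially by blast
    qed simp
  qed
  have "(\<lambda>N. sqrt (\<Sum>n. t (n + N))) \<longlonglongrightarrow> 0"
    using tendsto_real_sqrt[OF suminf_exist_split2[OF HS]] by (simp add: t_def)
  then have "(\<lambda>N. T - F N) \<longlonglongrightarrow> 0"
    by (rule Lim_null_comparison[rotated]) (use tail in auto)
  then have "(\<lambda>N. T - (T - F N)) \<longlonglongrightarrow> T - 0"
    by (intro tendsto_intros)
  then have "F \<longlonglongrightarrow> T" by simp
  moreover have "F N \<in> compact_operators" for N
    unfolding F_def by (intro compact_operators_sum compact_rank_one)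
  ultimately show ?thesis
    using closed_compact_operators unfolding closed_sequential_limits by blast
qed

text \<open>Orthonormal sequences are weakly null (this is Bessel's inequality), and compact operators
  map them to norm null sequences along a subsequence.\<close>

lemma Bessel_inequality:
  fixes x :: "nat \<Rightarrow> h2"
  assumes orth: "\<And>m n. cinner_h2 (x m) (x n) = (if m = n then 1 else 0)"
  shows "(\<Sum>n<N. (cmod (cinner_h2 y (x n)))\<^sup>2) \<le> (norm y)\<^sup>2"
proof -
  define z where "z = (\<Sum>n<N. cinner_h2 y (x n) *\<^sub>C x n)"
  define s where "s = (\<Sum>n<N. (cmod (cinner_h2 y (x n)))\<^sup>2)"
  have yz: "cinner_h2 y z = of_real s"
    by (simp add: z_def s_def cinner_h2.sum_right cinner_h2_scaleC_right complex_norm_square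
        mult.commute del: of_real_power)
  have "cinner_h2 z (x n) = cinner_h2 y (x n)" if "n < N" for n
  proof -
    have "cinner_h2 z (x n) = (\<Sum>k<N. if k = n then cinner_h2 y (x k) else 0)"
      unfolding z_def cinner_h2.sum_left cinner_h2_scaleC_left orth by (intro sum.cong) auto
    then show ?thesis using that by simp
  qed
  then have "cinner_h2 z z = (\<Sum>n<N. cnj (cinner_h2 y (x n)) * cinner_h2 y (x n))"
    by (subst (2) z_def) (simp add: cinner_h2.sum_right cinner_h2_scaleC_right)
  then have "complex_of_real ((norm z)\<^sup>2) = of_real s"
    by (simp add: s_def complex_norm_square mult.commute cinner_h2_self_norm[symmetric]
        del: of_real_power)
  then have zz: "(norm z)\<^sup>2 = s" by (simp only: of_real_eq_iff)
  have "s \<le> norm y * norm z"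
    using cinner_h2_Cauchy_Schwarz[of y z] by (simp add: yz)
  then have "norm z * norm z \<le> norm y * norm z" using zz by (simp add: power2_eq_square)
  then have "norm z \<le> norm y" by (cases "norm z = 0") auto
  then show ?thesis unfolding s_def[symmetric] zz[symmetric] by (intro power_mono) auto
qed

lemma compact_operator_orthonormal:
  fixes x :: "nat \<Rightarrow> h2"
  assumes K: "K \<in> compact_operators"
    and orth: "\<And>m n. cinner_h2 (x m) (x n) = (if m = n then 1 else 0)"
  obtains r where "strict_mono r" "(\<lambda>n. cinner_h2 (K (x (r n))) (x (r n))) \<longlonglongrightarrow> 0"
proof -
  have norm_x: "norm (x n) = 1" for n
    by (rule norm_h2_eq_1) (simp add: orth)
  obtain r y where r: "strict_mono r" and y: "(\<lambda>n. K (x (r n))) \<longlonglongrightarrow> y"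
    using compact_operators_subsequence[OF K, of x] norm_x unfolding convergent_def
    by (metis order_refl)
  have "summable (\<lambda>n. (cmod (cinner_h2 y (x n)))\<^sup>2)"
    by (rule summableI_nonneg_bounded[where x = "(norm y)\<^sup>2"]) (use Bessel_inequality[OF orth] in auto)
  then have "(\<lambda>n. (cmod (cinner_h2 y (x n)))\<^sup>2) \<longlonglongrightarrow> 0"
    by (rule summable_LIMSEQ_zero)
  from tendsto_real_sqrt[OF this] have "(\<lambda>n. cmod (cinner_h2 y (x n))) \<longlonglongrightarrow> 0" by simp
  then have "(\<lambda>n. cmod (cinner_h2 y (x (r n)))) \<longlonglongrightarrow> 0"
    using LIMSEQ_subseq_LIMSEQ[OF _ r] by (fastforce simp: comp_def)
  moreover have "(\<lambda>n. norm (K (x (r n)) - y)) \<longlonglongrightarrow> 0"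
    using y by (rule tendsto_norm_zero[OF LIM_zero])
  ultimately have "(\<lambda>n. norm (K (x (r n)) - y) + cmod (cinner_h2 y (x (r n)))) \<longlonglongrightarrow> 0 + 0"
    by (intro tendsto_add)
  then have "(\<lambda>n. norm (K (x (r n)) - y) + cmod (cinner_h2 y (x (r n)))) \<longlonglongrightarrow> 0"
    by simp
  then have "(\<lambda>n. cinner_h2 (K (x (r n))) (x (r n))) \<longlonglongrightarrow> 0"
  proof (rule Lim_null_comparison[rotated], intro always_eventually allI)
    fix n
    have "cinner_h2 (K (x (r n))) (x (r n))
        = cinner_h2 (K (x (r n)) - y) (x (r n)) + cinner_h2 y (x (r n))"
      by (simp add: cinner_h2_simps)
    also have "cmod \<dots> \<le> cmod (cinner_h2 (K (x (r n)) - y) (x (r n))) + cmod (cinner_h2 y (x (r n)))"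
      by (rule norm_triangle_ineq)
    also have "cmod (cinner_h2 (K (x (r n)) - y) (x (r n))) \<le> norm (K (x (r n)) - y)"
      using cinner_h2_Cauchy_Schwarz[of "K (x (r n)) - y" "x (r n)"] by (simp add: norm_x)
    finally show "cmod (cinner_h2 (K (x (r n))) (x (r n)))
        \<le> norm (K (x (r n)) - y) + cmod (cinner_h2 y (x (r n)))" by simp
  qed
  with r show ?thesis by (rule that)
qed

section \<open>The shift, dense subspaces and extension of operators\<close>

definition shift_fun :: "h2 \<Rightarrow> h2"
  where "shift_fun f = h2_of (\<lambda>n. if n = 0 then 0 else h2_coeff f (n - 1))"

definition shift :: "h2 \<Rightarrow>\<^sub>L h2"
  where "shift = Blinfun shift_fun"

lemma h2_coeff_shift_fun: "h2_coeff (shift_fun f) n = (if n = 0 then 0 else h2_coeff f (n - 1))"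
proof -
  have "summable (\<lambda>n. (cmod (if Suc n = 0 then 0 else h2_coeff f (Suc n - 1)))\<^sup>2)"
    using summable_h2_coeff[of f] by simp
  then have "summable (\<lambda>n. (cmod (if n = 0 then 0 else h2_coeff f (n - 1)))\<^sup>2)"
    by (subst (asm) summable_Suc_iff)
  then show ?thesis unfolding shift_fun_def by (rule h2_coeff_h2_of)
qed

lemma norm_shift_fun: "norm (shift_fun f) = norm f"
proof -
  have "(norm (shift_fun f))\<^sup>2 = (\<Sum>n. (cmod (h2_coeff (shift_fun f) (Suc n)))\<^sup>2)
      + (cmod (h2_coeff (shift_fun f) 0))\<^sup>2"
    unfolding norm_h2_square using suminf_split_head[OF summable_h2_coeff[of "shift_fun f"]] by simp
  also have "\<dots> = (norm f)\<^sup>2"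
    by (simp add: h2_coeff_shift_fun norm_h2_square)
  finally show ?thesis by (simp add: power2_eq_iff_nonneg)
qed

lemma shift_apply: "shift f = shift_fun f"
proof -
  have "bounded_linear shift_fun"
    by (rule bounded_linear_intro[where K = 1])
      (auto simp: norm_shift_fun intro!: h2_eqI_coeff
        simp: h2_coeff_shift_fun h2_coeff_add h2_coeff_scaleC scaleR_eq_scaleC)
  then show ?thesis by (simp add: shift_def bounded_linear_Blinfun_apply)
qed

lemma norm_shift: "norm (shift f) = norm f"
  by (simp add: shift_apply norm_shift_fun)

lemma bounded_operators_shift: "shift \<in> bounded_operators"
  by (auto simp: bounded_operators_def shift_apply h2_coeff_shift_fun h2_coeff_scaleC intro!: h2_eqI_coeff)

lemma shift_monomial: "shift (monomial_h2 n) = monomial_h2 (Suc n)"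
  by (auto simp: shift_apply h2_coeff_shift_fun h2_coeff_monomial intro!: h2_eqI_coeff)

lemma Rep_h2_shift:
  assumes "z \<in> ball 0 1"
  shows "Rep_h2 (shift f) z = z * Rep_h2 f z"
proof -
  have "(\<lambda>n. z * (h2_coeff f n * z ^ n)) sums (z * Rep_h2 f z)"
    by (intro sums_mult h2_power_series assms)
  then have "(\<lambda>n. h2_coeff (shift f) (Suc n) * z ^ Suc n) sums (z * Rep_h2 f z)"
    by (simp add: shift_apply h2_coeff_shift_fun mult_ac)
  then have "(\<lambda>n. h2_coeff (shift f) n * z ^ n) sums (z * Rep_h2 f z)"
    by (subst (asm) sums_Suc_iff) (simp add: shift_apply h2_coeff_shift_fun)
  with h2_power_series[OF assms, of "shift f"] show ?thesis by (rule sums_unique2)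
qed

lemma geometric_h2_shift:
  assumes "cmod w < 1"
  shows "geometric_h2 w = monomial_h2 0 + w *\<^sub>C shift (geometric_h2 w)"
proof (rule h2_eqI_coeff)
  fix n show "h2_coeff (geometric_h2 w) n = h2_coeff (monomial_h2 0 + w *\<^sub>C shift (geometric_h2 w)) n"
    using assms by (cases n) (simp_all add: h2_coeff_add h2_coeff_scaleC h2_coeff_geometric
      h2_coeff_monomial shift_apply h2_coeff_shift_fun)
qed

lemma complex_subspace_closure:
  assumes X: "complex_h2.subspace X"
  shows "complex_h2.subspace (closure X)"
proof (rule complex_h2.subspaceI)
  show "0 \<in> closure X" using complex_h2.subspace_0[OF X] closure_subset by blast
next
  fix x y assume "x \<in> closure X" "y \<in> closure X"
  then obtain u v where u: "\<And>n. u n \<in> X" "u \<longlonglongrightarrow> x" and v: "\<And>n. v n \<in> X" "v \<longlonglongrightarrow> y"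
    unfolding closure_sequential by blast
  have "(\<lambda>n. u n + v n) \<longlonglongrightarrow> x + y" by (intro tendsto_add u v)
  then show "x + y \<in> closure X"
    unfolding closure_sequential using complex_h2.subspace_add[OF X u(1) v(1)] by fast
next
  fix c x assume "x \<in> closure X"
  then obtain u where u: "\<And>n. u n \<in> X" "u \<longlonglongrightarrow> x" unfolding closure_sequential by blast
  have "(\<lambda>n. c *\<^sub>C u n) \<longlonglongrightarrow> c *\<^sub>C x" by (intro tendsto_scaleC_h2 u)
  then show "c *\<^sub>C x \<in> closure X"
    unfolding closure_sequential using complex_h2.subspace_scale[OF X u(1)] by fast
qed

text \<open>After subtracting the first \<open>n\<close> terms and dividing by the \<open>n\<close>-th power of the ratio, a geometric
  series with small ratio is close to the \<open>n\<close>-th monomial.  So the closure of the subspace contains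
  all monomials, one after the other.\<close>

lemma dense_if_geometric_series:
  assumes X: "complex_h2.subspace X"
    and w: "w \<longlonglongrightarrow> 0" "\<And>n. w n \<noteq> 0" "\<And>n. cmod (w n) < 1" "\<And>n. geometric_h2 (w n) \<in> X"
  shows "closure X = UNIV"
proof -
  note Y = complex_subspace_closure[OF X]
  have bound: "norm (geometric_h2 c) \<le> 2" if "cmod c < 1/2" for c
  proof -
    have "geometric_h2 c = monomial_h2 0 + c *\<^sub>C shift (geometric_h2 c)"
      by (rule geometric_h2_shift) (use that in linarith)
    then have "norm (geometric_h2 c) \<le> norm (monomial_h2 0) + norm (c *\<^sub>C shift (geometric_h2 c))"
      using norm_triangle_ineq by metis
    also have "\<dots> = 1 + cmod c * norm (geometric_h2 c)"
      by (simp add: norm_scaleC_h2 norm_shift)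
    also have "\<dots> \<le> 1 + 1/2 * norm (geometric_h2 c)"
      using that by (intro add_left_mono mult_right_mono) auto
    finally show ?thesis by simp
  qed
  have lim0: "(\<lambda>n. geometric_h2 (w n)) \<longlonglongrightarrow> monomial_h2 0"
  proof (rule LIM_zero_cancel, rule Lim_null_comparison)
    show "(\<lambda>n. 2 * cmod (w n)) \<longlonglongrightarrow> 0"
      using tendsto_mult_left[OF tendsto_norm_zero[OF w(1)], of 2] by simp
    have "eventually (\<lambda>n. cmod (w n) < 1/2) sequentially"
      using tendsto_norm_zero[OF w(1)] by (rule order_tendstoD(2)) simp
    then show "eventually (\<lambda>n. norm (geometric_h2 (w n) - monomial_h2 0) \<le> 2 * cmod (w n)) sequentially"
    proof eventually_elim
      case (elim n)
      have "geometric_h2 (w n) - monomial_h2 0 = w n *\<^sub>C shift (geometric_h2 (w n))"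
        using geometric_h2_shift[OF w(3)[of n]] by (metis add_diff_cancel_left')
      then show ?case
        using mult_left_mono[OF bound[OF elim], of "cmod (w n)"]
        by (simp add: norm_scaleC_h2 norm_shift mult.commute)
    qed
  qed
  have mono: "monomial_h2 N \<in> closure X" for N
  proof (induction N rule: less_induct)
    case (less N)
    have lim: "(\<lambda>n. (blinfun_apply shift ^^ N) (geometric_h2 (w n))) \<longlonglongrightarrow> monomial_h2 N" for N
    proof (induction N)
      case (Suc N)
      then show ?case
        using blinfun.tendsto[OF tendsto_const Suc, of shift] by (simp add: shift_monomial)
    qed (use lim0 in simp)
    have eq: "geometric_h2 (w n) = (\<Sum>k<N. w n ^ k *\<^sub>C monomial_h2 k)
        + w n ^ N *\<^sub>C (blinfun_apply shift ^^ N) (geometric_h2 (w n))" for n N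
    proof (induction N)
      case (Suc N)
      define G where "G N = (blinfun_apply shift ^^ N) (geometric_h2 (w n))" for N
      have G_Suc: "G (Suc N) = shift (G N)" for N by (simp add: G_def)
      have step: "G N = monomial_h2 N + w n *\<^sub>C G (Suc N)" for N
      proof (induction N)
        case 0
        show ?case
          using geometric_h2_shift[OF w(3)] unfolding G_def funpow.simps id_apply comp_apply .
      next
        case (Suc N)
        have "G (Suc N) = shift (monomial_h2 N + w n *\<^sub>C G (Suc N))"
          using G_Suc Suc by metis
        then show ?case
          unfolding G_Suc[of "Suc N"]
          by (simp only: blinfun.add_right bounded_operatorsD[OF bounded_operators_shift] shift_monomial)
      qed
      have "w n ^ N *\<^sub>C G N = w n ^ N *\<^sub>C monomial_h2 N + w n ^ Suc N *\<^sub>C G (Suc N)"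
        by (subst step) (simp add: complex_h2.scale_right_distrib mult.commute)
      with Suc show ?case
        unfolding G_def[symmetric] by (simp add: add.assoc)
    qed simp
    have "(blinfun_apply shift ^^ N) (geometric_h2 (w n)) \<in> closure X" for n
    proof -
      have "(\<Sum>k<N. w n ^ k *\<^sub>C monomial_h2 k) \<in> closure X"
        by (intro complex_h2.subspace_sum[OF Y] complex_h2.subspace_scale[OF Y] less) auto
      moreover have "geometric_h2 (w n) \<in> closure X" using w(4) closure_subset by blast
      ultimately have "w n ^ N *\<^sub>C (blinfun_apply shift ^^ N) (geometric_h2 (w n)) \<in> closure X"
        using complex_h2.subspace_diff[OF Y] eq[of n N] by (metis add_diff_cancel_left')
      then have "inverse (w n ^ N) *\<^sub>C (w n ^ N *\<^sub>C (blinfun_apply shift ^^ N) (geometric_h2 (w n))) \<in> closure X"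
        by (rule complex_h2.subspace_scale[OF Y])
      then show ?thesis using w(2)[of n] by simp
    qed
    then show ?case
      using closed_sequentially[OF closed_closure _ lim] by blast
  qed
  have "f \<in> closure X" for f
  proof (rule closed_sequentially[OF closed_closure _ h2_truncate_tendsto])
    show "h2_truncate N f \<in> closure X" for N
      unfolding h2_truncate_def
      by (intro complex_h2.subspace_sum[OF Y] complex_h2.subspace_scale[OF Y] mono)
  qed
  then show ?thesis by blast
qed

text \<open>A bounded linear map on a dense subspace is uniformly continuous, so it extends; linearity over
  the complex numbers and the bound are inherited by limits.\<close>

lemma bounded_operator_extension:
  assumes X: "complex_h2.subspace X" and dense: "closure X = UNIV"
    and add: "\<And>x y. x \<in> X \<Longrightarrow> y \<in> X \<Longrightarrow> g (x + y) = g x + g y"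
    and scale: "\<And>c x. x \<in> X \<Longrightarrow> g (c *\<^sub>C x) = c *\<^sub>C g x"
    and bound: "\<And>x. x \<in> X \<Longrightarrow> norm (g x) \<le> B * norm x" and B: "B \<ge> 0"
  shows "\<exists>T\<in>bounded_operators. norm T \<le> B \<and> (\<forall>x\<in>X. blinfun_apply T x = g x)"
proof -
  have diff: "g x - g y = g (x - y)" if "x \<in> X" "y \<in> X" for x y
    using add[of "x - y" y] complex_h2.subspace_diff[OF X that] that by simp
  have "uniformly_continuous_on X g"
    unfolding uniformly_continuous_on_def
  proof (intro allI impI)
    fix e :: real assume "e > 0"
    have "dist (g x') (g x) < e" if "x \<in> X" "x' \<in> X" "dist x' x < e / (B + 1)" for x x'
    proof -
      have "dist (g x') (g x) \<le> B * norm (x' - x)"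
        unfolding dist_norm using diff bound complex_h2.subspace_diff[OF X] that by metis
      also have "\<dots> \<le> (B + 1) * norm (x' - x)" by (intro mult_right_mono) auto
      also have "\<dots> < e" using that(3) B by (simp add: dist_norm field_simps)
      finally show ?thesis .
    qed
    then show "\<exists>d>0. \<forall>x\<in>X. \<forall>x'\<in>X. dist x' x < d \<longrightarrow> dist (g x') (g x) < e"
      using \<open>e > 0\<close> B by (intro exI[of _ "e / (B + 1)"]) auto
  qed
  then obtain h where "uniformly_continuous_on (closure X) h" and hg: "\<And>x. x \<in> X \<Longrightarrow> g x = h x"
    using uniformly_continuous_on_extension_on_closure[of X g] by metis
  then have h: "continuous_on UNIV h"
    using dense uniformly_continuous_imp_continuous by metis
  have tend: "(\<lambda>n. h (u n)) \<longlonglongrightarrow> h x" if "u \<longlonglongrightarrow> x" for u :: "nat \<Rightarrow> h2" and x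
    using continuous_on_tendsto_compose[OF h that] by simp
  have approx: "\<exists>u. (\<forall>n. u n \<in> X) \<and> u \<longlonglongrightarrow> x" for x
    using dense closure_sequential[of x X] by auto
  have h_add: "h (x + y) = h x + h y" for x y
  proof -
    obtain u v where u: "\<And>n. u n \<in> X" "u \<longlonglongrightarrow> x" and v: "\<And>n. v n \<in> X" "v \<longlonglongrightarrow> y"
      using approx by meson
    have "(\<lambda>n. h (u n + v n)) \<longlonglongrightarrow> h (x + y)" by (intro tend tendsto_add u v)
    moreover have "h (u n + v n) = h (u n) + h (v n)" for n
      using add[OF u(1) v(1), of n n] u(1) v(1) complex_h2.subspace_add[OF X] hg by simp
    ultimately have "(\<lambda>n. h (u n) + h (v n)) \<longlonglongrightarrow> h (x + y)" by simp
    moreover have "(\<lambda>n. h (u n) + h (v n)) \<longlonglongrightarrow> h x + h y" by (intro tendsto_add tend u v)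
    ultimately show ?thesis by (rule LIMSEQ_unique)
  qed
  have h_scale: "h (c *\<^sub>C x) = c *\<^sub>C h x" for c x
  proof -
    obtain u where u: "\<And>n. u n \<in> X" "u \<longlonglongrightarrow> x" using approx by meson
    have "(\<lambda>n. h (c *\<^sub>C u n)) \<longlonglongrightarrow> h (c *\<^sub>C x)" by (intro tend tendsto_scaleC_h2 u)
    moreover have "h (c *\<^sub>C u n) = c *\<^sub>C h (u n)" for n
      using scale[OF u(1), of c n] u(1) complex_h2.subspace_scale[OF X] hg by simp
    ultimately have "(\<lambda>n. c *\<^sub>C h (u n)) \<longlonglongrightarrow> h (c *\<^sub>C x)" by simp
    moreover have "(\<lambda>n. c *\<^sub>C h (u n)) \<longlonglongrightarrow> c *\<^sub>C h x" by (intro tendsto_scaleC_h2 tend u)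
    ultimately show ?thesis by (rule LIMSEQ_unique)
  qed
  have h_bound: "norm (h x) \<le> B * norm x" for x
  proof -
    obtain u where u: "\<And>n. u n \<in> X" "u \<longlonglongrightarrow> x" using approx by meson
    show ?thesis
    proof (rule LIMSEQ_le)
      show "(\<lambda>n. norm (h (u n))) \<longlonglongrightarrow> norm (h x)" by (intro tendsto_norm tend u)
      show "(\<lambda>n. B * norm (u n)) \<longlonglongrightarrow> B * norm x" by (intro tendsto_intros u)
      show "\<exists>N. \<forall>n\<ge>N. norm (h (u n)) \<le> B * norm (u n)" using bound u(1) hg by metis
    qed
  qed
  have lin: "bounded_linear h"
    by (rule bounded_linear_intro[where K = B])
      (simp_all add: h_add scaleR_eq_scaleC h_scale h_bound mult.commute[of _ B])
  show ?thesis
  proof (intro bexI conjI ballI)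
    show "Blinfun h \<in> bounded_operators"
      by (simp add: bounded_operators_def bounded_linear_Blinfun_apply[OF lin] h_scale)
    show "norm (Blinfun h) \<le> B"
      by (rule norm_blinfun_bound) (simp_all add: B bounded_linear_Blinfun_apply[OF lin] h_bound)
    show "Blinfun h x = g x" if "x \<in> X" for x
      using hg[OF that] by (simp add: bounded_linear_Blinfun_apply[OF lin])
  qed
qed

section \<open>Continuous functions on the unit interval\<close>

abbreviation continuous01 :: "(real \<Rightarrow> complex) \<Rightarrow> bool"
  where "continuous01 f \<equiv> continuous_on {0..1} f"

definition inner01 :: "(real \<Rightarrow> complex) \<Rightarrow> (real \<Rightarrow> complex) \<Rightarrow> complex"
  where "inner01 f g = integral {0..1} (\<lambda>t. f t * cnj (g t))"

lemma integrable01: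
  assumes "continuous01 f" "continuous01 g"
  shows "(\<lambda>t. f t * cnj (g t)) integrable_on {0..1}"
  by (intro integrable_continuous_real continuous_intros assms)

lemma inner01_cnj: "inner01 f g = cnj (inner01 g f)"
  by (simp add: inner01_def integral_cnj mult.commute)

lemma inner01_add:
  assumes "continuous01 f" "continuous01 g" "continuous01 h"
  shows "inner01 (\<lambda>t. f t + g t) h = inner01 f h + inner01 g h"
  unfolding inner01_def distrib_right
  by (intro integral_add integrable01 assms)

lemma inner01_bound:
  assumes "continuous01 f" "continuous01 g" "\<And>t. t \<in> {0..1} \<Longrightarrow> cmod (f t) \<le> A"
    "\<And>t. t \<in> {0..1} \<Longrightarrow> cmod (g t) \<le> B" "A \<ge> 0"
  shows "cmod (inner01 f g) \<le> A * B"
proof -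
  have "cmod (inner01 f g) \<le> integral {0..1::real} (\<lambda>t. A * B)"
    unfolding inner01_def
    by (intro integral_norm_bound_integral integrable01 assms)
      (use assms in \<open>auto simp: norm_mult intro!: mult_mono\<close>)
  then show ?thesis by simp
qed

lemma inner01_self: "inner01 f f = integral {0..1} (\<lambda>t. complex_of_real ((cmod (f t))\<^sup>2))"
  by (simp add: inner01_def complex_norm_square del: of_real_power)

lemma continuous01_power_function: "Re a > 0 \<Longrightarrow> continuous01 (power_function a)"
  unfolding power_function_def restrict_def
  by (subst continuous_on_cong[OF refl, of _ _ "\<lambda>t. complex_of_real t powr a"])
    (auto intro!: continuous_intros)

lemma continuous01_monomial: "continuous01 (\<lambda>t. complex_of_real t ^ i)"
  by (intro continuous_intros)

text \<open>The integrand is prescribed on the open interval only, since \<open>t ^ 0\<close> and \<open>t powr 0\<close> differ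
  at \<open>t = 0\<close>.\<close>

lemma has_integral_complex_power:
  assumes s: "Re s > - 1" and f: "\<And>t. 0 < t \<Longrightarrow> t < 1 \<Longrightarrow> f t = complex_of_real t powr s"
  shows "(f has_integral 1 / (s + 1)) {0..1}"
proof -
  define F where "F t = complex_of_real t powr (s + 1) / (s + 1)" for t
  have s1: "s + 1 \<noteq> 0"
  proof
    assume "s + 1 = 0"
    then have "Re (s + 1) = 0" by simp
    with s show False by simp
  qed
  have "(f has_integral (F 1 - F 0)) {0..1}"
  proof (rule fundamental_theorem_of_calculus_interior_strong[of "{}"])
    show "continuous_on {0..1} F"
      unfolding F_def using s by (intro continuous_intros) (use s1 in auto)
    fix t :: real assume "t \<in> {0<..<1} - {}"
    then have t: "0 < t" "t < 1" by auto
    have "((\<lambda>z. z powr (s + 1) / (s + 1)) has_field_derivative complex_of_real t powr s) (at (of_real t))"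
      using t s1 by (auto intro!: derivative_eq_intros simp: complex_nonpos_Reals_iff)
    from field_vector_diff_chain_at[OF has_vector_derivative_of_real[OF DERIV_ident] this]
    show "(F has_vector_derivative f t) (at t)"
      using f[OF t] by (simp add: comp_def F_def[abs_def])
  qed auto
  then show ?thesis using s1 by (simp add: F_def)
qed

text \<open>Bernstein polynomials are introduced as formal polynomials because they are evaluated in three
  ways: at numbers, at the vectors of the powers of \<open>t\<close>, and at operators.\<close>

definition bernstein_factor :: "nat \<Rightarrow> nat \<Rightarrow> complex poly"
  where "bernstein_factor n k = Polynomial.smult (of_nat (n choose k)) ([:0, 1:] ^ k * [:1, -1:] ^ (n - k))"

definition bernstein_poly :: "nat \<Rightarrow> (real \<Rightarrow> complex) \<Rightarrow> complex poly"
  where "bernstein_poly n q = (\<Sum>k\<le>n. Polynomial.smult (q (k / n)) (bernstein_factor n k))"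

lemma poly_bernstein:
  "poly (bernstein_poly n q) (of_real t) = (\<Sum>k\<le>n. q (k / n) * of_real (Bernstein n k t))"
  by (simp add: bernstein_poly_def bernstein_factor_def poly_sum Bernstein_def mult_ac)

lemma bernstein_poly_cong:
  assumes "\<And>t. t \<in> {0..1} \<Longrightarrow> q t = r t"
  shows "bernstein_poly n q = bernstein_poly n r"
  unfolding bernstein_poly_def by (intro sum.cong) (use assms in \<open>auto simp: divide_le_eq\<close>)

lemma bernstein_poly_add:
  "bernstein_poly n (\<lambda>t. q t + r t) = bernstein_poly n q + bernstein_poly n r"
  by (simp add: bernstein_poly_def smult_add_left sum.distrib)

lemma bernstein_poly_cmult: "bernstein_poly n (\<lambda>t. c * q t) = Polynomial.smult c (bernstein_poly n q)"
  by (simp add: bernstein_poly_def poly_eq_iff coeff_sum sum_distrib_left mult.assoc)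

lemma bernstein_approximation:
  assumes q: "continuous01 q" and e: "e > 0"
  shows "\<exists>N. \<forall>n\<ge>N. \<forall>t\<in>{0..1}. cmod (poly (bernstein_poly n q) (of_real t) - q t) < e"
proof -
  have re: "continuous_on {0..1} (\<lambda>t. Re (q t))" and im: "continuous_on {0..1} (\<lambda>t. Im (q t))"
    by (intro continuous_intros q)+
  obtain N where
    N: "\<And>n t. n \<ge> N \<Longrightarrow> t \<in> {0..1} \<Longrightarrow> \<bar>Re (q t) - (\<Sum>k\<le>n. Re (q (k / n)) * Bernstein n k t)\<bar> < e/2"
    using Bernstein_Weierstrass[OF re, of "e/2"] e by auto
  obtain M where
    M: "\<And>n t. n \<ge> M \<Longrightarrow> t \<in> {0..1} \<Longrightarrow> \<bar>Im (q t) - (\<Sum>k\<le>n. Im (q (k / n)) * Bernstein n k t)\<bar> < e/2"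
    using Bernstein_Weierstrass[OF im, of "e/2"] e by auto
  have "cmod (poly (bernstein_poly n q) (of_real t) - q t) < e" if "n \<ge> max N M" "t \<in> {0..1}" for n t
  proof -
    let ?d = "poly (bernstein_poly n q) (of_real t) - q t"
    have "\<bar>Re ?d\<bar> < e/2" "\<bar>Im ?d\<bar> < e/2"
      using N[of n t] M[of n t] that by (simp_all add: poly_bernstein abs_minus_commute)
    then show ?thesis using cmod_le[of ?d] by simp
  qed
  then show ?thesis by blast
qed

lemma continuous01_poly: "continuous01 (\<lambda>t. poly p (complex_of_real t))"
  by (intro continuous_intros)

lemma continuous01_bounded:
  assumes "continuous01 f"
  obtains M where "M > 0" "\<And>t. t \<in> {0..1} \<Longrightarrow> cmod (f t) \<le> M"
proof -
  have "bounded (f ` {0..1})"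
    by (intro compact_imp_bounded compact_continuous_image assms compact_Icc)
  then show thesis using that by (auto simp: bounded_pos)
qed

lemma inner01_bernstein_tendsto:
  assumes f: "continuous01 f" and g: "continuous01 g"
  shows "(\<lambda>n. inner01 (\<lambda>t. poly (bernstein_poly n f) (of_real t)) g) \<longlonglongrightarrow> inner01 f g"
proof (rule LIMSEQ_I)
  fix e :: real assume "e > 0"
  obtain M where M: "M > 0" "\<And>t. t \<in> {0..1} \<Longrightarrow> cmod (g t) \<le> M"
    using continuous01_bounded[OF g] by blast
  have "e / (2 * M) > 0" using M(1) \<open>e > 0\<close> by simp
  then obtain N where N: "\<And>n t. n \<ge> N \<Longrightarrow> t \<in> {0..1} \<Longrightarrow>
      cmod (poly (bernstein_poly n f) (of_real t) - f t) < e / (2 * M)"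
    using bernstein_approximation[OF f] by meson
  have "norm (inner01 (\<lambda>t. poly (bernstein_poly n f) (of_real t)) g - inner01 f g) < e" if "n \<ge> N" for n
  proof -
    let ?p = "\<lambda>t::real. poly (bernstein_poly n f) (of_real t)"
    have c: "continuous01 (\<lambda>t. ?p t - f t)" by (intro continuous_on_diff continuous01_poly f)
    have "inner01 (\<lambda>t. (?p t - f t) + f t) g = inner01 (\<lambda>t. ?p t - f t) g + inner01 f g"
      by (rule inner01_add[OF c f g])
    then have "inner01 ?p g - inner01 f g = inner01 (\<lambda>t. ?p t - f t) g" by simp
    also have "cmod \<dots> \<le> e / (2 * M) * M"
      by (rule inner01_bound[OF c g]) (use N[OF that] M \<open>e > 0\<close> in \<open>auto intro: less_imp_le\<close>)
    also have "\<dots> < e" using M(1) \<open>e > 0\<close> by simp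
    finally show ?thesis .
  qed
  then show "\<exists>N. \<forall>n\<ge>N. norm (inner01 (\<lambda>t. poly (bernstein_poly n f) (of_real t)) g - inner01 f g) < e"
    by blast
qed

section \<open>The Hardy space as a space of square integrable functions\<close>

locale boundary_point =
  fixes \<gamma> :: complex
  assumes norm_\<gamma>: "cmod \<gamma> = 1"
begin

lemma \<gamma>_nonzero: "\<gamma> \<noteq> 0"
  using norm_\<gamma> by auto

lemma \<gamma>_cnj: "\<gamma> * cnj \<gamma> = 1"
  using complex_norm_square[of \<gamma>] norm_\<gamma> by simp

text \<open>In the coordinate \<open>w = cayley \<gamma> z\<close> of the right half-plane, elements of the Hardy space are the
  functions \<open>(w + 1) F(w)\<close> where \<open>F\<close> is the Laplace transform of a square integrable function
  of \<open>x > 0\<close>.  The substitution \<open>t = exp (- x)\<close> turns this into the space of square integrable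
  functions on the unit interval.  The vectors below are the images of the powers \<open>t\<^sup>\<nu>\<close>, for which
  \<open>F(w)\<close> is a multiple of \<open>1 / (w + \<nu> + 1/2)\<close>; in the disk they are multiples of geometric series.\<close>

definition ratio :: "complex \<Rightarrow> complex"
  where "ratio \<nu> = cnj \<gamma> * (\<nu> - 1/2) / (\<nu> + 3/2)"

definition power_vec :: "complex \<Rightarrow> h2"
  where "power_vec \<nu> = (of_real (sqrt 2) / (\<nu> + 3/2)) *\<^sub>C geometric_h2 (ratio \<nu>)"

lemma power_vec_denominator: "Re \<nu> > - 1/2 \<Longrightarrow> \<nu> + 3/2 \<noteq> 0"
proof
  assume "Re \<nu> > - 1/2" "\<nu> + 3/2 = 0"
  then have "Re (\<nu> + 3/2) = 0" by (simp only: zero_complex.sel)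
  with \<open>Re \<nu> > - 1/2\<close> show False by simp
qed

lemma cmod_ratio:
  assumes "Re \<nu> > - 1/2"
  shows "cmod (ratio \<nu>) < 1"
proof -
  have "(cmod (\<nu> - 1/2))\<^sup>2 < (cmod (\<nu> + 3/2))\<^sup>2"
    using assms unfolding cmod_power2 by (simp add: power2_eq_square algebra_simps)
  then have "cmod (\<nu> - 1/2) < cmod (\<nu> + 3/2)"
    by (rule power_less_imp_less_base) simp
  then show ?thesis
    using power_vec_denominator[OF assms]
    by (simp add: ratio_def norm_mult norm_divide norm_\<gamma> divide_less_eq_1)
qed

text \<open>The right-hand side is the integral of \<open>t\<^sup>\<nu>\<close> times the conjugate of \<open>t\<^sup>\<mu>\<close>: the vectors
  \<open>power_vec\<close> have the Gram matrix of the powers.\<close>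

lemma cinner_power_vec:
  assumes \<nu>: "Re \<nu> > - 1/2" and \<mu>: "Re \<mu> > - 1/2"
  shows "cinner_h2 (power_vec \<nu>) (power_vec \<mu>) = 1 / (\<nu> + cnj \<mu> + 1)"
proof -
  let ?n = "\<nu> + 3/2" and ?m = "cnj \<mu> + 3/2"
  have n0: "?n \<noteq> 0" by (rule power_vec_denominator[OF \<nu>])
  have m0: "?m \<noteq> 0" using power_vec_denominator[of "cnj \<mu>"] \<mu> by simp
  have s2: "complex_of_real (sqrt 2) * of_real (sqrt 2) = 2"
    by (metis of_real_mult of_real_numeral real_sqrt_mult_self abs_numeral)
  have r: "ratio \<nu> * cnj (ratio \<mu>) = (\<nu> - 1/2) * (cnj \<mu> - 1/2) / (?n * ?m)"
  proof -
    have "ratio \<nu> * cnj (ratio \<mu>) = (\<gamma> * cnj \<gamma>) * ((\<nu> - 1/2) * (cnj \<mu> - 1/2)) / (?n * ?m)"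
      by (simp add: ratio_def)
    then show ?thesis by (simp add: \<gamma>_cnj)
  qed
  have e: "?n * ?m - (\<nu> - 1/2) * (cnj \<mu> - 1/2) = 2 * (\<nu> + cnj \<mu> + 1)"
    by (simp add: field_simps)
  have "cinner_h2 (geometric_h2 (ratio \<nu>)) (geometric_h2 (ratio \<mu>)) = 1 / (1 - ratio \<nu> * cnj (ratio \<mu>))"
    using cinner_geometric[OF cmod_ratio[OF \<mu>]] Rep_h2_geometric[OF cmod_ratio[OF \<nu>], of "cnj (ratio \<mu>)"]
      cmod_ratio[OF \<mu>] by simp
  also have "\<dots> = ?n * ?m / (2 * (\<nu> + cnj \<mu> + 1))"
  proof -
    have "1 - ratio \<nu> * cnj (ratio \<mu>) = 2 * (\<nu> + cnj \<mu> + 1) / (?n * ?m)"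
      unfolding r e[symmetric] using n0 m0 by (simp add: diff_divide_distrib)
    then show ?thesis by simp
  qed
  finally have g: "cinner_h2 (geometric_h2 (ratio \<nu>)) (geometric_h2 (ratio \<mu>)) = ?n * ?m / (2 * (\<nu> + cnj \<mu> + 1))" .
  have "cinner_h2 (power_vec \<nu>) (power_vec \<mu>)
      = (of_real (sqrt 2) * of_real (sqrt 2)) / (?n * ?m) * (?n * ?m / (2 * (\<nu> + cnj \<mu> + 1)))"
    by (simp add: power_vec_def cinner_h2_scaleC_left cinner_h2_scaleC_right g)
  also have "\<dots> = 1 / (\<nu> + cnj \<mu> + 1)"
  proof -
    have "2 / k * (k / (2 * s)) = 1 / s" if "k \<noteq> 0" for k s :: complex
      using that by simp
    then show ?thesis unfolding s2 using n0 m0 by (metis mult_eq_0_iff)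
  qed
  finally show ?thesis .
qed

lemma Rep_power_vec:
  assumes \<nu>: "Re \<nu> > - 1/2" and z: "z \<in> ball 0 1"
  shows "Rep_h2 (power_vec \<nu>) z = of_real (sqrt 2) / 2 * ((cayley \<gamma> z + 1) / (cayley \<gamma> z + \<nu> + 1/2))"
proof -
  have gz: "\<gamma> - z \<noteq> 0" using z norm_\<gamma> by auto
  have w: "cayley \<gamma> z + 1 = 2 * \<gamma> / (\<gamma> - z)"
    using gz by (simp add: cayley_def field_simps)
  have v: "cayley \<gamma> z + \<nu> + 1/2 = ((\<nu> + 3/2) * \<gamma> - (\<nu> - 1/2) * z) / (\<gamma> - z)"
    using gz by (simp add: cayley_def field_simps)
  have n0: "\<nu> + 3/2 \<noteq> 0" by (rule power_vec_denominator[OF \<nu>])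
  have "Rep_h2 (power_vec \<nu>) z = of_real (sqrt 2) / (\<nu> + 3/2) * (1 / (1 - ratio \<nu> * z))"
    by (simp add: power_vec_def scaleC_h2.rep_eq Rep_h2_geometric[OF cmod_ratio[OF \<nu>] z])
  also have "1 - ratio \<nu> * z = ((\<nu> + 3/2) * \<gamma> - (\<nu> - 1/2) * z) / ((\<nu> + 3/2) * \<gamma>)"
  proof -
    have "cnj \<gamma> = 1 / \<gamma>" using \<gamma>_cnj \<gamma>_nonzero by (simp add: field_simps)
    then have "ratio \<nu> = (\<nu> - 1/2) / ((\<nu> + 3/2) * \<gamma>)" by (simp add: ratio_def)
    moreover have "1 - x / k * z = (k - x * z) / k" if "k \<noteq> 0" for k x :: complex
      using that by (simp add: diff_divide_distrib)
    ultimately show ?thesis using n0 \<gamma>_nonzero by (metis mult_eq_0_iff)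
  qed
  finally show ?thesis
    unfolding w v using n0 gz \<gamma>_nonzero by simp
qed

lemma dense_power_vec:
  assumes X: "complex_h2.subspace X" and pv: "\<And>\<nu>. Re \<nu> > 0 \<Longrightarrow> power_vec \<nu> \<in> X"
  shows "closure X = UNIV"
proof (rule dense_if_geometric_series[OF X])
  define r where "r n = inverse (real (Suc (Suc n)))" for n
  have r: "0 < r n" "r n < 1" for n by (simp_all add: r_def field_simps)
  (* The solution of ratio \<nu> = cnj \<gamma> * r. *)
  define \<nu> where "\<nu> n = (1/2 + 3/2 * r n) / (1 - r n)" for n
  have \<nu>: "\<nu> n > 0" for n using r[of n] by (simp add: \<nu>_def)
  have ratio: "ratio (of_real (\<nu> n)) = cnj \<gamma> * of_real (r n)" for n
  proof -
    have "(\<nu> n - 1/2) / (\<nu> n + 3/2) = r n"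
      using r[of n] by (simp add: \<nu>_def field_simps)
    then have "complex_of_real ((\<nu> n - 1/2) / (\<nu> n + 3/2)) = of_real (r n)" by simp
    then show ?thesis unfolding ratio_def times_divide_eq_right[symmetric] by simp
  qed
  show "(\<lambda>n. cnj \<gamma> * of_real (r n)) \<longlonglongrightarrow> 0"
  proof -
    have "r \<longlonglongrightarrow> 0"
      unfolding r_def using LIMSEQ_Suc[OF LIMSEQ_inverse_real_of_nat] by simp
    then have "(\<lambda>n. cnj \<gamma> * of_real (r n)) \<longlonglongrightarrow> cnj \<gamma> * of_real 0"
      by (intro tendsto_intros)
    then show ?thesis by simp
  qed
  fix n
  show "cnj \<gamma> * of_real (r n) \<noteq> 0" using \<gamma>_nonzero r[of n] by simp
  show "cmod (cnj \<gamma> * of_real (r n)) < 1" using norm_\<gamma> r[of n] by (simp add: norm_mult)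
  let ?c = "complex_of_real (sqrt 2) / (of_real (\<nu> n) + 3/2)"
  have "of_real (\<nu> n) + 3/2 \<noteq> (0::complex)"
    by (rule power_vec_denominator) (use \<nu>[of n] in simp)
  then have c: "?c \<noteq> 0" by simp
  have "inverse ?c *\<^sub>C power_vec (of_real (\<nu> n)) \<in> X"
    by (intro complex_h2.subspace_scale[OF X] pv) (use \<nu>[of n] in simp)
  then show "geometric_h2 (cnj \<gamma> * of_real (r n)) \<in> X"
    using c by (simp add: power_vec_def ratio)
qed

lemma powr_eq_exp: "0 < t \<Longrightarrow> complex_of_real t powr a = exp (a * of_real (ln t))"
  by (simp add: powr_def Ln_of_real)

lemma power_eq_exp: "0 < t \<Longrightarrow> complex_of_real t ^ i = exp (of_nat i * of_real (ln t))"
  unfolding exp_of_nat_mult exp_of_real by simp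

lemma cinner_power_vec_of_nat:
  "cinner_h2 (power_vec (of_nat i)) (power_vec (of_nat j))
    = inner01 (\<lambda>t. of_real t ^ i) (\<lambda>t. of_real t ^ j)"
proof -
  have "((\<lambda>t. complex_of_real t ^ i * cnj (of_real t ^ j)) has_integral 1 / (of_nat i + of_nat j + 1)) {0..1}"
    by (rule has_integral_complex_power) (simp_all add: powr_add powr_nat)
  then show ?thesis
    by (simp add: inner01_def integral_unique cinner_power_vec)
qed

lemma cinner_power_vec_of_nat_power:
  assumes "Re a > 0"
  shows "cinner_h2 (power_vec (of_nat i)) (power_vec a) = inner01 (\<lambda>t. of_real t ^ i) (power_function a)"
proof -
  have "((\<lambda>t. complex_of_real t ^ i * cnj (power_function a t)) has_integral 1 / (of_nat i + cnj a + 1)) {0..1}"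
    by (rule has_integral_complex_power)
      (use assms in \<open>simp_all add: power_function_def powr_eq_exp power_eq_exp distrib_right exp_add exp_cnj\<close>)
  then show ?thesis
    using assms by (simp add: inner01_def integral_unique cinner_power_vec)
qed

lemma cinner_power_vec_self:
  assumes "Re a > 0"
  shows "cinner_h2 (power_vec a) (power_vec a) = inner01 (power_function a) (power_function a)"
proof -
  have "((\<lambda>t. power_function a t * cnj (power_function a t)) has_integral 1 / (a + cnj a + 1)) {0..1}"
    by (rule has_integral_complex_power)
      (use assms in \<open>simp_all add: power_function_def powr_eq_exp distrib_right exp_add exp_cnj\<close>)
  then show ?thesis
    using assms by (simp add: inner01_def integral_unique cinner_power_vec)
qed

definition poly_vec :: "complex poly \<Rightarrow> h2"
  where "poly_vec p = (\<Sum>i\<le>degree p. coeff p i *\<^sub>C power_vec (of_nat i))"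

lemma poly_vec_eq:
  assumes "degree p \<le> N"
  shows "poly_vec p = (\<Sum>i\<le>N. coeff p i *\<^sub>C power_vec (of_nat i))"
  unfolding poly_vec_def
  by (rule sum.mono_neutral_left) (use assms in \<open>auto simp: coeff_eq_0\<close>)

lemma poly_vec_add: "poly_vec (p + q) = poly_vec p + poly_vec q"
proof -
  let ?N = "max (degree p) (degree q)"
  have "degree (p + q) \<le> ?N" by (rule degree_add_le_max)
  then show ?thesis
    using poly_vec_eq[of p ?N] poly_vec_eq[of q ?N] poly_vec_eq[of "p + q" ?N]
    by (simp add: complex_h2.scale_left_distrib sum.distrib)
qed

lemma poly_vec_smult: "poly_vec (Polynomial.smult c p) = c *\<^sub>C poly_vec p"
  using poly_vec_eq[of "Polynomial.smult c p" "degree p"] degree_smult_le[of c p]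
  by (simp add: poly_vec_def complex_h2.scale_sum_right)

lemma poly_vec_diff: "poly_vec (p - q) = poly_vec p - poly_vec q"
  using poly_vec_add[of "p - q" q] by (simp add: algebra_simps)

lemma cinner_poly_vec_left:
  assumes g: "continuous01 g"
    and x: "\<And>i. cinner_h2 (power_vec (of_nat i)) x = inner01 (\<lambda>t. of_real t ^ i) g"
  shows "cinner_h2 (poly_vec p) x = inner01 (\<lambda>t. poly p (of_real t)) g"
proof -
  have "inner01 (\<lambda>t. poly p (of_real t)) g
      = integral {0..1} (\<lambda>t. \<Sum>i\<le>degree p. coeff p i * (of_real t ^ i * cnj (g t)))"
    unfolding inner01_def by (simp add: poly_altdef sum_distrib_right mult.assoc)
  also have "\<dots> = (\<Sum>i\<le>degree p. integral {0..1} (\<lambda>t. coeff p i * (of_real t ^ i * cnj (g t))))"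
    by (intro integral_sum integrable_on_mult_right integrable01 continuous01_monomial g) simp
  also have "\<dots> = (\<Sum>i\<le>degree p. coeff p i * inner01 (\<lambda>t. of_real t ^ i) g)"
    unfolding inner01_def by simp
  finally show ?thesis
    by (simp add: poly_vec_def cinner_h2.sum_left cinner_h2_scaleC_left x)
qed

lemma cinner_poly_vec:
  "cinner_h2 (poly_vec p) (poly_vec q) = inner01 (\<lambda>t. poly p (of_real t)) (\<lambda>t. poly q (of_real t))"
proof (rule cinner_poly_vec_left[OF continuous01_poly])
  fix i
  have "cinner_h2 (poly_vec q) (power_vec (of_nat i)) = inner01 (\<lambda>t. poly q (of_real t)) (\<lambda>t. of_real t ^ i)"
    by (rule cinner_poly_vec_left[OF continuous01_monomial cinner_power_vec_of_nat])
  then show "cinner_h2 (power_vec (of_nat i)) (poly_vec q) = inner01 (\<lambda>t. of_real t ^ i) (\<lambda>t. poly q (of_real t))"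
    by (metis cinner_h2_commute inner01_cnj)
qed

lemma norm_poly_vec_le:
  assumes "\<And>t. t \<in> {0..1} \<Longrightarrow> cmod (poly p (of_real t)) \<le> B" "B \<ge> 0"
  shows "norm (poly_vec p) \<le> B"
proof (rule power2_le_imp_le)
  have "complex_of_real ((norm (poly_vec p))\<^sup>2) = inner01 (\<lambda>t. poly p (of_real t)) (\<lambda>t. poly p (of_real t))"
    unfolding cinner_poly_vec[symmetric] cinner_h2_self_norm ..
  also have "cmod \<dots> \<le> B * B"
    by (rule inner01_bound[OF continuous01_poly continuous01_poly]) (use assms in auto)
  finally show "(norm (poly_vec p))\<^sup>2 \<le> B\<^sup>2"
    by (simp add: power2_eq_square norm_mult)
qed fact

text \<open>The isometry from the continuous functions with the inner product \<^const>\<open>inner01\<close> to the Hardy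
  space that maps powers to the vectors \<^const>\<open>power_vec\<close>.  Bernstein polynomials are an explicit
  approximation that depends linearly on the function, so the limit is linear by construction.\<close>

definition fun_vec :: "(real \<Rightarrow> complex) \<Rightarrow> h2"
  where "fun_vec q = lim (\<lambda>n. poly_vec (bernstein_poly n q))"

lemma fun_vec_tendsto:
  assumes q: "continuous01 q"
  shows "(\<lambda>n. poly_vec (bernstein_poly n q)) \<longlonglongrightarrow> fun_vec q"
proof -
  have "Cauchy (\<lambda>n. poly_vec (bernstein_poly n q))"
  proof (rule CauchyI)
    fix e :: real assume "e > 0"
    then have "e/4 > 0" by simp
    then obtain N where N: "\<And>n t. n \<ge> N \<Longrightarrow> t \<in> {0..1} \<Longrightarrow>
        cmod (poly (bernstein_poly n q) (of_real t) - q t) < e/4"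
      using bernstein_approximation[OF q] by meson
    have "norm (poly_vec (bernstein_poly m q) - poly_vec (bernstein_poly n q)) < e"
      if "m \<ge> N" "n \<ge> N" for m n
    proof -
      have "norm (poly_vec (bernstein_poly m q - bernstein_poly n q)) \<le> e/2"
      proof (rule norm_poly_vec_le)
        fix t :: real assume t: "t \<in> {0..1}"
        have "poly (bernstein_poly m q - bernstein_poly n q) (of_real t)
            = (poly (bernstein_poly m q) (of_real t) - q t) - (poly (bernstein_poly n q) (of_real t) - q t)"
          by simp
        also have "cmod \<dots> \<le> cmod (poly (bernstein_poly m q) (of_real t) - q t)
            + cmod (poly (bernstein_poly n q) (of_real t) - q t)"
          by (rule norm_triangle_ineq4)
        also have "\<dots> \<le> e/2" using N[OF that(1) t] N[OF that(2) t] by simp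
        finally show "cmod (poly (bernstein_poly m q - bernstein_poly n q) (of_real t)) \<le> e/2" .
      qed (use \<open>e > 0\<close> in simp)
      then show ?thesis using \<open>e > 0\<close> by (simp add: poly_vec_diff)
    qed
    then show "\<exists>M. \<forall>m\<ge>M. \<forall>n\<ge>M. norm (poly_vec (bernstein_poly m q) - poly_vec (bernstein_poly n q)) < e"
      by blast
  qed
  then show ?thesis
    unfolding fun_vec_def by (simp add: Cauchy_convergent_iff convergent_LIMSEQ_iff)
qed

lemma fun_vec_cong:
  "(\<And>t. t \<in> {0..1} \<Longrightarrow> q t = r t) \<Longrightarrow> fun_vec q = fun_vec r"
  unfolding fun_vec_def using bernstein_poly_cong[of q r] by simp

lemma fun_vec_add:
  assumes "continuous01 q" "continuous01 r"
  shows "fun_vec (\<lambda>t. q t + r t) = fun_vec q + fun_vec r"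
proof (rule LIMSEQ_unique)
  show "(\<lambda>n. poly_vec (bernstein_poly n (\<lambda>t. q t + r t))) \<longlonglongrightarrow> fun_vec (\<lambda>t. q t + r t)"
    by (intro fun_vec_tendsto continuous_intros assms)
  show "(\<lambda>n. poly_vec (bernstein_poly n (\<lambda>t. q t + r t))) \<longlonglongrightarrow> fun_vec q + fun_vec r"
    unfolding bernstein_poly_add poly_vec_add by (intro tendsto_add fun_vec_tendsto assms)
qed

lemma fun_vec_cmult:
  assumes "continuous01 q"
  shows "fun_vec (\<lambda>t. c * q t) = c *\<^sub>C fun_vec q"
proof (rule LIMSEQ_unique)
  show "(\<lambda>n. poly_vec (bernstein_poly n (\<lambda>t. c * q t))) \<longlonglongrightarrow> fun_vec (\<lambda>t. c * q t)"
    by (intro fun_vec_tendsto continuous_intros assms)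
  show "(\<lambda>n. poly_vec (bernstein_poly n (\<lambda>t. c * q t))) \<longlonglongrightarrow> c *\<^sub>C fun_vec q"
    unfolding bernstein_poly_cmult poly_vec_smult by (intro tendsto_scaleC_h2 fun_vec_tendsto assms)
qed

lemma fun_vec_diff:
  assumes "continuous01 q" "continuous01 r"
  shows "fun_vec (\<lambda>t. q t - r t) = fun_vec q - fun_vec r"
proof -
  have "continuous01 (\<lambda>t. q t - r t)" by (intro continuous_intros assms)
  from fun_vec_add[OF this assms(2)] show ?thesis by (simp add: algebra_simps)
qed

lemma cinner_fun_vec:
  assumes q: "continuous01 q" and r: "continuous01 r"
  shows "cinner_h2 (fun_vec q) (fun_vec r) = inner01 q r"
proof -
  have p: "cinner_h2 (poly_vec p) (fun_vec r) = inner01 (\<lambda>t. poly p (of_real t)) r" for p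
  proof (rule LIMSEQ_unique)
    show "(\<lambda>n. cinner_h2 (poly_vec p) (poly_vec (bernstein_poly n r))) \<longlonglongrightarrow> cinner_h2 (poly_vec p) (fun_vec r)"
      by (intro cinner_h2.tendsto tendsto_const fun_vec_tendsto r)
    have "(\<lambda>n. cnj (inner01 (\<lambda>t. poly (bernstein_poly n r) (of_real t)) (\<lambda>t. poly p (of_real t))))
        \<longlonglongrightarrow> cnj (inner01 r (\<lambda>t. poly p (of_real t)))"
      by (intro tendsto_cnj inner01_bernstein_tendsto r continuous01_poly)
    then show "(\<lambda>n. cinner_h2 (poly_vec p) (poly_vec (bernstein_poly n r))) \<longlonglongrightarrow> inner01 (\<lambda>t. poly p (of_real t)) r"
      by (simp add: cinner_poly_vec inner01_cnj[symmetric])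
  qed
  show ?thesis
  proof (rule LIMSEQ_unique)
    show "(\<lambda>n. cinner_h2 (poly_vec (bernstein_poly n q)) (fun_vec r)) \<longlonglongrightarrow> cinner_h2 (fun_vec q) (fun_vec r)"
      by (intro cinner_h2.tendsto tendsto_const fun_vec_tendsto q)
    show "(\<lambda>n. cinner_h2 (poly_vec (bernstein_poly n q)) (fun_vec r)) \<longlonglongrightarrow> inner01 q r"
      unfolding p by (rule inner01_bernstein_tendsto[OF q r])
  qed
qed

text \<open>The inner products of the two vectors with each other and with themselves all agree, hence
  their difference has norm \<open>0\<close>.  This covers exponents \<open>a\<close> that are not natural numbers, although
  \<^const>\<open>fun_vec\<close> is built from the natural powers only.\<close>

lemma fun_vec_power_function:
  assumes a: "Re a > 0"
  shows "fun_vec (power_function a) = power_vec a"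
proof -
  let ?u = "power_function a"
  note c = continuous01_power_function[OF a]
  have "cinner_h2 (fun_vec ?u) (power_vec a) = inner01 ?u ?u"
  proof (rule LIMSEQ_unique)
    show "(\<lambda>n. cinner_h2 (poly_vec (bernstein_poly n ?u)) (power_vec a)) \<longlonglongrightarrow> cinner_h2 (fun_vec ?u) (power_vec a)"
      by (intro cinner_h2.tendsto tendsto_const fun_vec_tendsto c)
    show "(\<lambda>n. cinner_h2 (poly_vec (bernstein_poly n ?u)) (power_vec a)) \<longlonglongrightarrow> inner01 ?u ?u"
      unfolding cinner_poly_vec_left[OF c cinner_power_vec_of_nat_power[OF a]]
      by (rule inner01_bernstein_tendsto[OF c c])
  qed
  moreover from this have "cinner_h2 (power_vec a) (fun_vec ?u) = inner01 ?u ?u"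
    by (metis cinner_h2_commute inner01_cnj)
  ultimately have "cinner_h2 (fun_vec ?u - power_vec a) (fun_vec ?u - power_vec a) = 0"
    by (simp add: cinner_h2_simps cinner_fun_vec[OF c c] cinner_power_vec_self[OF a])
  then show ?thesis by (simp add: cinner_h2_self_norm)
qed

lemma subspace_range_fun_vec: "complex_h2.subspace (fun_vec ` {q. continuous01 q})"
proof (rule complex_h2.subspaceI)
  have "fun_vec (\<lambda>t. 0 * 0) = 0" by (subst fun_vec_cmult) (auto intro: continuous_intros)
  then have "fun_vec (\<lambda>t. 0) = 0" by simp
  then show "0 \<in> fun_vec ` {q. continuous01 q}"
    by (metis (mono_tags) continuous_on_const image_eqI mem_Collect_eq)
next
  fix x y assume "x \<in> fun_vec ` {q. continuous01 q}" "y \<in> fun_vec ` {q. continuous01 q}"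
  then obtain q r where "continuous01 q" "x = fun_vec q" "continuous01 r" "y = fun_vec r" by blast
  then show "x + y \<in> fun_vec ` {q. continuous01 q}"
    using fun_vec_add[of q r] continuous_on_add[of "{0..1}" q r] by (auto intro!: image_eqI[of _ _ "\<lambda>t. q t + r t"])
next
  fix c x assume "x \<in> fun_vec ` {q. continuous01 q}"
  then obtain q where "continuous01 q" "x = fun_vec q" by blast
  then show "c *\<^sub>C x \<in> fun_vec ` {q. continuous01 q}"
    using fun_vec_cmult[of q c] continuous_on_mult_left[of "{0..1}" q c]
    by (auto intro!: image_eqI[of _ _ "\<lambda>t. c * q t"])
qed

lemma dense_range_fun_vec: "closure (fun_vec ` {q. continuous01 q}) = UNIV"
proof (rule dense_power_vec[OF subspace_range_fun_vec])
  show "power_vec \<nu> \<in> fun_vec ` {q. continuous01 q}" if "Re \<nu> > 0" for \<nu>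
    using fun_vec_power_function[OF that] continuous01_power_function[OF that]
    by (metis image_eqI mem_Collect_eq)
qed

lemma fun_vec_induct:
  assumes closed: "closed {x. P x}" and P: "\<And>q. continuous01 q \<Longrightarrow> P (fun_vec q)"
  shows "P x"
proof -
  have "closure (fun_vec ` {q. continuous01 q}) \<subseteq> {x. P x}"
    by (rule closure_minimal[OF _ closed]) (use P in auto)
  then show ?thesis using dense_range_fun_vec by auto
qed

lemma power_vec_induct:
  assumes sub: "complex_h2.subspace {x. P x}" and closed: "closed {x. P x}"
    and P: "\<And>\<nu>. Re \<nu> > 0 \<Longrightarrow> P (power_vec \<nu>)"
  shows "P x"
  using dense_power_vec[OF sub] P closed by auto

lemma integral_of_real01:
  assumes "continuous_on {0..1} g"
  shows "integral {0..1} (\<lambda>t. complex_of_real (g t)) = of_real (integral {0..1::real} g)"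
proof -
  have "(g has_integral integral {0..1} g) {0..1}"
    by (intro integrable_integral integrable_continuous_real assms)
  then have "((\<lambda>t. complex_of_real (g t)) has_integral of_real (integral {0..1} g)) {0..1}"
    by (rule has_integral_of_real)
  then show ?thesis by (rule integral_unique)
qed

lemma norm_fun_vec_square:
  assumes "continuous01 q"
  shows "(norm (fun_vec q))\<^sup>2 = integral {0..1} (\<lambda>t. (cmod (q t))\<^sup>2)"
proof -
  have "complex_of_real ((norm (fun_vec q))\<^sup>2) = inner01 q q"
    unfolding cinner_h2_self_norm[symmetric] by (rule cinner_fun_vec[OF assms assms])
  also have "\<dots> = of_real (integral {0..1} (\<lambda>t. (cmod (q t))\<^sup>2))"
    unfolding inner01_self by (rule integral_of_real01) (intro continuous_intros assms)
  finally show ?thesis by (simp only: of_real_eq_iff)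
qed

lemma norm_fun_vec_le:
  assumes p: "continuous01 p" and q: "continuous01 q"
    and M: "\<And>t. t \<in> {0..1} \<Longrightarrow> cmod (p t) \<le> M * cmod (q t)" "M \<ge> 0"
  shows "norm (fun_vec p) \<le> M * norm (fun_vec q)"
proof (rule power2_le_imp_le)
  have "(norm (fun_vec p))\<^sup>2 \<le> integral {0..1} (\<lambda>t. (M * cmod (q t))\<^sup>2)"
    unfolding norm_fun_vec_square[OF p]
    by (intro integral_le integrable_continuous_real continuous_intros p q power_mono M) auto
  also have "\<dots> = (M * norm (fun_vec q))\<^sup>2"
    by (simp add: power_mult_distrib norm_fun_vec_square[OF q])
  finally show "(norm (fun_vec p))\<^sup>2 \<le> (M * norm (fun_vec q))\<^sup>2" .
qed (use M in simp)

section \<open>Multiplication operators\<close>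

text \<open>Multiplication by \<open>f\<close>, transported by \<^const>\<open>fun_vec\<close>.  The prescribed values lie on a dense
  subspace only; they are consistent and bounded because \<^const>\<open>fun_vec\<close> is isometric.\<close>

definition mult_op :: "(real \<Rightarrow> complex) \<Rightarrow> (h2 \<Rightarrow>\<^sub>L h2)"
  where "mult_op f = (THE T. T \<in> bounded_operators \<and>
    (\<forall>q. continuous01 q \<longrightarrow> blinfun_apply T (fun_vec q) = fun_vec (\<lambda>t. f t * q t)))"

lemma mult_op_exists:
  assumes f: "continuous01 f" and M: "\<And>t. t \<in> {0..1} \<Longrightarrow> cmod (f t) \<le> M" "M \<ge> 0"
  shows "\<exists>T\<in>bounded_operators. norm T \<le> M \<and>
    (\<forall>q. continuous01 q \<longrightarrow> blinfun_apply T (fun_vec q) = fun_vec (\<lambda>t. f t * q t))"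
proof -
  let ?X = "fun_vec ` {q. continuous01 q}"
  have bound: "norm (fun_vec (\<lambda>t. f t * q t)) \<le> M * norm (fun_vec q)" if q: "continuous01 q" for q
    by (rule norm_fun_vec_le) (use M in \<open>auto simp: norm_mult intro!: continuous_intros mult_right_mono f q\<close>)
  define g where "g x = fun_vec (\<lambda>t. f t * (SOME q. continuous01 q \<and> fun_vec q = x) t)" for x
  have g: "g (fun_vec q) = fun_vec (\<lambda>t. f t * q t)" if q: "continuous01 q" for q
  proof -
    define r where "r = (SOME r. continuous01 r \<and> fun_vec r = fun_vec q)"
    have r: "continuous01 r" "fun_vec r = fun_vec q"
      unfolding r_def using someI[of "\<lambda>r. continuous01 r \<and> fun_vec r = fun_vec q" q] q by auto
    have d: "continuous01 (\<lambda>t. r t - q t)" by (intro continuous_intros r q)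
    have "norm (fun_vec (\<lambda>t. f t * (r t - q t))) \<le> M * norm (fun_vec (\<lambda>t. r t - q t))"
      by (rule bound[OF d])
    also have "fun_vec (\<lambda>t. r t - q t) = 0" by (simp add: fun_vec_diff r q)
    finally have "fun_vec (\<lambda>t. f t * r t - f t * q t) = 0"
      by (simp add: right_diff_distrib)
    then have "fun_vec (\<lambda>t. f t * r t) = fun_vec (\<lambda>t. f t * q t)"
      using fun_vec_diff[of "\<lambda>t. f t * r t" "\<lambda>t. f t * q t"] f r(1) q
      by (simp add: continuous_on_mult)
    then show ?thesis by (simp add: g_def r_def)
  qed
  have "\<exists>T\<in>bounded_operators. norm T \<le> M \<and> (\<forall>x\<in>?X. blinfun_apply T x = g x)"
  proof (rule bounded_operator_extension[OF subspace_range_fun_vec dense_range_fun_vec])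
    fix x y assume "x \<in> ?X" "y \<in> ?X"
    then obtain q r where q: "continuous01 q" "x = fun_vec q" and r: "continuous01 r" "y = fun_vec r" by blast
    have "g (x + y) = fun_vec (\<lambda>t. f t * (q t + r t))"
      unfolding q r fun_vec_add[OF q(1) r(1), symmetric] by (intro g continuous_intros q r)
    also have "\<dots> = fun_vec (\<lambda>t. f t * q t) + fun_vec (\<lambda>t. f t * r t)"
      unfolding distrib_left by (intro fun_vec_add continuous_intros f q r)
    finally show "g (x + y) = g x + g y" by (simp add: q r g)
  next
    fix c x assume "x \<in> ?X"
    then obtain q where q: "continuous01 q" "x = fun_vec q" by blast
    have "g (c *\<^sub>C x) = fun_vec (\<lambda>t. f t * (c * q t))"
      unfolding q fun_vec_cmult[OF q(1), symmetric] by (intro g continuous_intros q)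
    also have "\<dots> = fun_vec (\<lambda>t. c * (f t * q t))" by (simp add: mult_ac)
    also have "\<dots> = c *\<^sub>C fun_vec (\<lambda>t. f t * q t)" by (intro fun_vec_cmult continuous_intros f q)
    finally show "g (c *\<^sub>C x) = c *\<^sub>C g x" by (simp add: q g)
  next
    fix x assume "x \<in> ?X"
    then obtain q where q: "continuous01 q" "x = fun_vec q" by blast
    show "norm (g x) \<le> M * norm x"
      unfolding q g[OF q(1)] by (rule bound[OF q(1)])
  qed (rule M)
  then show ?thesis using g by auto
qed

lemma operator_eqI:
  assumes "\<And>q. continuous01 q \<Longrightarrow> blinfun_apply S (fun_vec q) = blinfun_apply T (fun_vec q)"
  shows "S = (T :: h2 \<Rightarrow>\<^sub>L h2)"
proof (rule blinfun_eqI)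
  show "S x = T x" for x
    by (rule fun_vec_induct[where x = x])
      (use assms in \<open>auto intro!: closed_Collect_eq continuous_intros\<close>)
qed

lemma mult_op:
  assumes f: "continuous01 f"
  shows mult_op_bounded: "mult_op f \<in> bounded_operators"
    and mult_op_apply: "continuous01 q \<Longrightarrow> mult_op f (fun_vec q) = fun_vec (\<lambda>t. f t * q t)"
    and norm_mult_op_le: "(\<And>t. t \<in> {0..1} \<Longrightarrow> cmod (f t) \<le> M) \<Longrightarrow> M \<ge> 0 \<Longrightarrow> norm (mult_op f) \<le> M"
proof -
  let ?P = "\<lambda>T. T \<in> bounded_operators \<and>
    (\<forall>q. continuous01 q \<longrightarrow> blinfun_apply T (fun_vec q) = fun_vec (\<lambda>t. f t * q t))"
  have eq: "mult_op f = T" if "?P T" for T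
    unfolding mult_op_def
  proof (rule the_equality[of ?P, OF that])
    show "S = T" if "?P S" for S using that \<open>?P T\<close> by (intro operator_eqI) simp
  qed
  obtain M where M: "M > 0" "\<And>t. t \<in> {0..1} \<Longrightarrow> cmod (f t) \<le> M"
    using continuous01_bounded[OF f] by blast
  obtain T where "?P T" using mult_op_exists[OF f M(2)] M(1) by (metis less_imp_le)
  then have P: "?P (mult_op f)" using eq by blast
  then show "mult_op f \<in> bounded_operators"
    and "continuous01 q \<Longrightarrow> mult_op f (fun_vec q) = fun_vec (\<lambda>t. f t * q t)" by blast+
  show "norm (mult_op f) \<le> M" if "\<And>t. t \<in> {0..1} \<Longrightarrow> cmod (f t) \<le> M" "M \<ge> 0" for M
    using mult_op_exists[OF f that] eq by blast
qed

lemma mult_op_cong: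
  assumes "\<And>t. t \<in> {0..1} \<Longrightarrow> f t = g t"
  shows "mult_op f = mult_op g"
proof -
  have "fun_vec (\<lambda>t. f t * q t) = fun_vec (\<lambda>t. g t * q t)" for q
    by (rule fun_vec_cong) (use assms in simp)
  then show ?thesis by (simp add: mult_op_def)
qed

lemma mult_op_add:
  assumes f: "continuous01 f" and g: "continuous01 g"
  shows "mult_op (\<lambda>t. f t + g t) = mult_op f + mult_op g"
proof (rule operator_eqI)
  fix q assume q: "continuous01 q"
  have "continuous01 (\<lambda>t. f t + g t)" by (intro continuous_intros f g)
  then have "mult_op (\<lambda>t. f t + g t) (fun_vec q) = fun_vec (\<lambda>t. f t * q t + g t * q t)"
    by (simp add: mult_op_apply q distrib_right)
  also have "\<dots> = fun_vec (\<lambda>t. f t * q t) + fun_vec (\<lambda>t. g t * q t)"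
    by (intro fun_vec_add continuous_intros f g q)
  finally show "mult_op (\<lambda>t. f t + g t) (fun_vec q) = (mult_op f + mult_op g) (fun_vec q)"
    by (simp add: plus_blinfun.rep_eq mult_op_apply f g q)
qed

lemma mult_op_mult:
  assumes f: "continuous01 f" and g: "continuous01 g"
  shows "mult_op (\<lambda>t. f t * g t) = mult_op f o\<^sub>L mult_op g"
proof (rule operator_eqI)
  fix q assume q: "continuous01 q"
  have "continuous01 (\<lambda>t. f t * g t)" "continuous01 (\<lambda>t. g t * q t)" by (intro continuous_intros f g q)+
  then show "mult_op (\<lambda>t. f t * g t) (fun_vec q) = (mult_op f o\<^sub>L mult_op g) (fun_vec q)"
    by (simp add: mult_op_apply f g q mult.assoc)
qed

lemma mult_op_cmult:
  assumes f: "continuous01 f"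
  shows "mult_op (\<lambda>t. c * f t) = op_scaleC c (mult_op f)"
proof (rule operator_eqI)
  fix q assume q: "continuous01 q"
  have "continuous01 (\<lambda>t. c * f t)" by (intro continuous_intros f)
  then have "mult_op (\<lambda>t. c * f t) (fun_vec q) = fun_vec (\<lambda>t. c * (f t * q t))"
    by (simp add: mult_op_apply q mult.assoc)
  also have "\<dots> = c *\<^sub>C fun_vec (\<lambda>t. f t * q t)"
    by (intro fun_vec_cmult continuous_intros f q)
  finally show "mult_op (\<lambda>t. c * f t) (fun_vec q) = op_scaleC c (mult_op f) (fun_vec q)"
    by (simp add: op_scaleC_apply mult_op_apply f q)
qed

lemma mult_op_diff:
  assumes f: "continuous01 f" and g: "continuous01 g"
  shows "mult_op (\<lambda>t. f t - g t) = mult_op f - mult_op g"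
proof -
  have "continuous01 (\<lambda>t. f t - g t)" by (intro continuous_intros f g)
  from mult_op_add[OF this g] show ?thesis by (simp add: algebra_simps)
qed

lemma mult_op_1: "mult_op (\<lambda>t. 1) = id_blinfun"
  by (rule operator_eqI) (simp add: mult_op_apply)

lemma op_adjoint_mult_op:
  assumes f: "continuous01 f"
  shows "op_adjoint (mult_op f) = mult_op (\<lambda>t. cnj (f t))"
proof (rule op_adjoint_eqI)
  have fc: "continuous01 (\<lambda>t. cnj (f t))" by (intro continuous_intros f)
  have qr: "cinner_h2 (mult_op f (fun_vec q)) (fun_vec r)
      = cinner_h2 (fun_vec q) (mult_op (\<lambda>t. cnj (f t)) (fun_vec r))"
    if q: "continuous01 q" and r: "continuous01 r" for q r
  proof -
    have "continuous01 (\<lambda>t. f t * q t)" "continuous01 (\<lambda>t. cnj (f t) * r t)"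
      by (intro continuous_intros f q r)+
    then show ?thesis
      by (simp add: mult_op_apply f fc q r cinner_fun_vec) (simp add: inner01_def mult_ac)
  qed
  have xr: "cinner_h2 (mult_op f x) (fun_vec r) = cinner_h2 x (mult_op (\<lambda>t. cnj (f t)) (fun_vec r))"
    if r: "continuous01 r" for x r
    by (rule fun_vec_induct[where x = x])
      (use qr r in \<open>auto intro!: closed_Collect_eq continuous_intros cinner_h2.continuous_on\<close>)
  show "cinner_h2 (mult_op f x) y = cinner_h2 x (mult_op (\<lambda>t. cnj (f t)) y)" for x y
    by (rule fun_vec_induct[where x = y])
      (use xr in \<open>auto intro!: closed_Collect_eq continuous_intros cinner_h2.continuous_on\<close>)
qed

end

context boundary_point
begin

section \<open>Parabolic composition operators\<close>

text \<open>Adding \<open>a\<close> to the exponent replaces \<open>1 / (w + \<nu> + 1/2)\<close> by its translate, so multiplication by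
  \<open>t\<^sup>a\<close> is the translation \<open>F(w) \<mapsto> F(w + a)\<close> of the half-plane picture.\<close>

lemma mult_op_power_vec:
  assumes "Re a > 0" "Re \<nu> > 0"
  shows "mult_op (power_function a) (power_vec \<nu>) = power_vec (\<nu> + a)"
proof -
  have "mult_op (power_function a) (power_vec \<nu>) = fun_vec (\<lambda>t. power_function a t * power_function \<nu> t)"
    unfolding fun_vec_power_function[OF assms(2), symmetric]
    by (intro mult_op_apply continuous01_power_function assms)
  also have "\<dots> = fun_vec (power_function (\<nu> + a))"
    by (rule fun_vec_cong) (simp add: power_function_def powr_add)
  also have "\<dots> = power_vec (\<nu> + a)"
    by (rule fun_vec_power_function) (use assms in simp)
  finally show ?thesis .
qed

text \<open>Multiplication by \<open>1 / (w + 1)\<close> with \<open>w = cayley \<gamma> z\<close>, a polynomial in the shift.\<close>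

definition cayley_resolvent :: "h2 \<Rightarrow>\<^sub>L h2"
  where "cayley_resolvent = op_scaleC (1/2) (id_blinfun - op_scaleC (cnj \<gamma>) shift)"

lemma cayley_resolvent_bounded: "cayley_resolvent \<in> bounded_operators"
  unfolding cayley_resolvent_def by (intro bounded_operators_intros bounded_operators_shift)

lemma cayley_resolvent_apply: "cayley_resolvent f = (1/2) *\<^sub>C (f - cnj \<gamma> *\<^sub>C shift f)"
  by (simp add: cayley_resolvent_def op_scaleC_apply minus_blinfun.rep_eq)

lemma Rep_h2_diff: "Rep_h2 (f - g) z = Rep_h2 f z - Rep_h2 g z"
proof -
  have "Rep_h2 f z = Rep_h2 (f - g) z + Rep_h2 g z"
    using Rep_h2_plus[of "f - g" g] by (simp add: fun_eq_iff)
  then show ?thesis by simp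
qed

lemma cayley_plus_1:
  assumes "z \<in> ball 0 1"
  shows "(1 - cnj \<gamma> * z) / 2 = 1 / (cayley \<gamma> z + 1)" "(1 + cnj \<gamma> * z) / 2 = cayley \<gamma> z / (cayley \<gamma> z + 1)"
proof -
  have gz: "\<gamma> - z \<noteq> 0" using assms norm_\<gamma> by auto
  have c: "cnj \<gamma> = 1 / \<gamma>" using \<gamma>_cnj \<gamma>_nonzero by (simp add: field_simps)
  have w: "cayley \<gamma> z + 1 = 2 * \<gamma> / (\<gamma> - z)"
    using gz by (simp add: cayley_def field_simps)
  show "(1 - cnj \<gamma> * z) / 2 = 1 / (cayley \<gamma> z + 1)"
    unfolding w c using gz \<gamma>_nonzero by (simp add: field_simps)
  show "(1 + cnj \<gamma> * z) / 2 = cayley \<gamma> z / (cayley \<gamma> z + 1)"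
    unfolding w c using gz \<gamma>_nonzero by (simp add: cayley_def field_simps)
qed

lemma cayley_add_nonzero:
  assumes "z \<in> ball 0 1" "Re b \<ge> 0"
  shows "cayley \<gamma> z + b \<noteq> 0"
proof
  assume "cayley \<gamma> z + b = 0"
  then have "Re (cayley \<gamma> z + b) = 0" by simp
  with Re_cayley_pos[OF norm_\<gamma> assms(1)] assms(2) show False by simp
qed

lemma Rep_cayley_resolvent:
  assumes "z \<in> ball 0 1"
  shows "Rep_h2 (cayley_resolvent f) z = Rep_h2 f z / (cayley \<gamma> z + 1)"
proof -
  have "Rep_h2 (cayley_resolvent f) z = (1 - cnj \<gamma> * z) / 2 * Rep_h2 f z"
    by (simp add: cayley_resolvent_apply scaleC_h2.rep_eq Rep_h2_diff Rep_h2_shift[OF assms] algebra_simps)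
  then show ?thesis unfolding cayley_plus_1[OF assms] by simp
qed

text \<open>Composing \<open>(w + 1) F(w)\<close> with \<open>w \<mapsto> w + a\<close> gives \<open>(w + 1 + a) F(w + a)\<close>, which is \<open>w + 1\<close> times
  \<open>(1 + a / (w + 1)) F(w + a)\<close>.  So this operator is the composition operator of the parabolic map; in
  particular that operator is bounded.\<close>

definition parabolic_op :: "complex \<Rightarrow> (h2 \<Rightarrow>\<^sub>L h2)"
  where "parabolic_op a = mult_op (power_function a) +
    op_scaleC a (cayley_resolvent o\<^sub>L mult_op (power_function a))"

lemma parabolic_op_bounded: "Re a > 0 \<Longrightarrow> parabolic_op a \<in> bounded_operators"
  unfolding parabolic_op_def
  by (intro bounded_operators_intros mult_op_bounded continuous01_power_function cayley_resolvent_bounded)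

lemma Rep_parabolic_op:
  assumes z: "z \<in> ball 0 1"
  shows "Rep_h2 (parabolic_op a f) z
    = (1 + a / (cayley \<gamma> z + 1)) * Rep_h2 (mult_op (power_function a) f) z"
  by (simp add: parabolic_op_def plus_blinfun.rep_eq op_scaleC_apply Rep_h2_plus scaleC_h2.rep_eq
      Rep_cayley_resolvent[OF z] algebra_simps)

lemma Rep_parabolic_op_compose:
  assumes a: "Re a > 0" and z: "z \<in> ball 0 1"
  shows "Rep_h2 (parabolic_op a f) z = Rep_h2 f (parabolic_map \<gamma> a z)"
proof (rule power_vec_induct[where x = f])
  have z': "parabolic_map \<gamma> a z \<in> ball 0 1"
    and cz': "cayley \<gamma> (parabolic_map \<gamma> a z) = cayley \<gamma> z + a"
    using parabolic_map_conjugate[OF norm_\<gamma> _ z, of a] a by simp_all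
  note lin = bounded_linear_compose[OF bounded_linear_Rep_h2[OF z] blinfun.bounded_linear_right[of "parabolic_op a"]]
    bounded_linear_Rep_h2[OF z']
  show "complex_h2.subspace {f. Rep_h2 (parabolic_op a f) z = Rep_h2 f (parabolic_map \<gamma> a z)}"
    by (rule complex_h2.subspaceI)
      (simp_all add: blinfun.zero_right blinfun.add_right bounded_operatorsD[OF parabolic_op_bounded[OF a]]
        zero_h2.rep_eq Rep_h2_plus scaleC_h2.rep_eq)
  show "closed {f. Rep_h2 (parabolic_op a f) z = Rep_h2 f (parabolic_map \<gamma> a z)}"
    by (intro closed_Collect_eq linear_continuous_on lin)
  fix \<nu> :: complex assume \<nu>: "Re \<nu> > 0"
  let ?w = "cayley \<gamma> z"
  have w1: "?w + 1 \<noteq> 0" by (rule cayley_add_nonzero[OF z]) simp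
  have "Rep_h2 (parabolic_op a (power_vec \<nu>)) z
      = (1 + a / (?w + 1)) * (of_real (sqrt 2) / 2 * ((?w + 1) / (?w + (\<nu> + a) + 1/2)))"
    unfolding Rep_parabolic_op[OF z] mult_op_power_vec[OF a \<nu>]
    by (subst Rep_power_vec) (use a \<nu> z in auto)
  also have "\<dots> = of_real (sqrt 2) / 2 * ((?w + a + 1) / (?w + a + \<nu> + 1/2))"
  proof -
    have "1 + a / (?w + 1) = (?w + a + 1) / (?w + 1)" using w1 by (simp add: field_simps)
    then show ?thesis using w1 by (simp add: add_ac)
  qed
  also have "\<dots> = Rep_h2 (power_vec \<nu>) (parabolic_map \<gamma> a z)"
    by (subst Rep_power_vec) (use \<nu> z' in \<open>auto simp: cz'\<close>)
  finally show "Rep_h2 (parabolic_op a (power_vec \<nu>)) z = Rep_h2 (power_vec \<nu>) (parabolic_map \<gamma> a z)" .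
qed

lemma composition_operator_parabolic:
  assumes a: "Re a > 0"
  shows "composition_operator (parabolic_map \<gamma> a) = parabolic_op a"
  unfolding composition_operator_def
proof (rule the_equality)
  fix T :: "h2 \<Rightarrow>\<^sub>L h2"
  assume T: "\<forall>f. \<forall>z\<in>ball 0 1. Rep_h2 (T f) z = Rep_h2 f (parabolic_map \<gamma> a z)"
  show "T = parabolic_op a"
  proof (rule blinfun_eqI)
    show "T f = parabolic_op a f" for f
      by (rule h2_eqI) (simp only: T Rep_parabolic_op_compose[OF a])
  qed
qed (simp add: Rep_parabolic_op_compose[OF a] del: mem_ball)

text \<open>Let \<open>Y\<close> be the image of the monomial \<open>z\<^sup>n\<close> under multiplication by \<open>t\<^sup>a\<close>, and let \<open>Q\<close> and \<open>P\<close> be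
  \<open>1 / (w + 1)\<close> and \<open>w / (w + 1)\<close> times \<open>Y\<close>.  The powers \<open>\<rho>\<^sup>n\<close> and \<open>\<rho>\<^sup>n\<^sup>+\<^sup>1\<close> of the parabolic map are
  \<open>P + a Q + Q\<close> and, up to the unimodular factor \<open>\<gamma>\<close>, \<open>P + a Q - Q\<close>.  As \<open>w\<close> is imaginary on the
  boundary, \<open>P\<close> and \<open>Q\<close> are orthogonal for the real inner product.  Hence \<open>4 Re a\<close> times the squared
  norm of \<open>Q\<close> is the decrease of the squared norm from \<open>\<rho>\<^sup>n\<close> to \<open>\<rho>\<^sup>n\<^sup>+\<^sup>1\<close>, and the sum over \<open>n\<close>
  telescopes.\<close>

lemma resolvent_power_Hilbert_Schmidt:
  assumes a: "Re a > 0"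
  shows "summable (\<lambda>n. (norm ((cayley_resolvent o\<^sub>L mult_op (power_function a)) (monomial_h2 n)))\<^sup>2)"
proof -
  define Y where "Y n = mult_op (power_function a) (monomial_h2 n)" for n
  define Z where "Z n = cnj \<gamma> *\<^sub>C shift (Y n)" for n
  define P where "P n = (1/2) *\<^sub>C (Y n + Z n)" for n
  define Q where "Q n = (1/2) *\<^sub>C (Y n - Z n)" for n
  define C where "C n = parabolic_op a (monomial_h2 n)" for n
  have Q: "cayley_resolvent (Y n) = Q n" for n
    by (simp add: cayley_resolvent_apply Q_def Z_def)
  have "Y n = P n + Q n" for n
    by (simp add: P_def Q_def complex_h2.scale_right_distrib[symmetric])
      (simp add: complex_h2.scale_left_distrib[symmetric] complex_h2.scale_right_distrib
        flip: mult_2 scaleR_2 add: scaleR_eq_scaleC)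
  moreover have "C n = Y n + a *\<^sub>C Q n" for n
    by (simp add: C_def parabolic_op_def plus_blinfun.rep_eq op_scaleC_apply Y_def[symmetric] Q)
  ultimately have C1: "C n = P n + a *\<^sub>C Q n + Q n" for n
    by (simp add: add_ac)
  have C2: "C (Suc n) = \<gamma> *\<^sub>C (P n + a *\<^sub>C Q n - Q n)" for n
  proof (rule h2_eqI)
    fix z :: complex assume z: "z \<in> ball 0 1"
    let ?w = "cayley \<gamma> z"
    define r where "r = parabolic_map \<gamma> a z"
    define y where "y = Rep_h2 (Y n) z"
    have r_ball: "r \<in> ball 0 1"
      using parabolic_map_conjugate[OF norm_\<gamma> _ z, of a] a by (simp add: r_def)
    have w1: "?w + 1 \<noteq> 0" by (rule cayley_add_nonzero[OF z]) simp
    have wa: "?w + a + 1 \<noteq> 0" using cayley_add_nonzero[OF z, of "a + 1"] a by (simp add: add.assoc)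
    have r: "r = \<gamma> * (?w + a - 1) / (?w + a + 1)"
      by (simp add: r_def parabolic_map_def cayley_inv_def)
    have Cz: "Rep_h2 (C k) z = r ^ k" for k
      unfolding C_def Rep_parabolic_op_compose[OF a z] r_def[symmetric] by (rule Rep_h2_monomial[OF r_ball])
    have "(1 + a / (?w + 1)) * y = r ^ n"
      using Cz[of n] unfolding C_def Rep_parabolic_op[OF z] y_def Y_def .
    then have y: "(?w + a + 1) * y = (?w + 1) * r ^ n"
      using w1 by (simp add: field_simps)
    have Pz: "Rep_h2 (P n) z = ?w / (?w + 1) * y"
    proof -
      have "Rep_h2 (P n) z = (1 + cnj \<gamma> * z) / 2 * y"
        by (simp add: P_def Z_def scaleC_h2.rep_eq Rep_h2_plus Rep_h2_shift[OF z] y_def algebra_simps)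
      then show ?thesis unfolding cayley_plus_1[OF z] .
    qed
    have Qz: "Rep_h2 (Q n) z = y / (?w + 1)"
      unfolding Q[symmetric] Rep_cayley_resolvent[OF z] y_def ..
    have "Rep_h2 (\<gamma> *\<^sub>C (P n + a *\<^sub>C Q n - Q n)) z = \<gamma> * ((?w + a - 1) / (?w + 1) * y)"
      by (simp add: scaleC_h2.rep_eq Rep_h2_plus Rep_h2_diff Pz Qz add_divide_distrib
          diff_divide_distrib ring_distribs mult_ac)
    also have "y = (?w + 1) * r ^ n / (?w + a + 1)"
      using y wa by (simp add: field_simps)
    also have "\<gamma> * ((?w + a - 1) / (?w + 1) * ((?w + 1) * r ^ n / (?w + a + 1))) = r * r ^ n"
      unfolding r using w1 by simp
    finally show "Rep_h2 (C (Suc n)) z = Rep_h2 (\<gamma> *\<^sub>C (P n + a *\<^sub>C Q n - Q n)) z"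
      by (simp add: Cz)
  qed
  have tele: "4 * Re a * (norm (Q n))\<^sup>2 = (norm (C n))\<^sup>2 - (norm (C (Suc n)))\<^sup>2" for n
  proof -
    (* The shift is isometric; this replaces integration over the unit circle. *)
    have "norm (Z n) = norm (Y n)" by (simp add: Z_def norm_scaleC_h2 norm_\<gamma> norm_shift)
    then have "inner (Y n + Z n) (Y n - Z n) = 0"
      by (simp add: inner_add_left inner_diff_right inner_commute[of "Z n" "Y n"]
          flip: power2_norm_eq_inner)
    then have PQ: "inner (P n) (Q n) = 0"
      by (simp add: P_def Q_def inner_h2_def cinner_h2_scaleC_left cinner_h2_scaleC_right)
    have QQ: "inner (a *\<^sub>C Q n) (Q n) = Re a * (norm (Q n))\<^sup>2"
      by (simp add: inner_h2_def cinner_h2_scaleC_left cinner_h2_self_norm del: of_real_power)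
    define u where "u = P n + a *\<^sub>C Q n"
    have "(norm (C n))\<^sup>2 - (norm (C (Suc n)))\<^sup>2 = (norm (u + Q n))\<^sup>2 - (norm (u - Q n))\<^sup>2"
      by (simp add: C1[of n] C2 norm_scaleC_h2 norm_\<gamma> u_def)
    also have "\<dots> = 4 * inner u (Q n)"
      unfolding power2_norm_eq_inner
      by (simp add: inner_add_left inner_add_right inner_diff_left inner_diff_right inner_commute)
    also have "\<dots> = 4 * Re a * (norm (Q n))\<^sup>2"
      by (simp add: u_def inner_add_left PQ QQ)
    finally show ?thesis by simp
  qed
  have "(\<Sum>n<N. 4 * Re a * (norm (Q n))\<^sup>2) \<le> (norm (C 0))\<^sup>2" for N
    unfolding tele using sum_lessThan_telescope'[of "\<lambda>n. (norm (C n))\<^sup>2" N] by simp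
  then have "summable (\<lambda>n. 4 * Re a * (norm (Q n))\<^sup>2)"
    by (intro summableI_nonneg_bounded[where x = "(norm (C 0))\<^sup>2"]) (use a in auto)
  then have "summable (\<lambda>n. (norm (Q n))\<^sup>2)"
    using a summable_cmult_iff[of "4 * Re a" "\<lambda>n. (norm (Q n))\<^sup>2"] by simp
  then show ?thesis by (simp add: Q[symmetric] Y_def)
qed

lemma parabolic_op_mod_compact:
  assumes a: "Re a > 0"
  shows "parabolic_op a - mult_op (power_function a) \<in> compact_operators"
proof -
  have "cayley_resolvent o\<^sub>L mult_op (power_function a) \<in> compact_operators"
    by (intro Hilbert_Schmidt_compact resolvent_power_Hilbert_Schmidt a bounded_operators_intros
        cayley_resolvent_bounded mult_op_bounded continuous01_power_function)
  then show ?thesis by (simp add: parabolic_op_def compact_operators_scaleC)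
qed

section \<open>Compact perturbations of multiplication operators\<close>

lemma disjoint_bumps:
  assumes t0: "t0 \<in> {0..1}"
  obtains h :: "nat \<Rightarrow> real \<Rightarrow> complex" where "\<And>n. continuous01 (h n)" "\<And>n. \<exists>t\<in>{0..1}. h n t \<noteq> 0"
    "\<And>m n t. m \<noteq> n \<Longrightarrow> h m t * h n t = 0" "\<And>n t. h n t \<noteq> 0 \<Longrightarrow> \<bar>t - t0\<bar> < (1/2) ^ n"
proof -
  define b where "b n = (1/2::real) ^ n" for n
  define h where "h n t = complex_of_real (max 0 ((\<bar>t - t0\<bar> - b (n + 2)) * (b (n + 1) - \<bar>t - t0\<bar>)))" for n t
  have b_mono: "b n \<le> b m" if "m \<le> n" for m n
    unfolding b_def by (rule power_decreasing) (use that in auto)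
  have supp: "b (n + 2) < \<bar>t - t0\<bar> \<and> \<bar>t - t0\<bar> < b (n + 1)" if "h n t \<noteq> 0" for n t
  proof -
    have "0 < p" if "complex_of_real (max 0 p) \<noteq> 0" for p
      using that by (cases "0 < p") (auto simp: max_def split: if_splits)
    then have "0 < (\<bar>t - t0\<bar> - b (n + 2)) * (b (n + 1) - \<bar>t - t0\<bar>)"
      using that unfolding h_def by blast
    then show ?thesis using b_mono[of "n + 1" "n + 2"] unfolding zero_less_mult_iff by auto
  qed
  have disjoint: "h m t * h n t = 0" if "m < n" for m n t
    using supp[of m t] supp[of n t] b_mono[of "m + 2" "n + 1"] that by fastforce
  show thesis
  proof (rule that)
    show "continuous01 (h n)" for n unfolding h_def by (intro continuous_intros)
    show "h m t * h n t = 0" if "m \<noteq> n" for m n t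
      using disjoint[of m n t] disjoint[of n m t] that by (cases "m < n") (auto simp: mult.commute)
    show "\<bar>t - t0\<bar> < (1/2) ^ n" if "h n t \<noteq> 0" for n t
      using supp[OF that] b_mono[of n "n + 1"] by (simp add: b_def)
    show "\<exists>t\<in>{0..1}. h n t \<noteq> 0" for n
    proof -
      define s where "s = 3/8 * b n"
      have s: "b (n + 2) = 2/3 * s" "b (n + 1) = 4/3 * s" "0 < s" by (simp_all add: s_def b_def)
      have "s \<le> 3/8" using b_mono[of 0 n] by (simp add: s_def b_def)
      define t where "t = (if t0 \<le> 1/2 then t0 + s else t0 - s)"
      have "t \<in> {0..1}" "\<bar>t - t0\<bar> = s" using t0 s(3) \<open>s \<le> 3/8\<close> by (auto simp: t_def)
      moreover have "0 < (s - b (n + 2)) * (b (n + 1) - s)" unfolding s using s(3) by (intro mult_pos_pos) auto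
      ultimately show ?thesis by (intro bexI[of _ t]) (use s in \<open>simp_all add: h_def max_def\<close>)
    qed
  qed
qed

text \<open>The bumps give an orthonormal sequence of approximate eigenvectors of \<^term>\<open>mult_op f\<close> for the
  value \<open>f t\<^sub>0\<close>, on which the quadratic form of a compact operator tends to \<open>0\<close> along a
  subsequence.\<close>

lemma essential_norm_lower_bound:
  assumes f: "continuous01 f" and K: "K \<in> compact_operators" and t0: "t0 \<in> {0..1}"
  shows "cmod (f t0) \<le> norm (mult_op f + K)"
proof -
  obtain h where h: "\<And>n. continuous01 (h n)" and nonzero: "\<And>n. \<exists>t\<in>{0..1}. h n t \<noteq> 0"
    and disjoint: "\<And>m n t. m \<noteq> n \<Longrightarrow> h m t * h n t = 0"
    and near: "\<And>n t. h n t \<noteq> 0 \<Longrightarrow> \<bar>t - t0\<bar> < (1/2) ^ n"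
    using disjoint_bumps[OF t0] by metis
  have h_pos: "norm (fun_vec (h n)) > 0" for n
  proof (rule ccontr)
    assume "\<not> norm (fun_vec (h n)) > 0"
    then have "integral {0..1} (\<lambda>t. (cmod (h n t))\<^sup>2) = 0"
      using norm_fun_vec_square[OF h, of n] by simp
    moreover have "continuous_on {0..1} (\<lambda>t. (cmod (h n t))\<^sup>2)" by (intro continuous_intros h)
    ultimately have "\<forall>t\<in>{0..1}. (cmod (h n t))\<^sup>2 = 0"
      by (subst (asm) integral_eq_0_iff) auto
    then show False using nonzero[of n] by auto
  qed
  define x where "x n = complex_of_real (inverse (norm (fun_vec (h n)))) *\<^sub>C fun_vec (h n)" for n
  have norm_x: "norm (x n) = 1" for n
    using h_pos[of n] by (simp add: x_def norm_scaleC_h2 norm_inverse)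
  have orth: "cinner_h2 (x m) (x n) = (if m = n then 1 else 0)" for m n
  proof (cases "m = n")
    case False
    have "h m t * cnj (h n t) = 0" for t using disjoint[OF False, of t] by auto
    then have "inner01 (h m) (h n) = 0" unfolding inner01_def by (simp only: integral_0)
    then show ?thesis
      using False by (simp add: x_def cinner_h2_simps cinner_fun_vec[OF h h])
  qed (simp add: cinner_h2_self_norm norm_x)
  obtain s where s: "strict_mono s" and K0: "(\<lambda>n. cinner_h2 (K (x (s n))) (x (s n))) \<longlonglongrightarrow> 0"
    using compact_operator_orthonormal[OF K orth] .
  show ?thesis
  proof (rule field_le_epsilon)
    fix e :: real assume e: "e > 0"
    obtain \<delta> where \<delta>: "\<delta> > 0" "\<And>t. t \<in> {0..1} \<Longrightarrow> \<bar>t - t0\<bar> < \<delta> \<Longrightarrow> cmod (f t - f t0) < e/2"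
      using f t0 e unfolding continuous_on_iff dist_norm by (metis half_gt_zero real_norm_def)
    have "(\<lambda>n. (1/2::real) ^ s n) \<longlonglongrightarrow> 0"
      using LIMSEQ_subseq_LIMSEQ[OF LIMSEQ_realpow_zero[of "1/2"] s] by (simp add: comp_def)
    then have "eventually (\<lambda>n. (1/2::real) ^ s n < \<delta>) sequentially"
      by (rule order_tendstoD(2)) (rule \<delta>(1))
    moreover have "eventually (\<lambda>n. cmod (cinner_h2 (K (x (s n))) (x (s n))) < e/2) sequentially"
      by (rule order_tendstoD(2)[OF tendsto_norm_zero[OF K0]]) (use e in simp)
    ultimately have "eventually (\<lambda>n. (1/2::real) ^ s n < \<delta> \<and>
        cmod (cinner_h2 (K (x (s n))) (x (s n))) < e/2) sequentially"
      by (rule eventually_conj)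
    then obtain n where n: "(1/2::real) ^ n < \<delta>" "cmod (cinner_h2 (K (x n)) (x n)) < e/2"
      unfolding eventually_sequentially by blast
    let ?v = "fun_vec (h n)" and ?c = "inverse (norm (fun_vec (h n)))"
    have "norm (fun_vec (\<lambda>t. (f t - f t0) * h n t)) \<le> e/2 * norm ?v"
    proof (rule norm_fun_vec_le[OF _ h])
      show "continuous01 (\<lambda>t. (f t - f t0) * h n t)" by (intro continuous_intros f h)
      fix t :: real assume t: "t \<in> {0..1}"
      have "cmod (f t - f t0) \<le> e/2" if "h n t \<noteq> 0"
        using \<delta>(2)[OF t] near[OF that] n(1) by simp
      then show "cmod ((f t - f t0) * h n t) \<le> e/2 * cmod (h n t)"
        by (cases "h n t = 0") (auto simp: norm_mult intro!: mult_right_mono)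
    qed (use e in simp)
    also have "fun_vec (\<lambda>t. (f t - f t0) * h n t) = fun_vec (\<lambda>t. f t * h n t) - fun_vec (\<lambda>t. f t0 * h n t)"
      unfolding left_diff_distrib by (intro fun_vec_diff continuous_intros f h)
    also have "\<dots> = mult_op f ?v - f t0 *\<^sub>C ?v" by (simp add: mult_op_apply f h fun_vec_cmult)
    finally have v: "norm (mult_op f ?v - f t0 *\<^sub>C ?v) \<le> e/2 * norm ?v" .
    define y where "y = mult_op f (x n) - f t0 *\<^sub>C x n"
    have "y = complex_of_real ?c *\<^sub>C (mult_op f ?v - f t0 *\<^sub>C ?v)"
      by (simp add: y_def x_def bounded_operatorsD[OF mult_op_bounded[OF f]]
          complex_h2.scale_right_diff_distrib mult.commute)
    then have "norm y = ?c * norm (mult_op f ?v - f t0 *\<^sub>C ?v)"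
      by (simp add: norm_scaleC_h2 norm_inverse del: mult_cancel_left)
    also have "\<dots> \<le> ?c * (e/2 * norm ?v)" by (rule mult_left_mono[OF v]) simp
    also have "\<dots> = e/2" using h_pos[of n] by simp
    finally have y: "norm y \<le> e/2" .
    have form: "cmod (cinner_h2 z (x n)) \<le> norm z" for z
      using cinner_h2_Cauchy_Schwarz[of z "x n"] by (simp add: norm_x)
    have "f t0 = cinner_h2 ((mult_op f + K) (x n)) (x n) - cinner_h2 y (x n) - cinner_h2 (K (x n)) (x n)"
      by (simp add: y_def cinner_h2_simps plus_blinfun.rep_eq orth)
    then have "cmod (f t0) \<le> cmod (cinner_h2 ((mult_op f + K) (x n)) (x n)) + cmod (cinner_h2 y (x n))
        + cmod (cinner_h2 (K (x n)) (x n))"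
      by (metis (no_types) add_mono_thms_linordered_semiring(3) norm_triangle_ineq4 order_trans)
    moreover have "norm ((mult_op f + K) (x n)) \<le> norm (mult_op f + K)"
      using norm_blinfun[of "mult_op f + K" "x n"] by (simp add: norm_x)
    ultimately show "cmod (f t0) \<le> norm (mult_op f + K) + e"
      using form[of "(mult_op f + K) (x n)"] form[of y] y n(2) by linarith
  qed
qed

end

section \<open>Polynomials of a positive contraction\<close>

text \<open>The Horner recursion turns multiplicativity in the polynomial into an induction.\<close>

definition op_poly :: "(h2 \<Rightarrow>\<^sub>L h2) \<Rightarrow> complex poly \<Rightarrow> (h2 \<Rightarrow>\<^sub>L h2)"
  where "op_poly T p = fold_coeffs (\<lambda>c S. op_scaleC c id_blinfun + (T o\<^sub>L S)) p 0"

lemma compose_0_right [simp]: "T o\<^sub>L 0 = 0"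
  by (rule blinfun_eqI) (simp add: blinfun.zero_right)

lemma compose_add_right: "T o\<^sub>L (R + S) = (T o\<^sub>L R) + (T o\<^sub>L S)"
  by (rule blinfun_eqI) (simp add: plus_blinfun.rep_eq blinfun.add_right)

lemma op_poly_0 [simp]: "op_poly T 0 = 0"
  by (simp add: op_poly_def)

lemma op_poly_pCons: "op_poly T (pCons c p) = op_scaleC c id_blinfun + (T o\<^sub>L op_poly T p)"
  by (cases "p = 0 \<and> c = 0") (auto simp: op_poly_def)

lemma op_poly_add: "op_poly T (p + q) = op_poly T p + op_poly T q"
proof (induction p q rule: poly_induct2)
  case (pCons a p b q)
  then show ?case
    by (simp add: op_poly_pCons complex_op.scale_left_distrib compose_add_right add_ac)
qed simp

lemma op_poly_sum: "op_poly T (sum F A) = (\<Sum>i\<in>A. op_poly T (F i))"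
  by (induction A rule: infinite_finite_induct) (simp_all add: op_poly_add)

lemma op_poly_smult:
  assumes "T \<in> bounded_operators"
  shows "op_poly T (Polynomial.smult c p) = op_scaleC c (op_poly T p)"
proof (induction p)
  case (pCons a p)
  then show ?case
    by (simp add: op_poly_pCons complex_op.scale_right_distrib op_scaleC_compose_right[OF assms])
qed simp

lemma op_poly_mult:
  assumes T: "T \<in> bounded_operators"
  shows "op_poly T (p * q) = op_poly T p o\<^sub>L op_poly T q"
proof (induction p)
  case (pCons a p)
  have "op_poly T (pCons a p * q) = op_scaleC a (op_poly T q) + (T o\<^sub>L (op_poly T p o\<^sub>L op_poly T q))"
    by (simp add: mult_pCons_left op_poly_add op_poly_smult[OF T] op_poly_pCons pCons)
  also have "\<dots> = op_poly T (pCons a p) o\<^sub>L op_poly T q"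
    by (rule blinfun_eqI) (simp add: op_poly_pCons plus_blinfun.rep_eq op_scaleC_apply)
  finally show ?case .
next
  case 0
  show ?case by (rule blinfun_eqI) simp
qed

lemma op_poly_1 [simp]: "op_poly T 1 = id_blinfun"
  unfolding one_pCons by (simp add: op_poly_pCons)

lemma op_poly_X: "op_poly T [:0, 1:] = T"
  by (simp add: op_poly_pCons)

lemma op_poly_1_minus_X: "op_poly T [:1, -1:] = id_blinfun - T"
  by (rule blinfun_eqI)
    (simp add: op_poly_pCons plus_blinfun.rep_eq minus_blinfun.rep_eq blinfun.minus_right
      uminus_blinfun.rep_eq)

definition symmetric_op :: "(h2 \<Rightarrow>\<^sub>L h2) \<Rightarrow> bool"
  where "symmetric_op S \<longleftrightarrow> (\<forall>x y. cinner_h2 (blinfun_apply S x) y = cinner_h2 x (blinfun_apply S y))"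

definition positive_op :: "(h2 \<Rightarrow>\<^sub>L h2) \<Rightarrow> bool"
  where "positive_op S \<longleftrightarrow> S \<in> bounded_operators \<and> symmetric_op S \<and>
    (\<forall>x. 0 \<le> Re (cinner_h2 (blinfun_apply S x) x))"

text \<open>The geometric mean in the Cauchy--Schwarz inequality of the form \<open>cinner (S x) y\<close> is replaced by
  the arithmetic mean, because that version can be summed over several operators \<open>S\<close>.\<close>

lemma positive_op_Cauchy_Schwarz:
  assumes S: "positive_op S"
  shows "2 * cmod (cinner_h2 (S x) y) \<le> Re (cinner_h2 (S x) x) + Re (cinner_h2 (S y) y)"
proof -
  define a where "a = cinner_h2 (S x) y"
  define c where "c = (if a = 0 then 1 else cnj (sgn a))"
  have c: "c * cnj c = 1" "c * a = of_real (cmod a)"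
  proof -
    have "cmod c = 1" by (simp add: c_def norm_sgn)
    then show "c * cnj c = 1" using complex_norm_square[of c] by simp
    show "c * a = of_real (cmod a)" by (simp add: c_def cnj_sgn_mult_self)
  qed
  have lin: "S (c *\<^sub>C x - y) = c *\<^sub>C S x - S y"
    using S by (simp add: positive_op_def blinfun.diff_right bounded_operatorsD)
  have yx: "cinner_h2 (S y) x = cnj a"
    using S by (metis a_def cinner_h2_commute positive_op_def symmetric_op_def)
  have "cinner_h2 (S (c *\<^sub>C x - y)) (c *\<^sub>C x - y)
      = (c * cnj c) * cinner_h2 (S x) x + cinner_h2 (S y) y - c * a - cnj (c * a)"
    unfolding lin by (simp add: cinner_h2_simps yx a_def[symmetric] algebra_simps)
  also have "Re \<dots> = Re (cinner_h2 (S x) x) + Re (cinner_h2 (S y) y) - 2 * cmod a"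
    unfolding c by simp
  finally have "0 \<le> Re (cinner_h2 (S x) x) + Re (cinner_h2 (S y) y) - 2 * cmod a"
    using S unfolding positive_op_def by metis
  then show ?thesis by (simp add: a_def)
qed

text \<open>The preceding inequality for each \<open>P k\<close> is weighted with \<open>cmod (c k) \<le> M\<close> and summed; the quadratic
  forms of the \<open>P k\<close> add up to the squared norm.\<close>

lemma norm_positive_partition_le:
  assumes P: "\<And>k. k \<in> A \<Longrightarrow> positive_op (P k)" and sum_P: "(\<Sum>k\<in>A. P k) = id_blinfun"
    and c: "\<And>k. k \<in> A \<Longrightarrow> cmod (c k) \<le> M" and M: "M \<ge> 0"
  shows "norm (\<Sum>k\<in>A. op_scaleC (c k) (P k)) \<le> M"
proof (rule norm_blinfun_bound[OF M])
  fix x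
  define S where "S = (\<Sum>k\<in>A. op_scaleC (c k) (P k))"
  have sum_Re: "(\<Sum>k\<in>A. Re (cinner_h2 (P k v) v)) = (norm v)\<^sup>2" for v
  proof -
    have "(\<Sum>k\<in>A. cinner_h2 (P k v) v) = cinner_h2 ((\<Sum>k\<in>A. P k) v) v"
      by (simp add: blinfun.sum_left cinner_h2.sum_left)
    also have "\<dots> = of_real ((norm v)\<^sup>2)" by (simp only: sum_P cinner_h2_self_norm blinfun_apply_id_blinfun)
    finally have "Re (\<Sum>k\<in>A. cinner_h2 (P k v) v) = (norm v)\<^sup>2" by (simp del: of_real_power)
    then show ?thesis by simp
  qed
  have form: "2 * cmod (cinner_h2 (S u) v) \<le> M * ((norm u)\<^sup>2 + (norm v)\<^sup>2)" for u v
  proof -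
    have "cinner_h2 (S u) v = (\<Sum>k\<in>A. c k * cinner_h2 (P k u) v)"
      by (simp add: S_def blinfun.sum_left cinner_h2.sum_left op_scaleC_apply cinner_h2_scaleC_left)
    then have "2 * cmod (cinner_h2 (S u) v) \<le> 2 * (\<Sum>k\<in>A. cmod (c k * cinner_h2 (P k u) v))"
      by (simp add: norm_sum)
    also have "\<dots> = (\<Sum>k\<in>A. cmod (c k) * (2 * cmod (cinner_h2 (P k u) v)))"
      by (simp add: sum_distrib_left norm_mult mult_ac)
    also have "\<dots> \<le> (\<Sum>k\<in>A. M * (Re (cinner_h2 (P k u) u) + Re (cinner_h2 (P k v) v)))"
      by (intro sum_mono mult_mono c positive_op_Cauchy_Schwarz P M) auto
    also have "\<dots> = M * ((norm u)\<^sup>2 + (norm v)\<^sup>2)"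
      by (simp add: sum_distrib_left[symmetric] sum.distrib sum_Re)
    finally show ?thesis .
  qed
  show "norm ((\<Sum>k\<in>A. op_scaleC (c k) (P k)) x) \<le> M * norm x"
    unfolding S_def[symmetric]
  proof (cases "S x = 0 \<or> x = 0")
    case False
    define s where "s = norm (S x)"
    define r where "r = norm x"
    have pos: "s > 0" "r > 0" using False by (auto simp: s_def r_def)
    define v where "v = complex_of_real (r / s) *\<^sub>C S x"
    have "norm v = r" using pos by (simp add: v_def norm_scaleC_h2 s_def norm_divide)
    moreover have "cinner_h2 (S x) v = of_real (r * s)"
    proof -
      have "cinner_h2 (S x) v = of_real (r / s) * of_real (s\<^sup>2)"
        by (simp add: v_def cinner_h2_scaleC_right cinner_h2_self_norm s_def del: of_real_power)
      also have "\<dots> = of_real (r / s * s\<^sup>2)" by (simp only: of_real_mult)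
      also have "r / s * s\<^sup>2 = r * s" using pos by (simp add: power2_eq_square)
      finally show ?thesis .
    qed
    ultimately have "2 * (r * s) \<le> M * (r\<^sup>2 + r\<^sup>2)"
      using form[of x v] pos by (simp add: r_def norm_mult)
    then have "r * s \<le> r * (M * r)" by (simp add: power2_eq_square mult_ac)
    then show "norm (S x) \<le> M * norm x" using pos by (simp add: s_def r_def)
  qed (use M in \<open>auto simp: blinfun.zero_right\<close>)
qed

text \<open>The two inequalities are \<open>T\<^sup>2 \<le> T\<close> and \<open>T \<le> 1\<close> for the quadratic forms.\<close>

definition positive_contraction :: "(h2 \<Rightarrow>\<^sub>L h2) \<Rightarrow> bool"
  where "positive_contraction T \<longleftrightarrow> T \<in> bounded_operators \<and> symmetric_op T \<and>
    (\<forall>x. (norm (blinfun_apply T x))\<^sup>2 \<le> Re (cinner_h2 (blinfun_apply T x) x)) \<and>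
    (\<forall>x. Re (cinner_h2 (blinfun_apply T x) x) \<le> (norm x)\<^sup>2)"

lemma op_poly_bounded:
  assumes "T \<in> bounded_operators"
  shows "op_poly T p \<in> bounded_operators"
  by (induction p) (simp_all add: op_poly_pCons bounded_operators_intros assms)

lemma symmetric_op_poly_mult:
  assumes T: "T \<in> bounded_operators"
    and "symmetric_op (op_poly T p)" "symmetric_op (op_poly T q)"
  shows "symmetric_op (op_poly T (p * q))"
  unfolding symmetric_op_def
proof (intro allI)
  fix x y
  have "cinner_h2 (op_poly T (p * q) x) y = cinner_h2 x (op_poly T (q * p) y)"
    using assms(2,3) by (simp add: op_poly_mult[OF T] symmetric_op_def)
  then show "cinner_h2 (op_poly T (p * q) x) y = cinner_h2 x (op_poly T (p * q) y)"
    by (simp add: mult.commute)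
qed

lemma symmetric_op_id: "symmetric_op id_blinfun"
  by (simp add: symmetric_op_def)

lemma symmetric_op_poly_power:
  assumes T: "T \<in> bounded_operators" and "symmetric_op (op_poly T p)"
  shows "symmetric_op (op_poly T (p ^ k))"
  by (induction k) (simp_all add: symmetric_op_id symmetric_op_poly_mult assms)

text \<open>The product of the powers of \<open>T\<close> and \<open>1 - T\<close> is, after splitting off squares, conjugate to
  one of \<open>1\<close>, \<open>T\<close>, \<open>1 - T\<close> and \<open>T (1 - T)\<close>.\<close>

lemma positive_op_bernstein_monomial:
  assumes T: "positive_contraction T"
  shows "positive_op (op_poly T ([:0, 1:] ^ k * [:1, -1:] ^ m))"
proof -
  have bT: "T \<in> bounded_operators" and sT: "symmetric_op T"
    using T by (auto simp: positive_contraction_def)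
  define X :: "complex poly" where "X = [:0, 1:]"
  define Y :: "complex poly" where "Y = [:1, -1:]"
  have sX: "symmetric_op (op_poly T X)" using sT by (simp add: X_def op_poly_X)
  have sY: "symmetric_op (op_poly T Y)"
    using sT by (simp add: Y_def op_poly_1_minus_X symmetric_op_def minus_blinfun.rep_eq cinner_h2_simps)
  have sym: "symmetric_op (op_poly T (X ^ i * Y ^ j))" for i j
    by (intro symmetric_op_poly_mult symmetric_op_poly_power bT sX sY)
  have pos01: "0 \<le> Re (cinner_h2 (op_poly T (X ^ i * Y ^ j) x) x)" if "i < 2" "j < 2" for i j x
  proof -
    have x: "Re (cinner_h2 x x) = (norm x)\<^sup>2" by (simp add: cinner_h2_self_norm del: of_real_power)
    have TT: "Re (cinner_h2 (T (T x)) x) = (norm (T x))\<^sup>2"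
      using sT by (simp add: symmetric_op_def cinner_h2_self_norm del: of_real_power)
    have "(norm (T x))\<^sup>2 \<le> Re (cinner_h2 (T x) x)" "Re (cinner_h2 (T x) x) \<le> (norm x)\<^sup>2"
      using T by (auto simp: positive_contraction_def)
    moreover from this(1) have "0 \<le> Re (cinner_h2 (T x) x)"
      using zero_le_power2 order_trans by blast
    moreover have "i = 0 \<or> i = 1" "j = 0 \<or> j = 1" using that by auto
    ultimately show ?thesis
      by (auto simp: X_def Y_def op_poly_mult[OF bT] op_poly_X op_poly_1_minus_X minus_blinfun.rep_eq
          blinfun.diff_right cinner_h2_simps x TT)
  qed
  have "0 \<le> Re (cinner_h2 (op_poly T (X ^ k * Y ^ m) x) x)" for x
  proof -
    define A where "A = X ^ (k div 2) * Y ^ (m div 2)"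
    define B where "B = X ^ (k mod 2) * Y ^ (m mod 2)"
    have kk: "X ^ k = X ^ (k div 2) * X ^ (k mod 2) * X ^ (k div 2)"
      unfolding power_add[symmetric] by (rule arg_cong[where f = "power X"]) presburger
    have mm: "Y ^ m = Y ^ (m div 2) * Y ^ (m mod 2) * Y ^ (m div 2)"
      unfolding power_add[symmetric] by (rule arg_cong[where f = "power Y"]) presburger
    have "X ^ k * Y ^ m = A * (B * A)"
      unfolding kk mm A_def B_def by (simp only: mult_ac)
    then have "cinner_h2 (op_poly T (X ^ k * Y ^ m) x) x
        = cinner_h2 (op_poly T A (op_poly T B (op_poly T A x))) x"
      by (simp add: op_poly_mult[OF bT])
    also have "\<dots> = cinner_h2 (op_poly T B (op_poly T A x)) (op_poly T A x)"
      using sym unfolding A_def symmetric_op_def by blast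
    finally show ?thesis using pos01[of "k mod 2" "m mod 2"] unfolding B_def by simp
  qed
  with sym show ?thesis
    unfolding positive_op_def X_def[symmetric] Y_def[symmetric] using op_poly_bounded[OF bT] by blast
qed

lemma positive_op_scale:
  assumes "positive_op S"
  shows "positive_op (op_scaleC (of_nat n) S)"
  using assms unfolding positive_op_def symmetric_op_def
  by (auto simp: bounded_operators_scaleC op_scaleC_apply cinner_h2_scaleC_left cinner_h2_scaleC_right)

lemma sum_bernstein_factor: "(\<Sum>k\<le>n. bernstein_factor n k) = 1"
proof -
  have "bernstein_factor n k = of_nat (n choose k) * [:0, 1:] ^ k * [:1, -1:] ^ (n - k)" for k
    by (simp add: bernstein_factor_def of_nat_poly)
  then have "(\<Sum>k\<le>n. bernstein_factor n k)
      = (\<Sum>k\<le>n. of_nat (n choose k) * [:0, 1:] ^ k * [:1, -1:] ^ (n - k))"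
    by (intro sum.cong refl)
  also have "\<dots> = ([:0, 1:] + [:1, -1:] :: complex poly) ^ n"
    by (rule binomial_ring[symmetric])
  also have "[:0, 1:] + [:1, -1:] = (1 :: complex poly)" by (simp add: one_pCons)
  finally show ?thesis by simp
qed

text \<open>At a positive contraction the Bernstein basis polynomials form a partition of the identity into
  positive operators.  So the Bernstein approximation of a function is bounded in operator norm, and
  not only modulo compact operators, by the supremum of the function.\<close>

lemma norm_op_poly_bernstein_le:
  assumes T: "positive_contraction T" and q: "\<And>t. t \<in> {0..1} \<Longrightarrow> cmod (q t) \<le> M" and M: "M \<ge> 0"
  shows "norm (op_poly T (bernstein_poly n q)) \<le> M"
proof -
  have bT: "T \<in> bounded_operators" using T by (simp add: positive_contraction_def)
  have "op_poly T (bernstein_poly n q)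
      = (\<Sum>k\<le>n. op_scaleC (q (k / n)) (op_poly T (bernstein_factor n k)))"
    by (simp add: bernstein_poly_def op_poly_sum op_poly_smult[OF bT])
  also have "norm \<dots> \<le> M"
  proof (rule norm_positive_partition_le[OF _ _ _ M])
    show "positive_op (op_poly T (bernstein_factor n k))" for k
      unfolding bernstein_factor_def op_poly_smult[OF bT]
      by (intro positive_op_scale positive_op_bernstein_monomial T)
    show "(\<Sum>k\<le>n. op_poly T (bernstein_factor n k)) = id_blinfun"
      by (simp add: op_poly_sum[symmetric] sum_bernstein_factor)
    show "cmod (q (k / n)) \<le> M" if "k \<in> {..n}" for k
      by (rule q) (use that in \<open>auto simp: divide_le_eq\<close>)
  qed
  finally show ?thesis .
qed

section \<open>The generated algebra modulo the compact operators\<close>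

lemma unital_cstar_subalgebra_generated:
  assumes "unital_cstar_subalgebra A" "P \<subseteq> A"
  shows "unital_cstar_subalgebra (cstar_generated P)"
    and "P \<subseteq> cstar_generated P" and "cstar_generated P \<subseteq> A"
proof -
  let ?F = "{A. unital_cstar_subalgebra A \<and> P \<subseteq> A}"
  have A: "A \<in> ?F" using assms by blast
  have sub: "unital_cstar_subalgebra B" if "B \<in> ?F" for B using that by blast
  show "cstar_generated P \<subseteq> A" "P \<subseteq> cstar_generated P"
    using A unfolding cstar_generated_def by blast+
  have "closed (\<Inter>?F)" using sub by (intro closed_Inter) (auto simp: unital_cstar_subalgebra_def)
  moreover have "\<Inter>?F \<subseteq> bounded_operators" using A sub unfolding unital_cstar_subalgebra_def by blast
  ultimately show "unital_cstar_subalgebra (cstar_generated P)"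
    unfolding cstar_generated_def unital_cstar_subalgebra_def[of "\<Inter>?F"]
    using sub unfolding unital_cstar_subalgebra_def by blast
qed

context boundary_point
begin

text \<open>The symbol \<open>f\<close> is unique on the unit interval by the lower bound for the essential norm.\<close>

definition ess_mult :: "(h2 \<Rightarrow>\<^sub>L h2) \<Rightarrow> (real \<Rightarrow> complex) \<Rightarrow> bool"
  where "ess_mult T f \<longleftrightarrow> continuous01 f \<and> T - mult_op f \<in> compact_operators"

lemma ess_mult_mult_op: "continuous01 f \<Longrightarrow> ess_mult (mult_op f) f"
  by (simp add: ess_mult_def compact_operators_0)

lemma ess_mult_cong:
  assumes T: "ess_mult T f" and eq: "\<And>t. t \<in> {0..1} \<Longrightarrow> f t = g t"
  shows "ess_mult T g"
proof -
  have "continuous01 f = continuous01 g" by (rule continuous_on_cong[OF refl eq])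
  moreover have "mult_op f = mult_op g" by (rule mult_op_cong) (rule eq)
  ultimately show ?thesis using T by (simp add: ess_mult_def)
qed

lemma ess_mult_parabolic: "Re a > 0 \<Longrightarrow> ess_mult (parabolic_op a) (power_function a)"
  by (simp add: ess_mult_def continuous01_power_function parabolic_op_mod_compact)

lemma ess_mult_bounded:
  assumes "ess_mult T f"
  shows "T \<in> bounded_operators"
proof -
  have "mult_op f + (T - mult_op f) \<in> bounded_operators"
    using assms unfolding ess_mult_def
    by (intro bounded_operators_add mult_op_bounded compact_operators_bounded) auto
  then show ?thesis by simp
qed

lemma ess_mult_id: "ess_mult id_blinfun (\<lambda>t. 1)"
  by (simp add: ess_mult_def mult_op_1 compact_operators_0)

lemma ess_mult_add:
  assumes "ess_mult S f" "ess_mult T g"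
  shows "ess_mult (S + T) (\<lambda>t. f t + g t)"
proof -
  have eq: "(S + T) - mult_op (\<lambda>t. f t + g t) = (S - mult_op f) + (T - mult_op g)"
    using assms by (simp add: ess_mult_def mult_op_add)
  show ?thesis
    unfolding ess_mult_def eq
    by (intro conjI continuous_intros compact_operators_add; use assms in \<open>simp add: ess_mult_def\<close>)
qed

lemma ess_mult_scaleC:
  assumes "ess_mult T f"
  shows "ess_mult (op_scaleC c T) (\<lambda>t. c * f t)"
proof -
  have eq: "op_scaleC c T - mult_op (\<lambda>t. c * f t) = op_scaleC c (T - mult_op f)"
    using assms by (simp add: ess_mult_def mult_op_cmult complex_op.scale_right_diff_distrib)
  show ?thesis
    unfolding ess_mult_def eq
    by (intro conjI continuous_intros compact_operators_scaleC; use assms in \<open>simp add: ess_mult_def\<close>)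
qed

lemma ess_mult_diff:
  assumes "ess_mult S f" "ess_mult T g"
  shows "ess_mult (S - T) (\<lambda>t. f t - g t)"
  using ess_mult_add[OF assms(1) ess_mult_scaleC[OF assms(2), of "- 1"]] by simp

lemma ess_mult_compose:
  assumes S: "ess_mult S f" and T: "ess_mult T g"
  shows "ess_mult (S o\<^sub>L T) (\<lambda>t. f t * g t)"
proof -
  have f: "continuous01 f" and g: "continuous01 g" using S T by (auto simp: ess_mult_def)
  have eq: "(S o\<^sub>L T) - mult_op (\<lambda>t. f t * g t)
      = (S o\<^sub>L (T - mult_op g)) + ((S - mult_op f) o\<^sub>L mult_op g)"
    by (rule blinfun_eqI)
      (simp add: mult_op_mult[OF f g] plus_blinfun.rep_eq minus_blinfun.rep_eq blinfun.diff_right)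
  show ?thesis
    unfolding ess_mult_def eq
    by (intro conjI continuous_intros f g compact_operators_add compact_operators_compose_left
        compact_operators_compose_right ess_mult_bounded[OF S] mult_op_bounded[OF g];
        use S T in \<open>simp add: ess_mult_def\<close>)
qed

lemma ess_mult_adjoint:
  assumes T: "ess_mult T f"
  shows "ess_mult (op_adjoint T) (\<lambda>t. cnj (f t))"
proof -
  have f: "continuous01 f" using T by (simp add: ess_mult_def)
  have eq: "op_adjoint T - mult_op (\<lambda>t. cnj (f t)) = op_adjoint (T - mult_op f)"
    by (simp add: op_adjoint_diff ess_mult_bounded[OF T] mult_op_bounded[OF f] op_adjoint_mult_op[OF f])
  show ?thesis
    unfolding ess_mult_def eq
    by (intro conjI continuous_intros f compact_operators_adjoint; use T in \<open>simp add: ess_mult_def\<close>)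
qed

lemma ess_mult_norm_le:
  assumes "ess_mult T f" "t \<in> {0..1}"
  shows "cmod (f t) \<le> norm T"
  using essential_norm_lower_bound[of f "T - mult_op f" t] assms by (simp add: ess_mult_def)

lemma ess_mult_unique:
  assumes "ess_mult T f" "ess_mult T g" "t \<in> {0..1}"
  shows "f t = g t"
  using ess_mult_norm_le[OF ess_mult_diff[OF assms(1,2)] assms(3)] by simp

text \<open>The essential norm bound makes the symbols of a norm convergent sequence converge
  uniformly.\<close>

lemma ess_mult_closed:
  assumes F: "\<And>n. ess_mult (F n) (f n)" and lim: "F \<longlonglongrightarrow> T"
  shows "\<exists>g. ess_mult T g"
proof -
  have cont: "continuous01 (f n)" for n using F[of n] by (simp add: ess_mult_def)
  have cauchy: "Cauchy F" using lim by (rule LIMSEQ_imp_Cauchy)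
  have "uniformly_Cauchy_on {0..1} f"
    unfolding uniformly_Cauchy_on_def
  proof (intro allI impI)
    fix e :: real assume "e > 0"
    then obtain M where M: "\<And>m n. m \<ge> M \<Longrightarrow> n \<ge> M \<Longrightarrow> norm (F m - F n) < e"
      using CauchyD[OF cauchy] by meson
    show "\<exists>M. \<forall>t\<in>{0..1}. \<forall>m\<ge>M. \<forall>n\<ge>M. dist (f m t) (f n t) < e"
      unfolding dist_norm
      using ess_mult_norm_le[OF ess_mult_diff[OF F F]] M by (intro exI[of _ M]) (meson le_less_trans)
  qed
  then obtain g where g: "uniform_limit {0..1} f g sequentially"
    using Cauchy_uniformly_convergent uniformly_convergent_on_def by blast
  have cont_g: "continuous01 g"
    by (rule uniform_limit_theorem[OF _ g]) (use cont in auto)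
  have "(\<lambda>n. mult_op (f n)) \<longlonglongrightarrow> mult_op g"
  proof (rule LIMSEQ_I)
    fix e :: real assume e: "e > 0"
    then have "eventually (\<lambda>n. \<forall>t\<in>{0..1}. dist (f n t) (g t) < e/2) sequentially"
      using uniform_limitD[OF g, of "e/2"] by simp
    then obtain N where N: "\<And>n t. n \<ge> N \<Longrightarrow> t \<in> {0..1} \<Longrightarrow> dist (f n t) (g t) < e/2"
      unfolding eventually_sequentially by blast
    have "norm (mult_op (f n) - mult_op g) < e" if "n \<ge> N" for n
    proof -
      have c: "continuous01 (\<lambda>t. f n t - g t)" by (intro continuous_intros cont cont_g)
      have "norm (mult_op (\<lambda>t. f n t - g t)) \<le> e/2"
        by (rule norm_mult_op_le[OF c]) (use N[OF that] e in \<open>auto simp: dist_norm intro: less_imp_le\<close>)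
      then show ?thesis using e by (simp add: mult_op_diff[OF cont cont_g])
    qed
    then show "\<exists>N. \<forall>n\<ge>N. norm (mult_op (f n) - mult_op g) < e" by blast
  qed
  then have "(\<lambda>n. F n - mult_op (f n)) \<longlonglongrightarrow> T - mult_op g"
    by (intro tendsto_diff lim)
  then have "T - mult_op g \<in> compact_operators"
    by (rule closed_sequentially[OF closed_compact_operators, rotated])
      (use F in \<open>simp add: ess_mult_def\<close>)
  then show ?thesis using cont_g unfolding ess_mult_def by blast
qed

text \<open>This algebra contains the composition operators, hence the algebra they generate.\<close>

lemma unital_cstar_ess_mult: "unital_cstar_subalgebra {T. \<exists>f. ess_mult T f}"
  unfolding unital_cstar_subalgebra_def
proof (intro conjI)
  show "{T. \<exists>f. ess_mult T f} \<subseteq> bounded_operators" using ess_mult_bounded by blast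
  show "closed {T. \<exists>f. ess_mult T f}"
    unfolding closed_sequential_limits
  proof (intro allI impI, elim conjE)
    fix F T assume F: "\<forall>n::nat. F n \<in> {T. \<exists>f. ess_mult T f}" and lim: "F \<longlonglongrightarrow> T"
    from F obtain f where "\<And>n. ess_mult (F n) (f n)" by simp metis
    from ess_mult_closed[OF this lim] show "T \<in> {T. \<exists>f. ess_mult T f}" by simp
  qed
qed (blast intro: ess_mult_id ess_mult_add ess_mult_compose ess_mult_scaleC ess_mult_adjoint)+

abbreviation parabolic_algebra :: "(h2 \<Rightarrow>\<^sub>L h2) set"
  where "parabolic_algebra \<equiv> cstar_generated (parabolic_operators \<gamma>)"

lemma parabolic_operators_ess_mult: "parabolic_operators \<gamma> \<subseteq> {T. \<exists>f. ess_mult T f}"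
proof
  fix T assume "T \<in> parabolic_operators \<gamma>"
  then obtain a where a: "Re a > 0" "T = parabolic_op a"
    unfolding parabolic_operators_def using composition_operator_parabolic by auto
  then show "T \<in> {T. \<exists>f. ess_mult T f}" using ess_mult_parabolic[OF a(1)] by blast
qed

lemmas parabolic_algebra_generated =
  unital_cstar_subalgebra_generated[OF unital_cstar_ess_mult parabolic_operators_ess_mult]

lemma parabolic_algebra:
  shows parabolic_algebra_closed: "closed parabolic_algebra"
    and parabolic_algebra_id: "id_blinfun \<in> parabolic_algebra"
    and parabolic_algebra_add: "S \<in> parabolic_algebra \<Longrightarrow> T \<in> parabolic_algebra \<Longrightarrow> S + T \<in> parabolic_algebra"
    and parabolic_algebra_compose: "S \<in> parabolic_algebra \<Longrightarrow> T \<in> parabolic_algebra \<Longrightarrow> S o\<^sub>L T \<in> parabolic_algebra"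
    and parabolic_algebra_scaleC: "T \<in> parabolic_algebra \<Longrightarrow> op_scaleC c T \<in> parabolic_algebra"
    and parabolic_algebra_adjoint: "T \<in> parabolic_algebra \<Longrightarrow> op_adjoint T \<in> parabolic_algebra"
  using parabolic_algebra_generated(1) unfolding unital_cstar_subalgebra_def by blast+

lemma parabolic_algebra_0: "0 \<in> parabolic_algebra"
  using parabolic_algebra_scaleC[OF parabolic_algebra_id, of 0] by simp

lemma parabolic_op_in_algebra:
  assumes a: "Re a > 0"
  shows "parabolic_op a \<in> parabolic_algebra"
proof -
  have "composition_operator (parabolic_map \<gamma> a) \<in> parabolic_operators \<gamma>"
    unfolding parabolic_operators_def using a by blast
  then show ?thesis
    unfolding composition_operator_parabolic[OF a] using parabolic_algebra_generated(2) by blast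
qed

lemma op_poly_in_algebra: "T \<in> parabolic_algebra \<Longrightarrow> op_poly T p \<in> parabolic_algebra"
  by (induction p)
    (simp_all add: op_poly_pCons parabolic_algebra_0 parabolic_algebra_id parabolic_algebra_add
      parabolic_algebra_compose parabolic_algebra_scaleC)

lemma ess_mult_op_poly:
  assumes T: "ess_mult T g"
  shows "ess_mult (op_poly T p) (\<lambda>t. poly p (g t))"
proof (induction p)
  case 0
  show ?case using ess_mult_scaleC[OF ess_mult_id, of 0] by simp
next
  case (pCons c p)
  show ?case
    using ess_mult_add[OF ess_mult_scaleC[OF ess_mult_id, of c] ess_mult_compose[OF T pCons(2)]]
    by (simp add: op_poly_pCons)
qed

text \<open>With \<open>A\<close> the composition operator for \<open>a = 1\<close>, the operator \<open>A\<^sup>* A\<close> is positive with symbol \<open>t\<^sup>2\<close>,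
  and a large multiple of the identity dominates it.\<close>

lemma positive_contraction_in_algebra:
  obtains T N where "T \<in> parabolic_algebra" "positive_contraction T" "N \<ge> 1"
    "ess_mult T (\<lambda>t. of_real (t\<^sup>2 / N))"
proof -
  define A where "A = parabolic_op 1"
  (* Large enough to dominate the squared norms of A and of its adjoint. *)
  define N where "N = (norm A + norm (op_adjoint A) + 1)\<^sup>2"
  define T where "T = op_scaleC (of_real (1 / N)) (op_adjoint A o\<^sub>L A)"
  have bA: "A \<in> bounded_operators" unfolding A_def by (rule parabolic_op_bounded) simp
  have N1: "N \<ge> 1" unfolding N_def by (rule one_le_power) simp
  have NA: "(norm A)\<^sup>2 \<le> N" "(norm (op_adjoint A))\<^sup>2 \<le> N"
    unfolding N_def by (intro power_mono; simp)+
  have bT: "T \<in> bounded_operators"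
    unfolding T_def by (intro bounded_operators_intros bounded_operators_adjoint bA)
  have TA: "cinner_h2 (T x) y = of_real (1 / N) * cinner_h2 (A x) (A y)" for x y
    by (simp add: T_def op_scaleC_apply cinner_h2_scaleC_left cinner_op_adjoint_left[OF bA])
  have TA': "cinner_h2 x (T y) = of_real (1 / N) * cinner_h2 (A x) (A y)" for x y
    by (simp add: T_def op_scaleC_apply cinner_h2_scaleC_right cinner_op_adjoint[OF bA])
  have Txx: "Re (cinner_h2 (T x) x) = (norm (A x))\<^sup>2 / N" for x
    unfolding TA cinner_h2_self_norm of_real_mult[symmetric] by simp
  have "positive_contraction T"
    unfolding positive_contraction_def symmetric_op_def
  proof (intro conjI allI bT)
    show "cinner_h2 (T x) y = cinner_h2 x (T y)" for x y unfolding TA TA' ..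
    show "Re (cinner_h2 (T x) x) \<le> (norm x)\<^sup>2" for x
    proof -
      have "(norm (A x))\<^sup>2 \<le> (norm A * norm x)\<^sup>2" by (intro power_mono norm_blinfun) simp
      also have "\<dots> \<le> N * (norm x)\<^sup>2"
        unfolding power_mult_distrib by (intro mult_right_mono NA) simp
      finally show ?thesis unfolding Txx using N1 by (simp add: divide_le_eq mult.commute)
    qed
    show "(norm (T x))\<^sup>2 \<le> Re (cinner_h2 (T x) x)" for x
    proof -
      have "norm (T x) = norm (op_adjoint A (A x)) / N"
        using N1 by (simp add: T_def op_scaleC_apply norm_scaleC_h2 norm_divide)
      then have "(norm (T x))\<^sup>2 = (norm (op_adjoint A (A x)))\<^sup>2 / N\<^sup>2"
        by (simp add: power_divide)
      also have "\<dots> \<le> (norm (op_adjoint A) * norm (A x))\<^sup>2 / N\<^sup>2"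
        by (intro divide_right_mono power_mono norm_blinfun) simp_all
      also have "\<dots> \<le> (N * (norm (A x))\<^sup>2) / N\<^sup>2"
        unfolding power_mult_distrib by (intro divide_right_mono mult_right_mono NA) simp_all
      also have "\<dots> = (norm (A x))\<^sup>2 / N" using N1 by (simp add: power2_eq_square)
      finally show ?thesis unfolding Txx .
    qed
  qed
  moreover have "T \<in> parabolic_algebra"
    unfolding T_def A_def
    by (intro parabolic_algebra_scaleC parabolic_algebra_compose parabolic_algebra_adjoint
        parabolic_op_in_algebra) simp_all
  moreover have "ess_mult T (\<lambda>t. of_real (t\<^sup>2 / N))"
  proof -
    have A: "ess_mult A (power_function 1)" unfolding A_def by (rule ess_mult_parabolic) simp
    have "ess_mult T (\<lambda>t. of_real (1 / N) * (cnj (power_function 1 t) * power_function 1 t))"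
      unfolding T_def by (intro ess_mult_scaleC ess_mult_compose ess_mult_adjoint A)
    moreover have "of_real (1 / N) * (cnj (power_function 1 t) * power_function 1 t)
        = complex_of_real (t\<^sup>2 / N)" if "t \<in> {0..1}" for t
      using that by (simp add: power_function_def power2_eq_square)
    ultimately show ?thesis by (rule ess_mult_cong)
  qed
  ultimately show ?thesis using that N1 by blast
qed

text \<open>The point is the bound for \<open>norm S\<close> by the supremum of \<open>f\<close>.  Approximating \<open>f\<close> by polynomials in
  \<open>t\<close> would yield elements of the algebra with nearby symbols, but their norms might be unbounded.\<close>

lemma approximate_lift:
  assumes f: "continuous01 f" and M: "\<And>t. t \<in> {0..1} \<Longrightarrow> cmod (f t) \<le> M" "M \<ge> 0" and e: "e > 0"
  shows "\<exists>S\<in>parabolic_algebra. \<exists>g. norm S \<le> M \<and> ess_mult S g \<and> (\<forall>t\<in>{0..1}. cmod (f t - g t) \<le> e)"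
proof -
  obtain T N where T: "T \<in> parabolic_algebra" "positive_contraction T" "N \<ge> 1"
    "ess_mult T (\<lambda>t. of_real (t\<^sup>2 / N))"
    using positive_contraction_in_algebra .
  (* F is f in the variable u = t^2 / N, extended by the constant f 1 to the unit interval. *)
  define F where "F u = f (sqrt (min 1 (N * u)))" for u
  have F_cont: "continuous01 F"
    unfolding F_def
    by (rule continuous_on_compose2[OF f]) (use T(3) in \<open>auto intro!: continuous_intros\<close>)
  have F_bound: "cmod (F u) \<le> M" if "u \<in> {0..1}" for u
    unfolding F_def by (rule M) (use that T(3) in auto)
  have F_symbol: "F (t\<^sup>2 / N) = f t" if "t \<in> {0..1}" for t
  proof -
    have "t\<^sup>2 \<le> 1" using that by (simp add: power_le_one)
    then show ?thesis using that T(3) by (simp add: F_def min_def)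
  qed
  obtain n where n: "\<And>u. u \<in> {0..1} \<Longrightarrow> cmod (poly (bernstein_poly n F) (of_real u) - F u) < e"
    using bernstein_approximation[OF F_cont e] by blast
  let ?S = "op_poly T (bernstein_poly n F)"
  let ?g = "\<lambda>t. poly (bernstein_poly n F) (complex_of_real (t\<^sup>2 / N))"
  have "cmod (f t - ?g t) \<le> e" if t: "t \<in> {0..1}" for t
  proof -
    have "t\<^sup>2 \<le> 1" using t by (simp add: power_le_one)
    then have "t\<^sup>2 / N \<in> {0..1}" using T(3) by (auto simp: divide_le_eq)
    from n[OF this] show ?thesis unfolding F_symbol[OF t] by (simp add: norm_minus_commute)
  qed
  moreover have "norm ?S \<le> M" by (rule norm_op_poly_bernstein_le[OF T(2) F_bound M(2)])
  moreover have "?S \<in> parabolic_algebra" by (rule op_poly_in_algebra[OF T(1)])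
  moreover have "ess_mult ?S ?g" by (rule ess_mult_op_poly[OF T(4)])
  ultimately show ?thesis by blast
qed

text \<open>Approximate lifts of the successive errors, with bounds that halve in each step, sum up to an
  exact lift: the geometric decay makes the series converge inside the algebra.\<close>

lemma lift_exists:
  assumes f: "continuous01 f"
  shows "\<exists>T\<in>parabolic_algebra. ess_mult T f"
proof -
  obtain M where M: "M > 0" "\<And>t. t \<in> {0..1} \<Longrightarrow> cmod (f t) \<le> M"
    using continuous01_bounded[OF f] by blast
  define b where "b n = M * (1/2) ^ n" for n
  have b: "b n > 0" for n using M(1) by (simp add: b_def)
  define ok where "ok n \<phi> \<longleftrightarrow> continuous01 \<phi> \<and> (\<forall>t\<in>{0..1}. cmod (\<phi> t) \<le> b n)" for n \<phi>
  have "\<exists>S g. ok n \<phi> \<longrightarrow> S \<in> parabolic_algebra \<and> norm S \<le> b n \<and> ess_mult S g \<and>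
      (\<forall>t\<in>{0..1}. cmod (\<phi> t - g t) \<le> b (Suc n))" for n \<phi>
    using approximate_lift[of \<phi> "b n" "b (Suc n)"] b[of n] b[of "Suc n"] unfolding ok_def
    by (meson less_imp_le)
  then obtain S g where Sg: "\<And>n \<phi>. ok n \<phi> \<Longrightarrow> S n \<phi> \<in> parabolic_algebra \<and> norm (S n \<phi>) \<le> b n \<and>
      ess_mult (S n \<phi>) (g n \<phi>) \<and> (\<forall>t\<in>{0..1}. cmod (\<phi> t - g n \<phi> t) \<le> b (Suc n))"
    by metis
  define fs where "fs = rec_nat f (\<lambda>n \<phi> t. \<phi> t - g n \<phi> t)"
  have fs: "fs 0 = f" "fs (Suc n) = (\<lambda>t. fs n t - g n (fs n) t)" for n by (simp_all add: fs_def)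
  have ok: "ok n (fs n)" for n
  proof (induction n)
    case 0
    show ?case using f M by (simp add: ok_def fs b_def)
  next
    case (Suc n)
    have "continuous01 (g n (fs n))" using Sg[OF Suc] by (simp add: ess_mult_def)
    then show ?case
      using Sg[OF Suc] Suc unfolding ok_def fs by (auto intro!: continuous_intros)
  qed
  define Sn where "Sn n = S n (fs n)" for n
  have Sn: "Sn n \<in> parabolic_algebra" "norm (Sn n) \<le> b n" "ess_mult (Sn n) (g n (fs n))" for n
    using Sg[OF ok[of n]] by (simp_all add: Sn_def)
  have partial: "(\<Sum>k<n. Sn k) \<in> parabolic_algebra \<and> ess_mult (\<Sum>k<n. Sn k) (\<lambda>t. f t - fs n t)" for n
  proof (induction n)
    case 0
    show ?case using parabolic_algebra_0 ess_mult_scaleC[OF ess_mult_id, of 0] by (simp add: fs)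
  next
    case (Suc n)
    show ?case
      using parabolic_algebra_add[OF conjunct1[OF Suc] Sn(1)[of n]]
        ess_mult_add[OF conjunct2[OF Suc] Sn(3)[of n]]
      by (simp add: fs algebra_simps)
  qed
  have "summable b" unfolding b_def by (intro summable_mult summable_geometric) simp
  then have "summable Sn" by (rule summable_comparison_test'[of _ 0]) (rule Sn(2))
  then have lim: "(\<lambda>n. \<Sum>k<n. Sn k) \<longlonglongrightarrow> suminf Sn" by (rule summable_LIMSEQ)
  have fs_cont: "continuous01 (fs n)" for n using ok[of n] by (simp add: ok_def)
  have "(\<lambda>n. mult_op (fs n)) \<longlonglongrightarrow> 0"
  proof (rule Lim_null_comparison)
    show "b \<longlonglongrightarrow> 0" by (rule summable_LIMSEQ_zero) fact
    have "norm (mult_op (fs n)) \<le> b n" for n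
      by (rule norm_mult_op_le[OF fs_cont]) (use ok[of n] b[of n] in \<open>auto simp: ok_def\<close>)
    then show "eventually (\<lambda>n. norm (mult_op (fs n)) \<le> b n) sequentially" by simp
  qed
  then have lim_K: "(\<lambda>n. (\<Sum>k<n. Sn k) - (mult_op f - mult_op (fs n))) \<longlonglongrightarrow> suminf Sn - (mult_op f - 0)"
    by (intro tendsto_diff lim tendsto_const)
  have "(\<Sum>k<n. Sn k) - (mult_op f - mult_op (fs n)) \<in> compact_operators" for n
    using conjunct2[OF partial[of n]] by (simp add: ess_mult_def mult_op_diff[OF f fs_cont])
  from closed_sequentially[OF closed_compact_operators this lim_K]
  have "suminf Sn - mult_op f \<in> compact_operators" by simp
  moreover have "suminf Sn \<in> parabolic_algebra"
    using closed_sequentially[OF parabolic_algebra_closed _ lim] partial by blast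
  ultimately show ?thesis using f unfolding ess_mult_def by blast
qed

end

section \<open>Characters of the algebra of continuous functions\<close>

text \<open>A character that respects conjugation is contractive, because \<open>M\<^sup>2 - \<bar>f\<bar>\<^sup>2\<close> is of the form
  \<open>g g\<^sup>*\<close> whenever \<open>M\<close> bounds \<open>f\<close>.  Hence its values on polynomials determine it.\<close>

lemma character_eq_evaluation:
  fixes \<phi> :: "(real \<Rightarrow> complex) \<Rightarrow> complex"
  assumes cong: "\<And>f g. (\<And>t. t \<in> {0..1} \<Longrightarrow> f t = g t) \<Longrightarrow> \<phi> f = \<phi> g"
    and add: "\<And>f g. continuous01 f \<Longrightarrow> continuous01 g \<Longrightarrow> \<phi> (\<lambda>t. f t + g t) = \<phi> f + \<phi> g"
    and mult: "\<And>f g. continuous01 f \<Longrightarrow> continuous01 g \<Longrightarrow> \<phi> (\<lambda>t. f t * g t) = \<phi> f * \<phi> g"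
    and scale: "\<And>c f. continuous01 f \<Longrightarrow> \<phi> (\<lambda>t. c * f t) = c * \<phi> f"
    and conj: "\<And>f. continuous01 f \<Longrightarrow> \<phi> (\<lambda>t. cnj (f t)) = cnj (\<phi> f)"
    and one: "\<phi> (\<lambda>t. 1) = 1"
    and ident: "\<phi> complex_of_real = of_real s"
    and s: "s \<in> {0..1}" and f: "continuous01 f"
  shows "\<phi> f = f s"
proof -
  have const: "\<phi> (\<lambda>t. c) = c" for c
    using scale[of "\<lambda>t. 1" c] by (simp add: one)
  have bound: "cmod (\<phi> h) \<le> M"
    if h: "continuous01 h" and M: "\<And>t. t \<in> {0..1} \<Longrightarrow> cmod (h t) \<le> M" "M \<ge> 0" for h M
  proof -
    define g where "g t = complex_of_real (sqrt (M\<^sup>2 - (cmod (h t))\<^sup>2))" for t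
    have g: "continuous01 g" unfolding g_def by (intro continuous_intros h)
    have c: "continuous01 (\<lambda>t. h t * cnj (h t))" "continuous01 (\<lambda>t. g t * cnj (g t))"
      "continuous01 (\<lambda>t. cnj (h t))" "continuous01 (\<lambda>t. cnj (g t))"
      by (intro continuous_intros h g)+
    have "\<phi> (\<lambda>t. h t * cnj (h t) + g t * cnj (g t)) = \<phi> (\<lambda>t. of_real (M\<^sup>2))"
    proof (rule cong)
      fix t :: real assume "t \<in> {0..1}"
      then have "(cmod (h t))\<^sup>2 \<le> M\<^sup>2" by (intro power_mono M) auto
      then have "g t * cnj (g t) = of_real (M\<^sup>2 - (cmod (h t))\<^sup>2)"
        by (simp add: g_def del: of_real_diff of_real_power flip: of_real_mult)
      moreover have "h t * cnj (h t) = of_real ((cmod (h t))\<^sup>2)"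
        using complex_norm_square[of "h t"] by simp
      ultimately show "h t * cnj (h t) + g t * cnj (g t) = of_real (M\<^sup>2)"
        by (simp del: of_real_power)
    qed
    then have "\<phi> h * cnj (\<phi> h) + \<phi> g * cnj (\<phi> g) = of_real (M\<^sup>2)"
      by (simp add: add c mult h g conj const del: of_real_power)
    then have "complex_of_real ((cmod (\<phi> h))\<^sup>2 + (cmod (\<phi> g))\<^sup>2) = of_real (M\<^sup>2)"
      by (simp add: complex_norm_square del: of_real_power)
    then have "(cmod (\<phi> h))\<^sup>2 + (cmod (\<phi> g))\<^sup>2 = M\<^sup>2" by (simp only: of_real_eq_iff)
    then have "(cmod (\<phi> h))\<^sup>2 \<le> M\<^sup>2" using zero_le_power2[of "cmod (\<phi> g)"] by linarith
    then show ?thesis using M(2) by (rule power2_le_imp_le)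
  qed
  have poly: "\<phi> (\<lambda>t. poly p (of_real t)) = poly p (of_real s)" for p
  proof (induction p)
    case 0
    show ?case using const[of 0] by simp
  next
    case (pCons c p)
    have "continuous01 (\<lambda>t. c)" "continuous01 (\<lambda>t. of_real t * poly p (of_real t))"
      "continuous01 complex_of_real" by (intro continuous_intros)+
    then show ?case
      using pCons by (simp add: add mult const ident continuous01_poly)
  qed
  have "cmod (\<phi> f - f s) \<le> e" if "e > 0" for e
  proof -
    have "e/2 > 0" using that by simp
    then obtain n where n: "\<And>t. t \<in> {0..1} \<Longrightarrow> cmod (poly (bernstein_poly n f) (of_real t) - f t) < e/2"
      using bernstein_approximation[OF f] by blast
    let ?p = "\<lambda>t::real. poly (bernstein_poly n f) (of_real t)"
    have c: "continuous01 (\<lambda>t. ?p t - f t)" by (intro continuous_intros f)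
    have "\<phi> (\<lambda>t. (?p t - f t) + f t) = \<phi> (\<lambda>t. ?p t - f t) + \<phi> f" by (rule add[OF c f])
    then have "\<phi> f - f s = (?p s - f s) - \<phi> (\<lambda>t. ?p t - f t)" by (simp add: poly)
    also have "cmod \<dots> \<le> cmod (?p s - f s) + cmod (\<phi> (\<lambda>t. ?p t - f t))" by (rule norm_triangle_ineq4)
    also have "cmod (\<phi> (\<lambda>t. ?p t - f t)) \<le> e/2"
      by (rule bound[OF c]) (use n that in \<open>auto intro: less_imp_le\<close>)
    finally show ?thesis using n[OF s] by simp
  qed
  then have "cmod (\<phi> f - f s) \<le> 0 + e" if "e > 0" for e using that by simp
  then have "cmod (\<phi> f - f s) \<le> 0" by (rule field_le_epsilon)
  then show ?thesis by simp
qed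

section \<open>Cosets of compact operators\<close>

definition calkin_coset :: "(h2 \<Rightarrow>\<^sub>L h2) \<Rightarrow> (h2 \<Rightarrow>\<^sub>L h2) set"
  where "calkin_coset T = {S. S - T \<in> compact_operators}"

lemma calkin_coset_refl: "T \<in> calkin_coset T"
  by (simp add: calkin_coset_def compact_operators_0)

lemma calkin_coset_eq_iff: "calkin_coset S = calkin_coset T \<longleftrightarrow> S - T \<in> compact_operators"
proof
  assume "calkin_coset S = calkin_coset T"
  then show "S - T \<in> compact_operators"
    using calkin_coset_refl[of S] by (simp add: calkin_coset_def)
next
  assume st: "S - T \<in> compact_operators"
  have "R - S \<in> compact_operators \<longleftrightarrow> R - T \<in> compact_operators" for R
    using compact_operators_add[OF _ st, of "R - S"] compact_operators_diff[OF _ st, of "R - T"] by auto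
  then show "calkin_coset S = calkin_coset T" by (simp add: calkin_coset_def)
qed

lemma a_r_coset_compact: "compact_operators +>\<^bsub>operator_algebra A\<^esub> T = calkin_coset T"
proof -
  have "S \<in> compact_operators +>\<^bsub>operator_algebra A\<^esub> T \<longleftrightarrow> S - T \<in> compact_operators" for S
  proof -
    have "S \<in> compact_operators +>\<^bsub>operator_algebra A\<^esub> T \<longleftrightarrow> (\<exists>K\<in>compact_operators. S = K + T)"
      by (simp add: a_r_coset_def' operator_algebra_def)
    also have "\<dots> \<longleftrightarrow> S - T \<in> compact_operators"
      by (metis add_diff_cancel_right' diff_add_cancel)
    finally show ?thesis .
  qed
  then show ?thesis by (auto simp: calkin_coset_def)
qed

lemma calkin_coset_bounded:
  assumes "T \<in> bounded_operators" "S \<in> calkin_coset T"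
  shows "S \<in> bounded_operators"
proof -
  have "S - T \<in> bounded_operators"
    using assms(2) by (simp add: calkin_coset_def compact_operators_bounded)
  from bounded_operators_add[OF this assms(1)] show ?thesis by simp
qed

text \<open>The operations of the quotient algebra are unions of cosets over all representatives; these
  unions collapse to a single coset.\<close>

lemma calkin_coset_UN:
  assumes "\<And>S. S \<in> calkin_coset T \<Longrightarrow> calkin_coset (F S) = calkin_coset (F T)"
  shows "(\<Union>S\<in>calkin_coset T. calkin_coset (F S)) = calkin_coset (F T)"
proof -
  have "(\<Union>S\<in>calkin_coset T. calkin_coset (F S)) = (\<Union>S\<in>calkin_coset T. calkin_coset (F T))"
    by (intro SUP_cong refl assms)
  also have "\<dots> = calkin_coset (F T)" using calkin_coset_refl[of T] by blast
  finally show ?thesis .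
qed

lemma calkin_coset_mult:
  assumes S: "S \<in> bounded_operators" and T: "T \<in> bounded_operators"
    and S': "S' \<in> calkin_coset S" and T': "T' \<in> calkin_coset T"
  shows "calkin_coset (S' o\<^sub>L T') = calkin_coset (S o\<^sub>L T)"
proof -
  have "(S' o\<^sub>L T') - (S o\<^sub>L T) = (S' o\<^sub>L (T' - T)) + ((S' - S) o\<^sub>L T)"
    by (rule blinfun_eqI) (simp add: plus_blinfun.rep_eq minus_blinfun.rep_eq blinfun.diff_right)
  moreover have "\<dots> \<in> compact_operators"
    using calkin_coset_bounded[OF S S'] S' T' T
    by (intro compact_operators_add compact_operators_compose_left compact_operators_compose_right)
      (auto simp: calkin_coset_def)
  ultimately show ?thesis unfolding calkin_coset_eq_iff by simp
qed

context boundary_point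
begin

abbreviation quotient :: "(h2 \<Rightarrow>\<^sub>L h2) set star_algebra"
  where "quotient \<equiv> quotient_star_algebra (parabolic_cstar_algebra \<gamma>) compact_operators"

lemma carrier_quotient: "carrier quotient = calkin_coset ` parabolic_algebra"
  by (auto simp: quotient_star_algebra_def FactRing_def A_RCOSETS_def' parabolic_cstar_algebra_def
      a_r_coset_compact) (auto simp: operator_algebra_def)

lemma one_quotient: "one quotient = calkin_coset id_blinfun"
  by (simp add: quotient_star_algebra_def FactRing_def parabolic_cstar_algebra_def a_r_coset_compact)
    (simp add: operator_algebra_def)

lemma add_quotient: "calkin_coset S \<oplus>\<^bsub>quotient\<^esub> calkin_coset T = calkin_coset (S + T)"
proof -
  have "calkin_coset S \<oplus>\<^bsub>quotient\<^esub> calkin_coset T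
      = (\<Union>S'\<in>calkin_coset S. \<Union>T'\<in>calkin_coset T. {S' + T'})"
    by (simp add: quotient_star_algebra_def FactRing_def set_add_def' parabolic_cstar_algebra_def
        operator_algebra_def)
  also have "\<dots> = calkin_coset (S + T)"
  proof (intro equalityI subsetI)
    fix R assume "R \<in> (\<Union>S'\<in>calkin_coset S. \<Union>T'\<in>calkin_coset T. {S' + T'})"
    then obtain S' T' where "S' - S \<in> compact_operators" "T' - T \<in> compact_operators" "R = S' + T'"
      by (auto simp: calkin_coset_def)
    then show "R \<in> calkin_coset (S + T)"
      using compact_operators_add[of "S' - S" "T' - T"] by (simp add: calkin_coset_def algebra_simps)
  next
    fix R assume "R \<in> calkin_coset (S + T)"
    then have "R - T \<in> calkin_coset S" by (simp add: calkin_coset_def algebra_simps)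
    then show "R \<in> (\<Union>S'\<in>calkin_coset S. \<Union>T'\<in>calkin_coset T. {S' + T'})"
      using calkin_coset_refl[of T] by (intro UN_I[of "R - T"] UN_I[of T]) auto
  qed
  finally show ?thesis .
qed

lemma mult_quotient:
  assumes "S \<in> bounded_operators" "T \<in> bounded_operators"
  shows "calkin_coset S \<otimes>\<^bsub>quotient\<^esub> calkin_coset T = calkin_coset (S o\<^sub>L T)"
proof -
  have "calkin_coset S \<otimes>\<^bsub>quotient\<^esub> calkin_coset T
      = (\<Union>S'\<in>calkin_coset S. \<Union>T'\<in>calkin_coset T. calkin_coset (S' o\<^sub>L T'))"
    by (simp add: quotient_star_algebra_def FactRing_def rcoset_mult_def parabolic_cstar_algebra_def
        a_r_coset_compact) (simp add: operator_algebra_def)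
  also have "\<dots> = (\<Union>S'\<in>calkin_coset S. \<Union>T'\<in>calkin_coset T. calkin_coset (S o\<^sub>L T))"
    by (intro SUP_cong refl calkin_coset_mult assms)
  also have "\<dots> = calkin_coset (S o\<^sub>L T)"
    using calkin_coset_refl[of S] calkin_coset_refl[of T] by blast
  finally show ?thesis .
qed

lemma smult_quotient: "c \<odot>\<^bsub>quotient\<^esub> calkin_coset T = calkin_coset (op_scaleC c T)"
proof -
  have "c \<odot>\<^bsub>quotient\<^esub> calkin_coset T = (\<Union>S\<in>calkin_coset T. calkin_coset (op_scaleC c S))"
    by (simp add: quotient_star_algebra_def parabolic_cstar_algebra_def a_r_coset_compact)
      (simp add: operator_algebra_def)
  also have "\<dots> = calkin_coset (op_scaleC c T)"
  proof (rule calkin_coset_UN)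
    fix S assume "S \<in> calkin_coset T"
    then have "op_scaleC c (S - T) \<in> compact_operators"
      by (intro compact_operators_scaleC) (simp add: calkin_coset_def)
    then show "calkin_coset (op_scaleC c S) = calkin_coset (op_scaleC c T)"
      unfolding calkin_coset_eq_iff by (simp add: complex_op.scale_right_diff_distrib)
  qed
  finally show ?thesis .
qed

lemma star_quotient:
  assumes T: "T \<in> bounded_operators"
  shows "star quotient (calkin_coset T) = calkin_coset (op_adjoint T)"
proof -
  have "star quotient (calkin_coset T) = (\<Union>S\<in>calkin_coset T. calkin_coset (op_adjoint S))"
    by (simp add: quotient_star_algebra_def parabolic_cstar_algebra_def a_r_coset_compact)
      (simp add: operator_algebra_def)
  also have "\<dots> = calkin_coset (op_adjoint T)"
  proof (rule calkin_coset_UN)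
    fix S assume S: "S \<in> calkin_coset T"
    then have "op_adjoint (S - T) \<in> compact_operators"
      by (intro compact_operators_adjoint) (simp add: calkin_coset_def)
    then show "calkin_coset (op_adjoint S) = calkin_coset (op_adjoint T)"
      unfolding calkin_coset_eq_iff by (simp add: op_adjoint_diff T calkin_coset_bounded[OF T S])
  qed
  finally show ?thesis .
qed

section \<open>The isomorphism\<close>

text \<open>Outside the carrier the value is \<^const>\<open>undefined\<close>, as extensionality demands.\<close>

definition symbol_map :: "(real \<Rightarrow> complex) \<Rightarrow> (h2 \<Rightarrow>\<^sub>L h2) set"
  where "symbol_map = (\<lambda>f\<in>carrier C01. calkin_coset (mult_op f))"

lemma carrier_C01: "f \<in> carrier C01 \<longleftrightarrow> f \<in> extensional {0..1} \<and> continuous01 f"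
  by (simp add: C01_def)

lemma restrict_in_C01: "continuous01 f \<Longrightarrow> restrict f {0..1} \<in> carrier C01"
  unfolding carrier_C01
  by (subst continuous_on_cong[OF refl, of _ _ f]) (auto simp: restrict_extensional)

lemma symbol_map_restrict:
  assumes "continuous01 f"
  shows "symbol_map (restrict f {0..1}) = calkin_coset (mult_op f)"
proof -
  have "mult_op (restrict f {0..1}) = mult_op f" by (rule mult_op_cong) simp
  then show ?thesis by (simp add: symbol_map_def restrict_in_C01[OF assms])
qed

lemma symbol_map_power:
  assumes a: "Re a > 0"
  shows "symbol_map (power_function a)
    = compact_operators +>\<^bsub>parabolic_cstar_algebra \<gamma>\<^esub> composition_operator (parabolic_map \<gamma> a)"
proof -
  have "power_function a \<in> carrier C01"
    unfolding carrier_C01 by (simp add: continuous01_power_function[OF a]) (simp add: power_function_def)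
  then have "symbol_map (power_function a) = calkin_coset (mult_op (power_function a))"
    by (simp add: symbol_map_def)
  also have "\<dots> = calkin_coset (parabolic_op a)"
    using parabolic_op_mod_compact[OF a] by (simp add: calkin_coset_eq_iff[symmetric])
  finally show ?thesis
    by (simp add: parabolic_cstar_algebra_def a_r_coset_compact composition_operator_parabolic[OF a])
qed

lemma C01_operations:
  shows "f \<otimes>\<^bsub>C01\<^esub> g = (\<lambda>t\<in>{0..1}. f t * g t)" and "f \<oplus>\<^bsub>C01\<^esub> g = (\<lambda>t\<in>{0..1}. f t + g t)"
    and "c \<odot>\<^bsub>C01\<^esub> f = (\<lambda>t\<in>{0..1}. c * f t)" and "star C01 f = (\<lambda>t\<in>{0..1}. cnj (f t))"
    and "\<one>\<^bsub>C01\<^esub> = (\<lambda>t\<in>{0..1}. 1)"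
  by (simp_all add: C01_def)

text \<open>Three earlier results enter besides the algebraic rules for \<^const>\<open>mult_op\<close>: lifts show that the
  values are cosets of elements of the algebra, uniqueness of the symbol gives injectivity, and the
  fact that all elements of the algebra have symbols gives surjectivity.\<close>

lemma symbol_map_star_iso: "symbol_map \<in> star_iso C01 quotient"
proof -
  have map: "symbol_map f = calkin_coset (mult_op f)" if "f \<in> carrier C01" for f
    using that by (simp add: symbol_map_def)
  have cont: "continuous01 f" if "f \<in> carrier C01" for f using that by (simp add: carrier_C01)
  have "symbol_map \<in> ring_iso C01 quotient"
  proof (rule ring_iso_memI)
    show "symbol_map f \<in> carrier quotient" if f: "f \<in> carrier C01" for f
    proof -
      obtain T where T: "T \<in> parabolic_algebra" "ess_mult T f" using lift_exists[OF cont[OF f]] by blast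
      then have "calkin_coset T = calkin_coset (mult_op f)" by (simp add: calkin_coset_eq_iff ess_mult_def)
      then show ?thesis unfolding map[OF f] carrier_quotient using T(1) by blast
    qed
    show "symbol_map (f \<otimes>\<^bsub>C01\<^esub> g) = symbol_map f \<otimes>\<^bsub>quotient\<^esub> symbol_map g"
      if "f \<in> carrier C01" "g \<in> carrier C01" for f g
    proof -
      have "continuous01 (\<lambda>t. f t * g t)" by (intro continuous_intros cont that)
      then show ?thesis
        by (simp add: C01_operations symbol_map_restrict map that mult_quotient mult_op_bounded cont mult_op_mult)
    qed
    show "symbol_map (f \<oplus>\<^bsub>C01\<^esub> g) = symbol_map f \<oplus>\<^bsub>quotient\<^esub> symbol_map g"
      if "f \<in> carrier C01" "g \<in> carrier C01" for f g
    proof -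
      have "continuous01 (\<lambda>t. f t + g t)" by (intro continuous_intros cont that)
      then show ?thesis
        by (simp add: C01_operations symbol_map_restrict map that add_quotient cont mult_op_add)
    qed
    show "symbol_map \<one>\<^bsub>C01\<^esub> = \<one>\<^bsub>quotient\<^esub>"
      by (simp add: C01_operations symbol_map_restrict one_quotient mult_op_1)
    show "bij_betw symbol_map (carrier C01) (carrier quotient)"
      unfolding bij_betw_def
    proof (intro conjI inj_onI equalityI subsetI)
      fix f g assume fg: "f \<in> carrier C01" "g \<in> carrier C01" "symbol_map f = symbol_map g"
      then have "ess_mult (mult_op f) g" by (simp add: map calkin_coset_eq_iff ess_mult_def cont)
      then have "f t = g t" if "t \<in> {0..1}" for t
        using ess_mult_unique[OF ess_mult_mult_op[OF cont[OF fg(1)]] _ that] by blast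
      then show "f = g" using fg(1,2) unfolding carrier_C01 by (blast intro: extensionalityI)
    next
      fix X assume "X \<in> symbol_map ` carrier C01"
      then show "X \<in> carrier quotient" using \<open>\<And>f. f \<in> carrier C01 \<Longrightarrow> symbol_map f \<in> carrier quotient\<close> by blast
    next
      fix X assume "X \<in> carrier quotient"
      then obtain T where T: "T \<in> parabolic_algebra" "X = calkin_coset T" unfolding carrier_quotient by blast
      then obtain f where f: "ess_mult T f" using parabolic_algebra_generated(3) by blast
      then have "X = symbol_map (restrict f {0..1})"
        by (simp add: T(2) symbol_map_restrict calkin_coset_eq_iff ess_mult_def)
      then show "X \<in> symbol_map ` carrier C01" using f restrict_in_C01 unfolding ess_mult_def by blast
    qed
  qed
  moreover have "symbol_map (c \<odot>\<^bsub>C01\<^esub> f) = c \<odot>\<^bsub>quotient\<^esub> symbol_map f" if "f \<in> carrier C01" for c f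
  proof -
    have "continuous01 (\<lambda>t. c * f t)" by (intro continuous_intros cont that)
    then show ?thesis
      by (simp add: C01_operations symbol_map_restrict map that smult_quotient cont mult_op_cmult)
  qed
  moreover have "symbol_map (star C01 f) = star quotient (symbol_map f)" if "f \<in> carrier C01" for f
  proof -
    have "continuous01 (\<lambda>t. cnj (f t))" by (intro continuous_intros cont that)
    then show ?thesis
      by (simp add: C01_operations symbol_map_restrict map that star_quotient mult_op_bounded cont op_adjoint_mult_op)
  qed
  ultimately show ?thesis unfolding star_iso_def by blast
qed

text \<open>Composing a competitor with the inverse of \<open>symbol_map\<close> gives an endomorphism of
  the algebra of continuous functions that fixes the coordinate function, so followed by an
  evaluation it is that evaluation.\<close>

lemma symbol_map_unique:
  assumes ext: "\<Gamma> \<in> extensional (carrier C01)" and iso: "\<Gamma> \<in> star_iso C01 quotient"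
    and power: "\<Gamma> (power_function 1) = symbol_map (power_function 1)"
  shows "\<Gamma> = symbol_map"
proof -
  have bij: "bij_betw symbol_map (carrier C01) (carrier quotient)"
    using symbol_map_star_iso by (simp add: star_iso_def ring_iso_def)
  have iso_rules: "G x \<in> carrier quotient" "G (x \<otimes>\<^bsub>C01\<^esub> y) = G x \<otimes>\<^bsub>quotient\<^esub> G y"
    "G (x \<oplus>\<^bsub>C01\<^esub> y) = G x \<oplus>\<^bsub>quotient\<^esub> G y" "G \<one>\<^bsub>C01\<^esub> = \<one>\<^bsub>quotient\<^esub>"
    "G (c \<odot>\<^bsub>C01\<^esub> x) = c \<odot>\<^bsub>quotient\<^esub> G x" "G (star C01 x) = star quotient (G x)"
    if "G \<in> star_iso C01 quotient" "x \<in> carrier C01" "y \<in> carrier C01" for G x y c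
    using that ring_iso_memE[of G C01 quotient] by (simp_all add: star_iso_def)
  define \<theta> where "\<theta> f = inv_into (carrier C01) symbol_map (\<Gamma> f)" for f
  have \<theta>: "\<theta> f \<in> carrier C01" "symbol_map (\<theta> f) = \<Gamma> f" if "f \<in> carrier C01" for f
  proof -
    have "\<Gamma> f \<in> symbol_map ` carrier C01"
      using iso_rules(1)[OF iso that that] bij by (simp add: bij_betw_def)
    then show "\<theta> f \<in> carrier C01" "symbol_map (\<theta> f) = \<Gamma> f"
      unfolding \<theta>_def by (rule inv_into_into, rule f_inv_into_f)
  qed
  have \<theta>_eqI: "\<theta> f = g" if "f \<in> carrier C01" "g \<in> carrier C01" "\<Gamma> f = symbol_map g" for f g
    using \<theta>[OF that(1)] that bij by (auto simp: bij_betw_def dest: inj_onD)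
  have closed: "f \<otimes>\<^bsub>C01\<^esub> g \<in> carrier C01" "f \<oplus>\<^bsub>C01\<^esub> g \<in> carrier C01" "c \<odot>\<^bsub>C01\<^esub> f \<in> carrier C01"
    "star C01 f \<in> carrier C01" "\<one>\<^bsub>C01\<^esub> \<in> carrier C01" if "f \<in> carrier C01" "g \<in> carrier C01" for f g c
    unfolding C01_operations
    by (intro restrict_in_C01 continuous_intros; use that in \<open>simp add: carrier_C01\<close>)+
  have \<theta>_mult: "\<theta> (f \<otimes>\<^bsub>C01\<^esub> g) = \<theta> f \<otimes>\<^bsub>C01\<^esub> \<theta> g"
    and \<theta>_add: "\<theta> (f \<oplus>\<^bsub>C01\<^esub> g) = \<theta> f \<oplus>\<^bsub>C01\<^esub> \<theta> g"
    and \<theta>_smult: "\<theta> (c \<odot>\<^bsub>C01\<^esub> f) = c \<odot>\<^bsub>C01\<^esub> \<theta> f"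
    and \<theta>_star: "\<theta> (star C01 f) = star C01 (\<theta> f)"
    and \<theta>_one: "\<theta> \<one>\<^bsub>C01\<^esub> = \<one>\<^bsub>C01\<^esub>"
    if f: "f \<in> carrier C01" and g: "g \<in> carrier C01" for f g c
    by (rule \<theta>_eqI;
        simp add: closed[OF f g] closed[OF \<theta>(1)[OF f] \<theta>(1)[OF g]] f g \<theta> iso_rules[OF iso f g] iso_rules[OF symbol_map_star_iso \<theta>(1)[OF f] \<theta>(1)[OF g]])+
  have x: "power_function 1 \<in> carrier C01"
    unfolding carrier_C01 by (simp add: continuous01_power_function) (simp add: power_function_def)
  have \<theta>_x: "\<theta> (power_function 1) = power_function 1" by (rule \<theta>_eqI[OF x x power])
  have \<theta>_id: "\<theta> f s = f s" if f: "f \<in> carrier C01" and s: "s \<in> {0..1}" for f s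
  proof -
    define \<phi> where "\<phi> f = \<theta> (restrict f {0..1}) s" for f
    have "\<phi> f = f s"
    proof (rule character_eq_evaluation[OF _ _ _ _ _ _ _ s])
      show "continuous01 f" using f by (simp add: carrier_C01)
      show "\<phi> f = \<phi> g" if "\<And>t. t \<in> {0..1} \<Longrightarrow> f t = g t" for f g
        unfolding \<phi>_def by (rule arg_cong[where f = "\<lambda>f. \<theta> f s"], rule restrict_ext) (use that in simp)
      fix f g assume f: "continuous01 f" and g: "continuous01 g"
      note fg = restrict_in_C01[OF f] restrict_in_C01[OF g]
      have "restrict (\<lambda>t. f t + g t) {0..1} = restrict f {0..1} \<oplus>\<^bsub>C01\<^esub> restrict g {0..1}"
        by (auto simp: C01_operations)
      then show "\<phi> (\<lambda>t. f t + g t) = \<phi> f + \<phi> g"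
        using s by (simp add: \<phi>_def \<theta>_add[OF fg]) (simp add: C01_operations)
      have "restrict (\<lambda>t. f t * g t) {0..1} = restrict f {0..1} \<otimes>\<^bsub>C01\<^esub> restrict g {0..1}"
        by (auto simp: C01_operations)
      then show "\<phi> (\<lambda>t. f t * g t) = \<phi> f * \<phi> g"
        using s by (simp add: \<phi>_def \<theta>_mult[OF fg]) (simp add: C01_operations)
    next
      fix f c assume f: "continuous01 f"
      note ff = restrict_in_C01[OF f] restrict_in_C01[OF f]
      have "restrict (\<lambda>t. c * f t) {0..1} = c \<odot>\<^bsub>C01\<^esub> restrict f {0..1}"
        by (auto simp: C01_operations)
      then show "\<phi> (\<lambda>t. c * f t) = c * \<phi> f"
        using s by (simp add: \<phi>_def \<theta>_smult[OF ff]) (simp add: C01_operations)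
    next
      fix f assume f: "continuous01 f"
      note ff = restrict_in_C01[OF f] restrict_in_C01[OF f]
      have "restrict (\<lambda>t. cnj (f t)) {0..1} = star C01 (restrict f {0..1})"
        by (auto simp: C01_operations)
      then show "\<phi> (\<lambda>t. cnj (f t)) = cnj (\<phi> f)"
        using s by (simp add: \<phi>_def \<theta>_star[OF ff]) (simp add: C01_operations)
    next
      have "restrict (\<lambda>t. 1) {0..1} = \<one>\<^bsub>C01\<^esub>" by (simp add: C01_operations)
      then show "\<phi> (\<lambda>t. 1) = 1"
        using s by (simp add: \<phi>_def \<theta>_one[OF x x]) (simp add: C01_operations)
    next
      have "restrict complex_of_real {0..1} = power_function 1"
        by (auto simp: power_function_def)
      then show "\<phi> complex_of_real = complex_of_real s"
        using s by (simp add: \<phi>_def \<theta>_x) (simp add: power_function_def)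
    qed
    moreover have "restrict f {0..1} = f" using f by (simp add: carrier_C01 extensional_restrict)
    ultimately show ?thesis by (simp add: \<phi>_def)
  qed
  have "\<Gamma> f = symbol_map f" for f
  proof (cases "f \<in> carrier C01")
    case True
    have "\<theta> f = f"
      by (rule extensionalityI[of _ "{0..1}"]) (use True \<theta>(1)[OF True] \<theta>_id[OF True] in \<open>auto simp: carrier_C01\<close>)
    then show ?thesis using \<theta>(2)[OF True] by simp
  next
    case False
    then show ?thesis using ext by (simp add: extensional_def symbol_map_def)
  qed
  then show ?thesis by blast
qed

end

theorem theorem3:
  fixes \<gamma> :: complex
  assumes "cmod \<gamma> = 1"
  shows "\<exists>!\<Gamma>. \<Gamma> \<in> extensional (carrier C01) \<and>
    \<Gamma> \<in> star_iso C01 (quotient_star_algebra (parabolic_cstar_algebra \<gamma>) compact_operators) \<and>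
    (\<forall>a. Re a > 0 \<longrightarrow>
      \<Gamma> (power_function a) =
        compact_operators +>\<^bsub>parabolic_cstar_algebra \<gamma>\<^esub>
          composition_operator (parabolic_map \<gamma> a))"
proof -
  interpret boundary_point \<gamma> by unfold_locales fact
  show ?thesis
  proof (rule ex1I[of _ symbol_map], intro conjI allI impI)
    show "symbol_map \<in> extensional (carrier C01)" by (simp add: symbol_map_def)
    show "symbol_map \<in> star_iso C01 quotient" by (rule symbol_map_star_iso)
  qed (use symbol_map_power symbol_map_unique in auto)
qed

end
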